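(* Let $(M=B\times_f F,g^f,\Pi)$ be a pseudo-Riemannian Poisson warped product space with $\dim(F)=s_2>1$, where $f$ is a Casimir function on $B$. Suppose that the fiber space $F$ has constant scalar curvature $S_F=\mu\neq 0$. Then $g^f$ admits the following warping function $f$ for which $M$ has a constant scalar curvature $\mu_1$: (a) if $\mu_1>S_B$ and $\mu>0$: $f=\sqrt{\dfrac{\mu_1-S_B}{\mu}}$; (b) if $\mu_1<S_B$ and $\mu<0$: $f=\sqrt{\dfrac{\mu_1-S_B}{\mu}}$; (c) if $\mu_1=S_B$, there does not exist such a warping function.
   Context: Contravariant geometry. Let $(N,\Pi)$ be a Poisson manifold with Poisson bivector field $\Pi$. The anchor map $\sharp_\Pi:T^*N\to TN$ is defined by $\beta(\sharp_\Pi(\alpha))=\Pi(\alpha,\beta)$. The Koszul bracket on 1-forms is $[\alpha,\beta]_\Pi=\mathcal L_{\sharp_\Pi(\alpha)}\beta-\mathcal L_{\sharp_\Pi(\beta)}\alpha-d(\Pi(\alpha,\beta))$. A pseudo-Riemannian metric $\tilde g$ on $N$ induces a metric $g$ on $T^*N$ (its cometric) through the isomorphism $X\mapsto\tilde g(X,\cdot)$. The contravariant Levi-Civita connection of $(\Pi,g)$ is the unique $\mathbb R$-bilinear map $\mathcal D:\Gamma(T^*N)\times\Gamma(T^*N)\to\Gamma(T^*N)$ with $\mathcal D_{u\alpha}\beta=u\mathcal D_\alpha\beta$, $\mathcal D_\alpha(u\beta)=u\mathcal D_\alpha\beta+\sharp_\Pi(\alpha)(u)\beta$ for $u\in C^\infty(N)$,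 $\mathcal D_\alpha\beta-\mathcal D_\beta\alpha=[\alpha,\beta]_\Pi$, and $\sharp_\Pi(\alpha)(g(\beta,\gamma))=g(\mathcal D_\alpha\beta,\gamma)+g(\beta,\mathcal D_\alpha\gamma)$. Its curvature is $\mathcal R(\alpha,\beta)\gamma=\mathcal D_\alpha\mathcal D_\beta\gamma-\mathcal D_\beta\mathcal D_\alpha\gamma-\mathcal D_{[\alpha,\beta]_\Pi}\gamma$. For a local $g$-orthonormal coframe $\{\eta_i\}$, the Ricci curvature is $Ric(\alpha,\beta)=\sum_i g(\mathcal R(\alpha,\eta_i)\eta_i,\beta)$ and the scalar curvature is $S=\sum_i Ric(\eta_i,\eta_i)$. The triple $(N,g,\Pi)$ is a pseudo-Riemannian Poisson manifold if $\mathcal D\Pi=0$, i.e. $\sharp_\Pi(\alpha)(\Pi(\beta,\gamma))-\Pi(\mathcal D_\alpha\beta,\gamma)-\Pi(\beta,\mathcal D_\alpha\gamma)=0$ for all 1-forms $\alpha,\beta,\gamma$. A smooth function $f$ is a Casimir function if $\sharp_\Pi(df)=0$. Warped products. Let $(B,\tilde g_B)$ (the base space) and $(F,\tilde g_F)$ (the fiber space) be pseudo-Riemannian manifolds of positive dimensions with cometrics $g_B,g_F$ and Poisson bivector fields $\Pi_B,\Pi_F$; let $f>0$ be a smooth function on $B$ (the warping function), and let $\pi,\sigma$ be the projections of $B\times F$ onto $B$ and $F$. Put $u^h=u\circ\pi$, $\alpha_1^h=\pi^*\alpha_1$ for functions and 1-forms on $B$, and $w^v=w\circ\sigma$, $\alpha_2^v=\sigma^*\alpha_2$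 for functions and 1-forms on $F$. On $M=B\times_fF$ (the manifold $B\times F$) one takes the warped metric $\tilde g^f=\pi^*\tilde g_B+(f^h)^2\sigma^*\tilde g_F$, whose cometric $g^f$ satisfies $g^f(\alpha_1^h,\beta_1^h)=g_B(\alpha_1,\beta_1)^h$, $g^f(\alpha_1^h,\beta_2^v)=0$, $g^f(\alpha_2^v,\beta_2^v)=\frac1{(f^h)^2}g_F(\alpha_2,\beta_2)^v$, and the bivector field $\Pi=\Pi_B+\Pi_F$ given by $\Pi(\alpha_1^h,\beta_1^h)=\Pi_B(\alpha_1,\beta_1)^h$, $\Pi(\alpha_1^h,\beta_2^v)=0$, $\Pi(\alpha_2^v,\beta_2^v)=\Pi_F(\alpha_2,\beta_2)^v$. The triple $(M,g^f,\Pi)$ is a pseudo-Riemannian Poisson warped product space if it is a pseudo-Riemannian Poisson manifold. $S_B$ and $S_F$ denote the scalar curvatures of $(B,\Pi_B,g_B)$ and $(F,\Pi_F,g_F)$; the scalar curvature of $M$ is that of $(M,\Pi,g^f)$, all taken with respect to the contravariant Levi-Civita connections. The quantity $\mu_1$ is a constant.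
   Formalization: M is claimed to have scalar curvature μ₁ for f=√((μ₁−S_B)/μ) only if this f is itself Casimir, which does not follow from the other hypotheses; for indefinite metrics the signs g(η_i,η_i) are added in the sums defining Ric and S, which otherwise depend on the coframe. *)

theory Defs
  imports "HOL-Analysis.Analysis" "HOL-Library.Function_Algebras"
begin

text \<open>
  Manifolds are given by a (not necessarily maximal) smooth atlas on a second countable Hausdorff
  space whose points form a whole type, with the model space \<open>'e\<close>, so that the dimension is
  \<open>DIM('e) \<ge> 1\<close>.  Tensor calculus is done over the ring of globally defined smooth functions:
  vector fields are derivations of that ring, 1-forms are its linear functionals on the module of
  vector fields, and bivector fields and metrics are its bilinear maps on 1-forms and on vector
  fields.

  The operations \<open>+\<close>, \<open>-\<close>, \<open>*\<close>, \<open>0\<close> on functions are the pointwise ones.  Vector fields, 1-forms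
  and contravariant derivatives are set to \<open>0\<close> outside their domain, so that each of these objects
  is determined by its values on that domain.
\<close>

section \<open>Smooth manifolds\<close>

fun Ck_on :: "nat \<Rightarrow> 'e::euclidean_space set \<Rightarrow> ('e \<Rightarrow> 'b::real_normed_vector) \<Rightarrow> bool" where
  "Ck_on 0 S h \<longleftrightarrow> continuous_on S h"
| "Ck_on (Suc k) S h \<longleftrightarrow>
     h differentiable_on S \<and> (\<forall>v. Ck_on k S (\<lambda>x. frechet_derivative h (at x) v))"

text \<open>Only meant for open \<open>S\<close>.\<close>

definition smooth_on :: "'e::euclidean_space set \<Rightarrow> ('e \<Rightarrow> 'b::real_normed_vector) \<Rightarrow> bool" where
  "smooth_on S h \<longleftrightarrow> (\<forall>k. Ck_on k S h)"

type_synonym ('a, 'e) atlas = "('a set \<times> ('a \<Rightarrow> 'e)) set"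

definition smooth_manifold ::
  "('a::{second_countable_topology,t2_space}, 'e::euclidean_space) atlas \<Rightarrow> bool" where
  "smooth_manifold N \<longleftrightarrow>
     (\<Union>(U, \<phi>)\<in>N. U) = UNIV \<and>
     (\<forall>(U, \<phi>)\<in>N. open U \<and> open (\<phi> ` U) \<and> (\<exists>\<phi>'. homeomorphism U (\<phi> ` U) \<phi> \<phi>')) \<and>
     (\<forall>(U, \<phi>)\<in>N. \<forall>(V, \<psi>)\<in>N. smooth_on (\<phi> ` (U \<inter> V)) (\<psi> \<circ> inv_into U \<phi>))"

definition smooth_functions :: "('a, 'e::euclidean_space) atlas \<Rightarrow> ('a \<Rightarrow> real) set" where
  "smooth_functions N = {u. \<forall>(U, \<phi>)\<in>N. smooth_on (\<phi> ` U) (u \<circ> inv_into U \<phi>)}"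

definition prod_atlas ::
  "('a, 'e::euclidean_space) atlas \<Rightarrow> ('b, 'f::euclidean_space) atlas \<Rightarrow> ('a \<times> 'b, 'e \<times> 'f) atlas"
  where
  "prod_atlas B F = {(U \<times> V, map_prod \<phi> \<psi>) | U \<phi> V \<psi>. (U, \<phi>) \<in> B \<and> (V, \<psi>) \<in> F}"

section \<open>Vector fields, 1-forms and bivector fields\<close>

type_synonym 'a vfield = "('a \<Rightarrow> real) \<Rightarrow> 'a \<Rightarrow> real"
type_synonym 'a form = "'a vfield \<Rightarrow> 'a \<Rightarrow> real"
type_synonym 'a bivector = "'a form \<Rightarrow> 'a form \<Rightarrow> 'a \<Rightarrow> real"
type_synonym 'a cometric = "'a form \<Rightarrow> 'a form \<Rightarrow> 'a \<Rightarrow> real"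
type_synonym 'a metric = "'a vfield \<Rightarrow> 'a vfield \<Rightarrow> 'a \<Rightarrow> real"
type_synonym 'a connection = "'a form \<Rightarrow> 'a form \<Rightarrow> 'a form"

text \<open>Multiplication of a vector field or a 1-form by a function.\<close>

definition fscale :: "('a \<Rightarrow> real) \<Rightarrow> ('z \<Rightarrow> 'a \<Rightarrow> real) \<Rightarrow> 'z \<Rightarrow> 'a \<Rightarrow> real" where
  "fscale u T = (\<lambda>z. u * T z)"

definition vector_fields :: "('a, 'e::euclidean_space) atlas \<Rightarrow> 'a vfield set" where
  "vector_fields N = {X.
     (\<forall>u\<in>smooth_functions N. X u \<in> smooth_functions N) \<and>
     (\<forall>u\<in>smooth_functions N. \<forall>v\<in>smooth_functions N. X (u + v) = X u + X v) \<and>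
     (\<forall>c. \<forall>u\<in>smooth_functions N. X ((\<lambda>_. c) * u) = (\<lambda>_. c) * X u) \<and>
     (\<forall>u\<in>smooth_functions N. \<forall>v\<in>smooth_functions N. X (u * v) = X u * v + u * X v) \<and>
     (\<forall>u. u \<notin> smooth_functions N \<longrightarrow> X u = 0)}"

definition one_forms :: "('a, 'e::euclidean_space) atlas \<Rightarrow> 'a form set" where
  "one_forms N = {\<alpha>.
     (\<forall>X\<in>vector_fields N. \<alpha> X \<in> smooth_functions N) \<and>
     (\<forall>X\<in>vector_fields N. \<forall>Y\<in>vector_fields N. \<alpha> (X + Y) = \<alpha> X + \<alpha> Y) \<and>
     (\<forall>u\<in>smooth_functions N. \<forall>X\<in>vector_fields N. \<alpha> (fscale u X) = u * \<alpha> X) \<and>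
     (\<forall>X. X \<notin> vector_fields N \<longrightarrow> \<alpha> X = 0)}"

definition differential :: "('a, 'e::euclidean_space) atlas \<Rightarrow> ('a \<Rightarrow> real) \<Rightarrow> 'a form" where
  "differential N u = (\<lambda>X. if X \<in> vector_fields N then X u else 0)"

definition bivector_field :: "('a, 'e::euclidean_space) atlas \<Rightarrow> 'a bivector \<Rightarrow> bool" where
  "bivector_field N P \<longleftrightarrow>
     (\<forall>\<alpha>\<in>one_forms N. \<forall>\<beta>\<in>one_forms N. P \<alpha> \<beta> \<in> smooth_functions N) \<and>
     (\<forall>\<alpha>\<in>one_forms N. \<forall>\<beta>\<in>one_forms N. \<forall>\<gamma>\<in>one_forms N. P (\<alpha> + \<beta>) \<gamma> = P \<alpha> \<gamma> + P \<beta> \<gamma>) \<and>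
     (\<forall>u\<in>smooth_functions N. \<forall>\<alpha>\<in>one_forms N. \<forall>\<beta>\<in>one_forms N.
        P (fscale u \<alpha>) \<beta> = u * P \<alpha> \<beta>) \<and>
     (\<forall>\<alpha>\<in>one_forms N. \<forall>\<beta>\<in>one_forms N. P \<alpha> \<beta> = - P \<beta> \<alpha>)"

definition poisson_bracket ::
  "('a, 'e::euclidean_space) atlas \<Rightarrow> 'a bivector \<Rightarrow> ('a \<Rightarrow> real) \<Rightarrow> ('a \<Rightarrow> real) \<Rightarrow> 'a \<Rightarrow> real" where
  "poisson_bracket N P u v = P (differential N u) (differential N v)"

definition poisson_bivector :: "('a, 'e::euclidean_space) atlas \<Rightarrow> 'a bivector \<Rightarrow> bool" where
  "poisson_bivector N P \<longleftrightarrow> bivector_field N P \<and>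
     (\<forall>u\<in>smooth_functions N. \<forall>v\<in>smooth_functions N. \<forall>w\<in>smooth_functions N.
        poisson_bracket N P u (poisson_bracket N P v w) +
        poisson_bracket N P v (poisson_bracket N P w u) +
        poisson_bracket N P w (poisson_bracket N P u v) = 0)"

definition sharp :: "('a, 'e::euclidean_space) atlas \<Rightarrow> 'a bivector \<Rightarrow> 'a form \<Rightarrow> 'a vfield" where
  "sharp N P \<alpha> = (THE X. X \<in> vector_fields N \<and> (\<forall>\<beta>\<in>one_forms N. \<beta> X = P \<alpha> \<beta>))"

definition casimir :: "('a, 'e::euclidean_space) atlas \<Rightarrow> 'a bivector \<Rightarrow> ('a \<Rightarrow> real) \<Rightarrow> bool" where
  "casimir N P f \<longleftrightarrow> f \<in> smooth_functions N \<and> sharp N P (differential N f) = 0"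

definition lie_bracket :: "'a vfield \<Rightarrow> 'a vfield \<Rightarrow> 'a vfield" where
  "lie_bracket X Y = (\<lambda>u. X (Y u) - Y (X u))"

definition lie_derivative ::
  "('a, 'e::euclidean_space) atlas \<Rightarrow> 'a vfield \<Rightarrow> 'a form \<Rightarrow> 'a form" where
  "lie_derivative N X \<beta> =
     (\<lambda>Y. if Y \<in> vector_fields N then X (\<beta> Y) - \<beta> (lie_bracket X Y) else 0)"

definition koszul_bracket ::
  "('a, 'e::euclidean_space) atlas \<Rightarrow> 'a bivector \<Rightarrow> 'a form \<Rightarrow> 'a form \<Rightarrow> 'a form" where
  "koszul_bracket N P \<alpha> \<beta> =
     lie_derivative N (sharp N P \<alpha>) \<beta> - lie_derivative N (sharp N P \<beta>) \<alpha>
       - differential N (P \<alpha> \<beta>)"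

section \<open>Metrics and cometrics\<close>

text \<open>
  In the nondegeneracy condition the values \<open>X\<^sub>p\<close> of vector fields exhaust the tangent space at
  \<open>p\<close>, and \<open>X\<^sub>p = 0\<close> is expressed by \<open>X u p = 0\<close> for all \<open>u\<close>.  The signature is arbitrary.
\<close>

definition pseudo_riemannian_metric :: "('a, 'e::euclidean_space) atlas \<Rightarrow> 'a metric \<Rightarrow> bool" where
  "pseudo_riemannian_metric N G \<longleftrightarrow>
     (\<forall>X\<in>vector_fields N. \<forall>Y\<in>vector_fields N. G X Y \<in> smooth_functions N) \<and>
     (\<forall>X\<in>vector_fields N. \<forall>Y\<in>vector_fields N. \<forall>Z\<in>vector_fields N.
        G (X + Y) Z = G X Z + G Y Z) \<and>
     (\<forall>u\<in>smooth_functions N. \<forall>X\<in>vector_fields N. \<forall>Y\<in>vector_fields N.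
        G (fscale u X) Y = u * G X Y) \<and>
     (\<forall>X\<in>vector_fields N. \<forall>Y\<in>vector_fields N. G X Y = G Y X) \<and>
     (\<forall>p. \<forall>X\<in>vector_fields N. (\<forall>Y\<in>vector_fields N. G X Y p = 0) \<longrightarrow>
        (\<forall>u\<in>smooth_functions N. X u p = 0))"

definition flat :: "('a, 'e::euclidean_space) atlas \<Rightarrow> 'a metric \<Rightarrow> 'a vfield \<Rightarrow> 'a form" where
  "flat N G X = (\<lambda>Y. if Y \<in> vector_fields N then G X Y else 0)"

definition cometric :: "('a, 'e::euclidean_space) atlas \<Rightarrow> 'a metric \<Rightarrow> 'a cometric" where
  "cometric N G \<alpha> \<beta> =
     G (inv_into (vector_fields N) (flat N G) \<alpha>) (inv_into (vector_fields N) (flat N G) \<beta>)"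

section \<open>The contravariant Levi-Civita connection and its curvatures\<close>

definition is_levi_civita ::
  "('a, 'e::euclidean_space) atlas \<Rightarrow> 'a bivector \<Rightarrow> 'a cometric \<Rightarrow> 'a connection \<Rightarrow> bool" where
  "is_levi_civita N P g D \<longleftrightarrow>
     (\<forall>\<alpha>\<in>one_forms N. \<forall>\<beta>\<in>one_forms N. D \<alpha> \<beta> \<in> one_forms N) \<and>
     (\<forall>\<alpha> \<beta>. \<not> (\<alpha> \<in> one_forms N \<and> \<beta> \<in> one_forms N) \<longrightarrow> D \<alpha> \<beta> = 0) \<and>
     (\<forall>\<alpha>\<in>one_forms N. \<forall>\<beta>\<in>one_forms N. \<forall>\<gamma>\<in>one_forms N.
        D (\<alpha> + \<beta>) \<gamma> = D \<alpha> \<gamma> + D \<beta> \<gamma> \<and> D \<alpha> (\<beta> + \<gamma>) = D \<alpha> \<beta> + D \<alpha> \<gamma>) \<and>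
     (\<forall>c. \<forall>\<alpha>\<in>one_forms N. \<forall>\<beta>\<in>one_forms N.
        D (fscale (\<lambda>_. c) \<alpha>) \<beta> = fscale (\<lambda>_. c) (D \<alpha> \<beta>) \<and>
        D \<alpha> (fscale (\<lambda>_. c) \<beta>) = fscale (\<lambda>_. c) (D \<alpha> \<beta>)) \<and>
     (\<forall>u\<in>smooth_functions N. \<forall>\<alpha>\<in>one_forms N. \<forall>\<beta>\<in>one_forms N.
        D (fscale u \<alpha>) \<beta> = fscale u (D \<alpha> \<beta>) \<and>
        D \<alpha> (fscale u \<beta>) = fscale u (D \<alpha> \<beta>) + fscale (sharp N P \<alpha> u) \<beta>) \<and>
     (\<forall>\<alpha>\<in>one_forms N. \<forall>\<beta>\<in>one_forms N. D \<alpha> \<beta> - D \<beta> \<alpha> = koszul_bracket N P \<alpha> \<beta>) \<and>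
     (\<forall>\<alpha>\<in>one_forms N. \<forall>\<beta>\<in>one_forms N. \<forall>\<gamma>\<in>one_forms N.
        sharp N P \<alpha> (g \<beta> \<gamma>) = g (D \<alpha> \<beta>) \<gamma> + g \<beta> (D \<alpha> \<gamma>))"

definition levi_civita ::
  "('a, 'e::euclidean_space) atlas \<Rightarrow> 'a bivector \<Rightarrow> 'a cometric \<Rightarrow> 'a connection" where
  "levi_civita N P g = (THE D. is_levi_civita N P g D)"

definition curvature ::
  "('a, 'e::euclidean_space) atlas \<Rightarrow> 'a bivector \<Rightarrow> 'a cometric \<Rightarrow>
     'a form \<Rightarrow> 'a form \<Rightarrow> 'a form \<Rightarrow> 'a form" where
  "curvature N P g \<alpha> \<beta> \<gamma> =
     levi_civita N P g \<alpha> (levi_civita N P g \<beta> \<gamma>)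
     - levi_civita N P g \<beta> (levi_civita N P g \<alpha> \<gamma>)
     - levi_civita N P g (koszul_bracket N P \<alpha> \<beta>) \<gamma>"

text \<open>
  A local orthonormal coframe around \<open>p\<close> is represented by globally defined 1-forms
  \<open>\<eta> 0, \<dots>, \<eta> (DIM('e) - 1)\<close> that are orthonormal on a neighbourhood of \<open>p\<close>: a coframe defined near
  \<open>p\<close> only can be extended after shrinking its domain.  As the cometric may be indefinite,
  orthonormality means \<open>g (\<eta> i) (\<eta> j) = \<plusminus>\<delta>\<^sub>i\<^sub>j\<close>.
\<close>

definition orthonormal_coframe_near ::
  "('a::topological_space, 'e::euclidean_space) atlas \<Rightarrow> 'a cometric \<Rightarrow> 'a \<Rightarrow> (nat \<Rightarrow> 'a form) \<Rightarrow> bool"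
  where
  "orthonormal_coframe_near N g p \<eta> \<longleftrightarrow>
     (\<forall>i<DIM('e). \<eta> i \<in> one_forms N) \<and>
     (\<exists>U. open U \<and> p \<in> U \<and>
       (\<forall>q\<in>U. \<forall>i<DIM('e). \<forall>j<DIM('e).
          if i = j then \<bar>g (\<eta> i) (\<eta> i) q\<bar> = 1 else g (\<eta> i) (\<eta> j) q = 0))"

text \<open>
  The factors \<open>g (\<eta> i) (\<eta> i)\<close> are the signs of the coframe.  They equal \<open>1\<close> for a Riemannian
  cometric and are what makes the sums, which are metric traces, independent of the coframe for an
  indefinite one.
\<close>

definition ricci ::
  "('a::topological_space, 'e::euclidean_space) atlas \<Rightarrow> 'a bivector \<Rightarrow> 'a cometric \<Rightarrow>
     'a form \<Rightarrow> 'a form \<Rightarrow> 'a \<Rightarrow> real" where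
  "ricci N P g \<alpha> \<beta> p = (THE r. \<exists>\<eta>. orthonormal_coframe_near N g p \<eta> \<and>
     r = (\<Sum>i<DIM('e). g (\<eta> i) (\<eta> i) p * g (curvature N P g \<alpha> (\<eta> i) (\<eta> i)) \<beta> p))"

definition scalar_curvature ::
  "('a::topological_space, 'e::euclidean_space) atlas \<Rightarrow> 'a bivector \<Rightarrow> 'a cometric \<Rightarrow> 'a \<Rightarrow> real"
  where
  "scalar_curvature N P g p = (THE s. \<exists>\<eta>. orthonormal_coframe_near N g p \<eta> \<and>
     s = (\<Sum>i<DIM('e). g (\<eta> i) (\<eta> i) p * ricci N P g (\<eta> i) (\<eta> i) p))"

definition pseudo_riemannian_poisson ::
  "('a, 'e::euclidean_space) atlas \<Rightarrow> 'a bivector \<Rightarrow> 'a metric \<Rightarrow> bool" where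
  "pseudo_riemannian_poisson N P G \<longleftrightarrow>
     pseudo_riemannian_metric N G \<and> poisson_bivector N P \<and>
     (\<forall>\<alpha>\<in>one_forms N. \<forall>\<beta>\<in>one_forms N. \<forall>\<gamma>\<in>one_forms N.
        sharp N P \<alpha> (P \<beta> \<gamma>)
        - P (levi_civita N P (cometric N G) \<alpha> \<beta>) \<gamma>
        - P \<beta> (levi_civita N P (cometric N G) \<alpha> \<gamma>) = 0)"

section \<open>Warped products\<close>

text \<open>
  Let \<open>X\<close> be a vector field on the product.  For fixed \<open>w\<close>, the first components of \<open>X\<close> along the
  slice \<open>B \<times> {w}\<close>, that is \<open>b \<mapsto> d\<pi> (X\<^sub>(\<^sub>b\<^sub>,\<^sub>w\<^sub>))\<close>, form a vector field on \<open>B\<close>, which is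
  \<open>push_fst X w\<close>.  Hence the pullback of a form satisfies
  \<open>(\<pi>\<^sup>* \<alpha>) X (b, w) = \<alpha> (push_fst X w) b\<close>; similarly for the second factor.
\<close>

definition push_fst :: "('a \<times> 'b) vfield \<Rightarrow> 'b \<Rightarrow> 'a vfield" where
  "push_fst X w = (\<lambda>u b. X (u \<circ> fst) (b, w))"

definition push_snd :: "('a \<times> 'b) vfield \<Rightarrow> 'a \<Rightarrow> 'b vfield" where
  "push_snd X b = (\<lambda>u w. X (u \<circ> snd) (b, w))"

definition hlift ::
  "('a, 'e::euclidean_space) atlas \<Rightarrow> ('b, 'f::euclidean_space) atlas \<Rightarrow> 'a form \<Rightarrow> ('a \<times> 'b) form"
  where
  "hlift B F \<alpha> = (\<lambda>X. if X \<in> vector_fields (prod_atlas B F)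
     then (\<lambda>(b, w). \<alpha> (push_fst X w) b) else 0)"

definition vlift ::
  "('a, 'e::euclidean_space) atlas \<Rightarrow> ('b, 'f::euclidean_space) atlas \<Rightarrow> 'b form \<Rightarrow> ('a \<times> 'b) form"
  where
  "vlift B F \<alpha> = (\<lambda>X. if X \<in> vector_fields (prod_atlas B F)
     then (\<lambda>(b, w). \<alpha> (push_snd X b) w) else 0)"

definition warped_metric :: "'a metric \<Rightarrow> 'b metric \<Rightarrow> ('a \<Rightarrow> real) \<Rightarrow> ('a \<times> 'b) metric" where
  "warped_metric GB GF f X Y = (\<lambda>(b, w).
     GB (push_fst X w) (push_fst Y w) b + (f b)\<^sup>2 * GF (push_snd X b) (push_snd Y b) w)"

definition is_product_bivector ::
  "('a, 'e::euclidean_space) atlas \<Rightarrow> ('b, 'f::euclidean_space) atlas \<Rightarrow>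
     'a bivector \<Rightarrow> 'b bivector \<Rightarrow> ('a \<times> 'b) bivector \<Rightarrow> bool" where
  "is_product_bivector B F PB PF P \<longleftrightarrow>
     bivector_field (prod_atlas B F) P \<and>
     (\<forall>\<alpha>\<in>one_forms B. \<forall>\<beta>\<in>one_forms B. P (hlift B F \<alpha>) (hlift B F \<beta>) = PB \<alpha> \<beta> \<circ> fst) \<and>
     (\<forall>\<alpha>\<in>one_forms B. \<forall>\<beta>\<in>one_forms F. P (hlift B F \<alpha>) (vlift B F \<beta>) = 0) \<and>
     (\<forall>\<alpha>\<in>one_forms F. \<forall>\<beta>\<in>one_forms F. P (vlift B F \<alpha>) (vlift B F \<beta>) = PF \<alpha> \<beta> \<circ> snd)"

definition warping_function :: "('a, 'e::euclidean_space) atlas \<Rightarrow> ('a \<Rightarrow> real) \<Rightarrow> bool" where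
  "warping_function B f \<longleftrightarrow> f \<in> smooth_functions B \<and> (\<forall>b. f b > 0)"

text \<open>Here \<open>P\<close> is the product bivector field.\<close>

definition poisson_warped_product ::
  "('a, 'e::euclidean_space) atlas \<Rightarrow> ('b, 'f::euclidean_space) atlas \<Rightarrow>
     'a metric \<Rightarrow> 'b metric \<Rightarrow> ('a \<times> 'b) bivector \<Rightarrow> ('a \<Rightarrow> real) \<Rightarrow> bool" where
  "poisson_warped_product B F GB GF P f \<longleftrightarrow>
     warping_function B f \<and> pseudo_riemannian_poisson (prod_atlas B F) P (warped_metric GB GF f)"

definition warped_scalar_curvature ::
  "('a::topological_space, 'e::euclidean_space) atlas \<Rightarrow>
     ('b::topological_space, 'f::euclidean_space) atlas \<Rightarrow>
     'a metric \<Rightarrow> 'b metric \<Rightarrow> ('a \<times> 'b) bivector \<Rightarrow> ('a \<Rightarrow> real) \<Rightarrow> 'a \<times> 'b \<Rightarrow> real" where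
  "warped_scalar_curvature B F GB GF P f =
     scalar_curvature (prod_atlas B F) P (cometric (prod_atlas B F) (warped_metric GB GF f))"

definition casimir_warping_with_scalar ::
  "('a::topological_space, 'e::euclidean_space) atlas \<Rightarrow>
     ('b::topological_space, 'f::euclidean_space) atlas \<Rightarrow>
     'a metric \<Rightarrow> 'b metric \<Rightarrow> 'a bivector \<Rightarrow> ('a \<times> 'b) bivector \<Rightarrow> real \<Rightarrow> ('a \<Rightarrow> real) \<Rightarrow> bool" where
  "casimir_warping_with_scalar B F GB GF PB P \<mu>1 f \<longleftrightarrow>
     poisson_warped_product B F GB GF P f \<and> casimir B PB f \<and>
     (\<forall>x. warped_scalar_curvature B F GB GF P f x = \<mu>1)"

end

theory Submission
  imports Defs
begin

text \<open>
  Let \<open>f\<close> be a Casimir function on \<open>B\<close>.  In the Koszul formula for the warped product, evaluated on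
  lifts of 1-forms from the factors, every derivative of \<open>f\<close> vanishes, so the contravariant
  Levi-Civita connection is the product of the connections of the factors, whatever \<open>f\<close> is.  Hence
  the curvature splits.  An orthonormal coframe of the fibre becomes orthonormal after
  multiplication by \<open>f\<close>, which gives \<open>S = S\<^sub>B + f\<^sup>2 S\<^sub>F\<close>; thus \<open>S = \<mu>\<^sub>1\<close> means
  \<open>f\<^sup>2 = (\<mu>\<^sub>1 - S\<^sub>B) / \<mu>\<close>, which has exactly one positive solution or none.  As the connection does not
  depend on \<open>f\<close> on lifts, the parallelism of \<open>\<Pi>\<close> passes from one Casimir warping function to another.

  Derivations and linear functionals over the ring of global smooth functions are handled locally:
  bump functions make them local operators, and Hadamard's lemma expands derivations in coordinate
  fields.
\<close>

section \<open>Calculus of smooth maps\<close>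

text \<open>In covariant geometry the fibre of a warped product contributes
  \<open>S_F / f^2\<close>; here the power is inverted. Frames consist of 1-forms and the cometric
  of the fibre carries the factor \<open>1 / f^2\<close>, so a coframe is normalised by multiplying
  with \<open>f\<close>. The four slots of the curvature then contribute \<open>f^4\<close>, and
  pairing with the cometric gives back \<open>1 / f^2\<close>.

  The obstacle is that \<open>sharp\<close>, \<open>levi_civita\<close>, \<open>ricci\<close> and
  \<open>scalar_curvature\<close> are definite descriptions over global objects: existence and
  uniqueness must be settled before anything can be computed. Moreover, a 1-form on the product is
  in general not a sum of lifts; it is one only at a single point, with summands depending on that
  point. Identities are therefore phrased as equalities of maps linear over the smooth functions,
  which may be tested on lifts, point by point. The connection is not of this kind in its second
  slot; it is reached through its pairing with a third form.

  The candidate warping function involves \<open>S\<^sub>B\<close>, so being a Casimir function is a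
  genuine condition on it: existence is asserted under that condition, uniqueness among all Casimir
  solutions.\<close>

lemma Ck_on_cong:
  assumes "open S" "\<And>x. x \<in> S \<Longrightarrow> h x = h' x" "Ck_on k S h"
  shows "Ck_on k S h'"
  using assms(2,3)
proof (induction k arbitrary: h h')
  case 0
  then show ?case by (auto intro: continuous_on_eq)
next
  case (Suc k)
  \<comment> \<open>\<open>at x\<close> looks at a full neighbourhood, so agreement on
    \<open>S\<close> determines the derivative only because \<open>S\<close> is open.\<close>
  have fr: "frechet_derivative h (at x) = frechet_derivative h' (at x)" if "x \<in> S" for x
  proof (rule frechet_derivative_transform_within_open[of h x S h'])
    show "h differentiable (at x)"
      using Suc.prems(2) that assms(1) by (simp add: differentiable_on_def at_within_open_NO_MATCH)
  qed (use that assms(1) Suc.prems(1) in auto)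
  show ?case
  proof (simp, intro conjI allI)
    show "h' differentiable_on S"
      unfolding differentiable_on_def differentiable_def
    proof
      fix x assume x: "x \<in> S"
      with Suc.prems(2) obtain D where "(h has_derivative D) (at x within S)"
        by (auto simp: differentiable_on_def differentiable_def)
      from has_derivative_transform[OF x Suc.prems(1)[symmetric] this]
      show "\<exists>D. (h' has_derivative D) (at x within S)" by blast
    qed
    show "Ck_on k S (\<lambda>x. frechet_derivative h' (at x) v)" for v
      by (rule Suc.IH[of "\<lambda>x. frechet_derivative h (at x) v"]) (use Suc.prems fr in auto)
  qed
qed

lemma Ck_on_SucI:
  assumes "open S" "\<And>x. x \<in> S \<Longrightarrow> (h has_derivative h' x) (at x)" "\<And>v. Ck_on k S (\<lambda>x. h' x v)"
  shows "Ck_on (Suc k) S h"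
proof (simp, intro conjI allI)
  show "h differentiable_on S"
    using assms by (auto simp: differentiable_on_def differentiable_def at_within_open_NO_MATCH)
  show "Ck_on k S (\<lambda>x. frechet_derivative h (at x) v)" for v
    by (rule Ck_on_cong[OF assms(1) _ assms(3)[of v]]) (simp add: frechet_derivative_at[OF assms(2), symmetric])
qed

lemma Ck_on_SucD:
  assumes "open S" "Ck_on (Suc k) S h"
  shows "\<And>x. x \<in> S \<Longrightarrow> (h has_derivative frechet_derivative h (at x)) (at x)"
    "\<And>v. Ck_on k S (\<lambda>x. frechet_derivative h (at x) v)"
  using assms by (auto simp: differentiable_on_def at_within_open_NO_MATCH frechet_derivative_works)

lemma Ck_on_SucE: "Ck_on (Suc k) S h \<Longrightarrow> Ck_on k S h"
proof (induction k arbitrary: h)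
  case 0 then show ?case by (simp add: differentiable_imp_continuous_on)
next
  case (Suc k) then show ?case by simp
qed

lemma Ck_on_continuous: "Ck_on k S h \<Longrightarrow> continuous_on S h"
  by (cases k) (auto simp: differentiable_imp_continuous_on)

lemma Ck_on_subset: "open S \<Longrightarrow> T \<subseteq> S \<Longrightarrow> Ck_on k S h \<Longrightarrow> Ck_on k T h"
proof (induction k arbitrary: h)
  case 0 then show ?case by (simp add: continuous_on_subset)
next
  case (Suc k) then show ?case by (auto intro: differentiable_on_subset)
qed

text \<open>Each derivative is the canonical \<open>frechet_derivative h (at x)\<close>, the same
  for every neighbourhood, so the local statements glue without any choice and the induction goes
  through.\<close>

lemma Ck_on_local:
  assumes "open S" "\<And>x. x \<in> S \<Longrightarrow> \<exists>T. open T \<and> x \<in> T \<and> Ck_on k (T \<inter> S) h"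
  shows "Ck_on k S h"
  using assms(2)
proof (induction k arbitrary: h)
  case 0
  show ?case
  proof (simp, intro continuous_at_imp_continuous_on ballI)
    fix x assume "x \<in> S"
    with 0 obtain T where "open T" "x \<in> T" "continuous_on (T \<inter> S) h" by auto
    then show "isCont h x"
      using assms(1) \<open>x \<in> S\<close> continuous_on_eq_continuous_at[of "T \<inter> S" h] by auto
  qed
next
  case (Suc k)
  show ?case
  proof (simp, intro conjI allI)
    show "h differentiable_on S"
      unfolding differentiable_on_def
    proof
      fix x assume "x \<in> S"
      from Suc.prems[OF this] obtain T where T: "open T" "x \<in> T" "h differentiable_on (T \<inter> S)"
        by auto
      then have "h differentiable (at x)"
        using assms(1) \<open>x \<in> S\<close> at_within_open[of x "T \<inter> S"]
        by (metis IntI differentiable_on_def open_Int)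
      then show "h differentiable (at x within S)" by (rule differentiable_at_withinI)
    qed
    show "Ck_on k S (\<lambda>x. frechet_derivative h (at x) v)" for v
    proof (rule Suc.IH)
      fix x assume "x \<in> S"
      from Suc.prems[OF this]
      show "\<exists>T. open T \<and> x \<in> T \<and> Ck_on k (T \<inter> S) (\<lambda>x. frechet_derivative h (at x) v)" by auto
    qed
  qed
qed

lemma Ck_on_const: "open S \<Longrightarrow> Ck_on k S (\<lambda>x. c)"
proof (induction k arbitrary: c)
  case (Suc k)
  show ?case by (rule Ck_on_SucI[where h'="\<lambda>x v. 0"]) (use Suc in auto)
qed simp

lemma Ck_on_linear:
  assumes "open S" "bounded_linear h"
  shows "Ck_on k S h"
proof (cases k)
  case 0
  then show ?thesis using assms by (simp add: linear_continuous_on)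
next
  case (Suc j)
  show ?thesis unfolding Suc
    by (rule Ck_on_SucI[where h'="\<lambda>x. h"])
      (use assms in \<open>auto intro: Ck_on_const bounded_linear_imp_has_derivative\<close>)
qed

lemma Ck_on_add:
  assumes "open S" "Ck_on k S h" "Ck_on k S g"
  shows "Ck_on k S (\<lambda>x. h x + g x)"
  using assms(2,3)
proof (induction k arbitrary: h g)
  case 0
  then show ?case by (simp add: continuous_on_add)
next
  case (Suc k)
  note D = Ck_on_SucD[OF assms(1) Suc.prems(1)] Ck_on_SucD[OF assms(1) Suc.prems(2)]
  show ?case
    by (rule Ck_on_SucI[OF assms(1) has_derivative_add[OF D(1) D(3)]], assumption, assumption)
      (rule Suc.IH[OF D(2,4)])
qed

lemma (in bounded_bilinear) Ck_on_prod:
  assumes "open S" "Ck_on k S h" "Ck_on k S g"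
  shows "Ck_on k S (\<lambda>x. prod (h x) (g x))"
  using assms(2,3)
proof (induction k arbitrary: h g)
  case 0
  then show ?case by (simp add: continuous_on)
next
  case (Suc k)
  note D = Ck_on_SucD[OF assms(1) Suc.prems(1)] Ck_on_SucD[OF assms(1) Suc.prems(2)]
  show ?case
    by (rule Ck_on_SucI[OF assms(1) FDERIV[OF D(1) D(3)]], assumption, assumption)
      (intro Ck_on_add[OF assms(1)] Suc.IH D(2,4) Suc.prems[THEN Ck_on_SucE])
qed

lemmas Ck_on_mult = bounded_bilinear.Ck_on_prod[OF bounded_bilinear_mult]
lemmas Ck_on_scaleR = bounded_bilinear.Ck_on_prod[OF bounded_bilinear_scaleR]
lemmas Ck_on_inner = bounded_bilinear.Ck_on_prod[OF bounded_bilinear_inner]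

lemma Ck_on_sum:
  assumes "open S" "\<And>i. i \<in> A \<Longrightarrow> Ck_on k S (h i)"
  shows "Ck_on k S (\<lambda>x. \<Sum>i\<in>A. h i x)"
  using assms(2)
  by (induction A rule: infinite_finite_induct) (auto intro: assms(1) Ck_on_const Ck_on_add)

lemma linear_Basis_expansion:
  fixes L :: "'e::euclidean_space \<Rightarrow> 'b::real_vector"
  assumes "linear L"
  shows "L v = (\<Sum>b\<in>Basis. (v \<bullet> b) *\<^sub>R L b)"
proof -
  have "L v = L (\<Sum>b\<in>Basis. (v \<bullet> b) *\<^sub>R b)" by (simp add: euclidean_representation)
  then show ?thesis by (simp add: linear_sum[OF assms] linear_cmul[OF assms])
qed

lemma Ck_on_compose:
  fixes g :: "'e::euclidean_space \<Rightarrow> 'f::euclidean_space" and h :: "'f \<Rightarrow> 'b::real_normed_vector"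
  assumes "open S" "open T" "Ck_on k S g" "Ck_on k T h" "\<And>x. x \<in> S \<Longrightarrow> g x \<in> T"
  shows "Ck_on k S (\<lambda>x. h (g x))"
  using assms(3,4)
proof (induction k arbitrary: h)
  case 0
  then show ?case using assms(5) by (auto intro!: continuous_on_compose2[of T h])
next
  case (Suc k)
  note G = Ck_on_SucD[OF assms(1) Suc.prems(1)] and H = Ck_on_SucD[OF assms(2) Suc.prems(2)]
  \<comment> \<open>In \<open>?dh (g x) (?dg x v)\<close> the direction varies with
    \<open>x\<close>, which the induction hypothesis does not cover. Expanding the direction in the
    basis leaves derivatives of \<open>h\<close> in fixed directions, multiplied by scalar
    functions.\<close>
  let ?dg = "\<lambda>x. frechet_derivative g (at x)" and ?dh = "\<lambda>x. frechet_derivative h (at x)"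
  have s: "Ck_on k S (\<lambda>x. \<Sum>b\<in>Basis. (?dg x v \<bullet> b) *\<^sub>R ?dh (g x) b)" for v
    by (intro Ck_on_sum Ck_on_scaleR Ck_on_inner Ck_on_const assms(1) G(2)
        Suc.IH[OF Ck_on_SucE[OF Suc.prems(1)]] H(2))
  have eq: "(\<Sum>b\<in>Basis. (?dg x v \<bullet> b) *\<^sub>R ?dh (g x) b) = ?dh (g x) (?dg x v)" if "x \<in> S" for x v
    using linear_Basis_expansion[OF has_derivative_linear[OF H(1)[OF assms(5)[OF that]]], of "?dg x v"]
    by simp
  have d: "Ck_on k S (\<lambda>x. ?dh (g x) (?dg x v))" for v
    by (rule Ck_on_cong[OF assms(1) eq s])
  show ?case
    by (rule Ck_on_SucI[OF assms(1) has_derivative_compose[OF G(1) H(1)[OF assms(5)]]],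
        assumption, assumption) (rule d)
qed

lemma Ck_on_inverse: "Ck_on k (- {0}) (inverse :: real \<Rightarrow> real)"
proof (induction k)
  case 0
  show ?case by (auto intro!: continuous_intros)
next
  case (Suc k)
  have o: "open (- {0::real})" by auto
  show ?case
  proof (rule Ck_on_SucI[OF o])
    \<comment> \<open>The derivative is written as a product of copies of \<open>inverse\<close> and
      constants, so that the induction hypothesis applies to it.\<close>
    show "(inverse has_derivative (\<lambda>v. (- 1) * (inverse x * (inverse x * v)))) (at x)"
      if "x \<in> - {0::real}" for x
      using that by (auto intro!: derivative_eq_intros)
  qed (intro Ck_on_mult Ck_on_const Suc o)
qed

lemma Ck_on_sqrt: "Ck_on k {0<..} sqrt"
proof (induction k)
  case 0
  show ?case by (auto intro!: continuous_intros)
next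
  case (Suc k)
  have o: "open {0::real<..}" by auto
  show ?case
  proof (rule Ck_on_SucI[OF o])
    show "(sqrt has_derivative (\<lambda>v. inverse (sqrt x) * (v / 2))) (at x)"
      if "x \<in> {0<..}" for x
      by (rule has_derivative_eq_rhs[OF DERIV_real_sqrt[unfolded has_field_derivative_def]])
        (use that in auto)
    show "Ck_on k {0<..} (\<lambda>x. inverse (sqrt x) * (v / 2))" for v
      by (rule Ck_on_mult[OF o Ck_on_compose[OF o _ Suc Ck_on_inverse] Ck_on_const[OF o]]) auto
  qed
qed

text \<open>As a family in \<open>n\<close>, the functions \<open>exp (- 1 / x) / x ^ n\<close> are closed under differentiation, also
  at \<open>0\<close>.\<close>

definition flat_exp :: "nat \<Rightarrow> real \<Rightarrow> real" where
  "flat_exp n x = (if x > 0 then exp (- inverse x) * inverse x ^ n else 0)"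

text \<open>From the right this is \<open>y ^ n / exp y\<close> with \<open>y = inverse x\<close>
  tending to infinity; from the left the function is identically zero.\<close>

lemma flat_exp_lim0: "(flat_exp n \<longlongrightarrow> 0) (at 0)"
proof -
  have "((\<lambda>x. (inverse x) ^ n / exp (inverse x)) \<longlongrightarrow> (0::real)) (at_right 0)"
    by (rule filterlim_compose[OF tendsto_power_div_exp_0 filterlim_inverse_at_top_right])
  moreover have "\<forall>\<^sub>F x in at_right 0. (inverse x) ^ n / exp (inverse x) = flat_exp n x"
    by (rule eventually_at_rightI[of 0 1])
      (auto simp: flat_exp_def exp_minus divide_inverse mult.commute)
  ultimately have "(flat_exp n \<longlongrightarrow> 0) (at_right 0)" by (rule Lim_transform_eventually)
  moreover have "\<forall>\<^sub>F x in at_left 0. 0 = flat_exp n x"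
    by (rule eventually_at_leftI[of "-1"]) (auto simp: flat_exp_def)
  then have "(flat_exp n \<longlongrightarrow> 0) (at_left 0)"
    by (rule Lim_transform_eventually[OF tendsto_const])
  ultimately show ?thesis by (simp add: filterlim_split_at)
qed

lemma flat_exp_deriv:
  "(flat_exp n has_real_derivative flat_exp (n + 2) x - n * flat_exp (Suc n) x) (at x)"
proof -
  consider "x > 0" | "x < 0" | "x = 0" by linarith
  then show ?thesis
  proof cases
    case 1
    have i: "(inverse has_real_derivative - (inverse x * inverse x)) (at x)"
      using DERIV_inverse[of x] 1 by (simp add: power2_eq_square)
    have e: "((\<lambda>x. exp (- inverse x)) has_real_derivative exp (- inverse x) * (inverse x * inverse x)) (at x)"
      using DERIV_fun_exp[OF DERIV_minus[OF i]] by simp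
    have "((\<lambda>x. exp (- inverse x) * inverse x ^ n) has_real_derivative
        flat_exp (n + 2) x - n * flat_exp (Suc n) x) (at x)"
      by (rule DERIV_cong[OF DERIV_mult[OF e DERIV_power[OF i, of n]]])
        (use 1 in \<open>cases n; simp add: flat_exp_def algebra_simps\<close>)
    then show ?thesis
      by (rule has_field_derivative_transform_within_open[where S="{0<..}"])
        (use 1 in \<open>auto simp: flat_exp_def\<close>)
  next
    case 2
    have "((\<lambda>x. 0) has_real_derivative flat_exp (n + 2) x - n * flat_exp (Suc n) x) (at x)"
      using 2 by (simp add: flat_exp_def)
    then show ?thesis
      by (rule has_field_derivative_transform_within_open[where S="{..<0}"])
        (use 2 in \<open>auto simp: flat_exp_def\<close>)
  next
    case 3
    \<comment> \<open>The difference quotient at \<open>0\<close> is the next member of the family,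
      whose limit is already known.\<close>
    have "((\<lambda>h. (flat_exp n (0 + h) - flat_exp n 0) / h) \<longlongrightarrow> 0) (at 0)"
    proof (rule Lim_transform_eventually[OF flat_exp_lim0[of "Suc n"]])
      show "\<forall>\<^sub>F h in at 0. flat_exp (Suc n) h = (flat_exp n (0 + h) - flat_exp n 0) / h"
        by (rule eventuallyI) (simp add: flat_exp_def divide_inverse)
    qed
    then show ?thesis unfolding 3 DERIV_def by (simp add: flat_exp_def)
  qed
qed

lemma Ck_on_flat_exp: "Ck_on k UNIV (flat_exp n)"
proof (induction k arbitrary: n)
  case 0
  show ?case
    by (simp add: continuous_at_imp_continuous_on DERIV_isCont[OF flat_exp_deriv])
next
  case (Suc k)
  show ?case
  proof (rule Ck_on_SucI)
    show "(flat_exp n has_derivative (\<lambda>v. (flat_exp (n + 2) x + (- real n) * flat_exp (Suc n) x) * v)) (at x)" for x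
      using flat_exp_deriv[of n x] by (simp add: has_field_derivative_def)
    show "Ck_on k UNIV (\<lambda>x. (flat_exp (n + 2) x + (- real n) * flat_exp (Suc n) x) * v)" for v
      by (rule Ck_on_mult[OF open_UNIV Ck_on_add[OF open_UNIV Suc
              Ck_on_mult[OF open_UNIV Ck_on_const[OF open_UNIV] Suc]] Ck_on_const[OF open_UNIV]])
  qed simp
qed

text \<open>The bump is \<open>a / (a + b)\<close>, where \<open>a\<close> vanishes outside the
  large ball and \<open>b\<close> inside the small one. As \<open>r < s\<close>, they never vanish
  together. The squared distance is used because it is smooth at the centre too.\<close>

lemma smooth_bump_exists:
  fixes c :: "'e::euclidean_space"
  assumes "0 < r" "r < s"
  obtains \<rho> where "smooth_on UNIV \<rho>" "\<And>x. dist c x \<le> r \<Longrightarrow> \<rho> x = (1::real)" "\<And>x. dist c x \<ge> s \<Longrightarrow> \<rho> x = 0"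
proof -
  let ?h = "flat_exp 0"
  define d where "d x = (x - c) \<bullet> (x - c)" for x
  have d: "d x = (dist c x)\<^sup>2" for x
    by (metis d_def dist_commute dist_norm power2_norm_eq_inner)
  define a where "a x = ?h (s\<^sup>2 + (- 1) * d x)" for x
  define b where "b x = ?h (- r\<^sup>2 + 1 * d x)" for x
  have h0: "?h y \<ge> 0" "?h y = 0 \<longleftrightarrow> y \<le> 0" for y by (auto simp: flat_exp_def)
  have "r\<^sup>2 < s\<^sup>2" using assms by (simp add: power_strict_mono)
  then have pos: "a x + b x \<noteq> 0" for x
    using h0(1)[of "s\<^sup>2 - d x"] h0(1)[of "d x - r\<^sup>2"] h0(2)[of "s\<^sup>2 - d x"] h0(2)[of "d x - r\<^sup>2"]
    unfolding a_def b_def by (smt (verit))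
  have dC: "Ck_on k UNIV d" for k
  proof -
    have "Ck_on k UNIV (\<lambda>x::'e. x + - c)"
      by (intro Ck_on_add Ck_on_const Ck_on_linear) (auto intro: bounded_linear_ident)
    then have "Ck_on k UNIV (\<lambda>x::'e. (x + - c) \<bullet> (x + - c))" by (intro Ck_on_inner) auto
    then show ?thesis by (simp add: d_def[abs_def])
  qed
  have m: "Ck_on k UNIV (\<lambda>x. e + m * d x)" for k e m
    by (rule Ck_on_add[OF open_UNIV Ck_on_const[OF open_UNIV]
          Ck_on_mult[OF open_UNIV Ck_on_const[OF open_UNIV] dC]])
  have aC: "Ck_on k UNIV a" and bC: "Ck_on k UNIV b" for k
    unfolding a_def[abs_def] b_def[abs_def]
    by (rule Ck_on_compose[OF open_UNIV open_UNIV m Ck_on_flat_exp UNIV_I])+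
  define \<rho> where "\<rho> x = a x * inverse (a x + b x)" for x
  show thesis
  proof
    have "Ck_on k UNIV \<rho>" for k
      unfolding \<rho>_def[abs_def]
      by (rule Ck_on_mult[OF open_UNIV aC
            Ck_on_compose[OF open_UNIV _ Ck_on_add[OF open_UNIV aC bC] Ck_on_inverse]])
        (use pos in auto)
    then show "smooth_on UNIV \<rho>" by (simp add: smooth_on_def)
    show "\<rho> x = 1" if "dist c x \<le> r" for x
    proof -
      have "d x \<le> r\<^sup>2" using that by (simp add: d power_mono)
      then have "b x = 0" unfolding b_def by (subst h0(2)) simp
      then show ?thesis using pos[of x] by (simp add: \<rho>_def)
    qed
    show "\<rho> x = 0" if "dist c x \<ge> s" for x
    proof -
      have "d x \<ge> s\<^sup>2" using that assms by (simp add: d power_mono)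
      then have "a x = 0" unfolding a_def by (subst h0(2)) simp
      then show ?thesis by (simp add: \<rho>_def)
    qed
  qed
qed


section \<open>Integrals along segments and Hadamard's lemma\<close>

lemma segment_in_convex:
  assumes "convex S" "q \<in> S" "x \<in> S" "t \<in> {0..1}"
  shows "q + t *\<^sub>R (x - q) \<in> S"
proof -
  have "(1 - t) *\<^sub>R q + t *\<^sub>R x \<in> S" using assms by (intro convexD_alt) auto
  then show ?thesis by (simp add: algebra_simps)
qed

lemma continuous_on_segment:
  fixes u :: "'e::euclidean_space \<Rightarrow> real"
  assumes "convex S" "q \<in> S" "continuous_on S u"
  shows "continuous_on (S \<times> cbox 0 1) (\<lambda>(x, t). t ^ n * u (q + t *\<^sub>R (x - q)))"
  unfolding split_beta
  by (intro continuous_intros continuous_on_compose2[OF assms(3)])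
    (use segment_in_convex[OF assms(1,2)] in auto)

text \<open>Each derivative brings down a factor \<open>t\<close>, hence the weight \<open>t ^ n\<close>.\<close>

lemma Ck_on_segment_integral:
  fixes u :: "'e::euclidean_space \<Rightarrow> real"
  assumes "open S" "convex S" "q \<in> S" "Ck_on k S u"
  shows "Ck_on k S (\<lambda>x. integral (cbox 0 1) (\<lambda>t. t ^ n * u (q + t *\<^sub>R (x - q))))"
  using assms(4)
proof (induction k arbitrary: n u)
  case 0
  then show ?case
    using integral_continuous_on_param[OF continuous_on_segment[OF assms(2,3)]] by simp
next
  case (Suc k)
  note D = Ck_on_SucD[OF assms(1) Suc.prems]
  let ?D = "\<lambda>x. frechet_derivative u (at x)"
  \<comment> \<open>Differentiation under the integral asks for a derivative that is continuous as a
    bounded linear map. Assembling it from finitely many partial derivatives reduces this to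
    continuity of scalar functions.\<close>
  define fx where "fx x t = (\<Sum>e\<in>Basis. (t ^ Suc n * ?D (q + t *\<^sub>R (x - q)) e) *\<^sub>R blinfun_inner_left e)"
    for x and t :: real
  have fx: "blinfun_apply (fx x t) v = t ^ Suc n * ?D (q + t *\<^sub>R (x - q)) v"
    if "x \<in> S" "t \<in> cbox 0 1" for x t v
  proof -
    have "q + t *\<^sub>R (x - q) \<in> S" using segment_in_convex[OF assms(2,3) that(1)] that(2) by simp
    from linear_Basis_expansion[OF has_derivative_linear[OF D(1)[OF this]], of v]
    show ?thesis
      by (simp add: fx_def blinfun.sum_left blinfun.scaleR_left sum_distrib_left algebra_simps)
  qed
  have ccont: "continuous_on S (\<lambda>x. ?D x e)" for e
    by (rule Ck_on_continuous[OF D(2)])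
  have fxc: "continuous_on (S \<times> cbox 0 1) (\<lambda>(x, t). fx x t)"
    unfolding fx_def split_beta
    by (intro continuous_on_sum continuous_on_scaleR continuous_on_const)
      (rule continuous_on_segment[OF assms(2,3) ccont, of "Suc n", unfolded split_beta])
  have deriv: "((\<lambda>x. t ^ n * u (q + t *\<^sub>R (x - q))) has_derivative blinfun_apply (fx x t)) (at x within S)"
    if "x \<in> S" "t \<in> cbox 0 1" for x t
  proof -
    have inS: "q + t *\<^sub>R (x - q) \<in> S" using segment_in_convex[OF assms(2,3) that(1)] that(2) by simp
    have "((\<lambda>x. q + t *\<^sub>R (x - q)) has_derivative (\<lambda>v. t *\<^sub>R v)) (at x within S)"
      using has_derivative_add[OF has_derivative_const[of q] has_derivative_scaleR_right[OF
          has_derivative_diff[OF has_derivative_ident has_derivative_const[of q]], of t]] by simp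
    from has_derivative_mult_right[OF has_derivative_compose[OF this D(1)[OF inS]], of "t ^ n"]
    show ?thesis
      by (rule has_derivative_eq_rhs)
        (simp add: fun_eq_iff fx[OF that] linear_cmul[OF has_derivative_linear[OF D(1)[OF inS]]])
  qed
  have int: "(\<lambda>t. t ^ n * u (q + t *\<^sub>R (x - q))) integrable_on cbox 0 1" if "x \<in> S" for x
  proof (rule integrable_continuous)
    have "continuous_on (cbox 0 1) ((\<lambda>(x, t). t ^ n * u (q + t *\<^sub>R (x - q))) \<circ> Pair x)"
      by (rule continuous_on_compose[OF _ continuous_on_subset[OF continuous_on_segment[OF assms(2,3)
                Ck_on_continuous[OF Suc.prems]]]])
        (use that in \<open>auto intro!: continuous_intros\<close>)
    then show "continuous_on (cbox 0 1) (\<lambda>t. t ^ n * u (q + t *\<^sub>R (x - q)))" by (simp add: o_def)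
  qed
  show ?case
  proof (rule Ck_on_SucI[OF assms(1)])
    fix x assume x: "x \<in> S"
    have fxi: "fx x integrable_on cbox 0 1"
    proof (rule integrable_continuous)
      have "continuous_on (cbox 0 1) ((\<lambda>(x, t). fx x t) \<circ> Pair x)"
        by (rule continuous_on_compose[OF _ continuous_on_subset[OF fxc]])
          (use x in \<open>auto intro!: continuous_intros\<close>)
      then show "continuous_on (cbox 0 1) (fx x)" by (simp add: o_def)
    qed
    have "((\<lambda>x. integral (cbox 0 1) (\<lambda>t. t ^ n * u (q + t *\<^sub>R (x - q)))) has_derivative
        blinfun_apply (integral (cbox 0 1) (fx x))) (at x within S)"
      by (rule leibniz_rule[OF deriv int fxc x assms(2)])
    moreover have "blinfun_apply (integral (cbox 0 1) (fx x)) v =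
        integral (cbox 0 1) (\<lambda>t. t ^ Suc n * ?D (q + t *\<^sub>R (x - q)) v)" for v
      unfolding blinfun_apply_integral[OF fxi] by (rule integral_cong) (rule fx[OF x])
    then have "blinfun_apply (integral (cbox 0 1) (fx x)) =
        (\<lambda>v. integral (cbox 0 1) (\<lambda>t. t ^ Suc n * ?D (q + t *\<^sub>R (x - q)) v))" by (rule ext)
    ultimately show "((\<lambda>x. integral (cbox 0 1) (\<lambda>t. t ^ n * u (q + t *\<^sub>R (x - q)))) has_derivative
        (\<lambda>v. integral (cbox 0 1) (\<lambda>t. t ^ Suc n * ?D (q + t *\<^sub>R (x - q)) v))) (at x)"
      using at_within_open[OF x assms(1)] by metis
  qed (rule Suc.IH[OF D(2)])
qed

text \<open>By the fundamental theorem of calculus along the segment from \<open>q\<close> to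
  \<open>y\<close>, the coefficient of \<open>(y - q) \<bullet> e\<close> is the mean of the partial
  derivative in direction \<open>e\<close> over that segment. At \<open>y = q\<close> the mean is
  the partial derivative itself.\<close>

lemma hadamard:
  fixes u :: "'e::euclidean_space \<Rightarrow> real"
  assumes "smooth_on S u" "open S" "convex S" "q \<in> S"
  obtains g where "\<And>e. smooth_on S (g e)" "\<And>e. g e q = frechet_derivative u (at q) e"
    "\<And>y. y \<in> S \<Longrightarrow> u y = u q + (\<Sum>e\<in>Basis. ((y - q) \<bullet> e) * g e y)"
proof
  define g where "g e y = integral (cbox 0 1) (\<lambda>t. t ^ 0 * frechet_derivative u (at (q + t *\<^sub>R (y - q))) e)"
    for e y
  have C: "Ck_on (Suc k) S u" for k using assms(1) unfolding smooth_on_def by blast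
  note D = Ck_on_SucD[OF assms(2) C]
  show "smooth_on S (g e)" for e
    unfolding smooth_on_def g_def[abs_def] using Ck_on_segment_integral[OF assms(2-4) D(2)] by blast
  show "g e q = frechet_derivative u (at q) e" for e by (simp add: g_def)
  show "u y = u q + (\<Sum>e\<in>Basis. ((y - q) \<bullet> e) * g e y)" if y: "y \<in> S" for y
  proof -
    let ?p = "\<lambda>t. q + t *\<^sub>R (y - q)"
    have inS: "?p t \<in> S" if "t \<in> {0..1}" for t using segment_in_convex[OF assms(3,4) y that] .
    have "((\<lambda>t. u (?p t)) has_vector_derivative frechet_derivative u (at (?p t)) (y - q)) (at t within {0..1})"
      if "t \<in> {0..1}" for t
    proof -
      have "(?p has_derivative (\<lambda>s. s *\<^sub>R (y - q))) (at t within {0..1})"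
        by (auto intro!: derivative_eq_intros)
      from has_derivative_compose[OF this D(1)[OF inS[OF that]]] show ?thesis
        by (simp add: has_vector_derivative_def linear_cmul[OF has_derivative_linear[OF D(1)[OF inS[OF that]]]])
    qed
    from fundamental_theorem_of_calculus[OF _ this]
    have "((\<lambda>t. frechet_derivative u (at (?p t)) (y - q)) has_integral u y - u q) {0..1}" by simp
    moreover have "((\<lambda>t. frechet_derivative u (at (?p t)) (y - q)) has_integral
        (\<Sum>e\<in>Basis. ((y - q) \<bullet> e) * g e y)) {0..1}"
    proof (rule has_integral_eq)
      show "(\<Sum>e\<in>Basis. ((y - q) \<bullet> e) * (t ^ 0 * frechet_derivative u (at (?p t)) e)) =
          frechet_derivative u (at (?p t)) (y - q)" if "t \<in> {0..1}" for t
        using linear_Basis_expansion[OF has_derivative_linear[OF D(1)[OF inS[OF that]]], of "y - q"] by simp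
      have "(\<lambda>t. t ^ 0 * frechet_derivative u (at (?p t)) e) integrable_on {0..1}" for e
        by (intro integrable_continuous_interval continuous_intros
            continuous_on_compose2[OF Ck_on_continuous[OF D(2)]]) (use inS in auto)
      then show "((\<lambda>t. \<Sum>e\<in>Basis. ((y - q) \<bullet> e) * (t ^ 0 * frechet_derivative u (at (?p t)) e))
          has_integral (\<Sum>e\<in>Basis. ((y - q) \<bullet> e) * g e y)) {0..1}"
        unfolding g_def by (intro has_integral_sum has_integral_mult_right) (auto simp: has_integral_integral)
    qed
    ultimately have "u y - u q = (\<Sum>e\<in>Basis. ((y - q) \<bullet> e) * g e y)" by (rule has_integral_unique)
    then show ?thesis by simp
  qed
qed

section \<open>Closure properties of smooth maps\<close>

lemma smooth_on_cong:
  "open S \<Longrightarrow> (\<And>x. x \<in> S \<Longrightarrow> h x = h' x) \<Longrightarrow> smooth_on S h \<Longrightarrow> smooth_on S h'"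
  unfolding smooth_on_def by (metis Ck_on_cong)

lemma smooth_on_subset: "open S \<Longrightarrow> T \<subseteq> S \<Longrightarrow> smooth_on S h \<Longrightarrow> smooth_on T h"
  unfolding smooth_on_def using Ck_on_subset by blast

lemma smooth_on_const: "open S \<Longrightarrow> smooth_on S (\<lambda>x. c)"
  unfolding smooth_on_def by (simp add: Ck_on_const del: Ck_on.simps)

lemma smooth_on_linear: "open S \<Longrightarrow> bounded_linear h \<Longrightarrow> smooth_on S h"
  unfolding smooth_on_def by (simp add: Ck_on_linear del: Ck_on.simps)

lemma smooth_on_add: "open S \<Longrightarrow> smooth_on S h \<Longrightarrow> smooth_on S g \<Longrightarrow> smooth_on S (\<lambda>x. h x + g x)"
  unfolding smooth_on_def by (simp add: Ck_on_add del: Ck_on.simps)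

lemma smooth_on_mult:
  fixes h g :: "'e::euclidean_space \<Rightarrow> real"
  shows "open S \<Longrightarrow> smooth_on S h \<Longrightarrow> smooth_on S g \<Longrightarrow> smooth_on S (\<lambda>x. h x * g x)"
  unfolding smooth_on_def by (simp add: Ck_on_mult del: Ck_on.simps)

lemma smooth_on_compose:
  fixes g :: "'e::euclidean_space \<Rightarrow> 'f::euclidean_space"
  shows "open S \<Longrightarrow> open T \<Longrightarrow> smooth_on S g \<Longrightarrow> smooth_on T h \<Longrightarrow> (\<And>x. x \<in> S \<Longrightarrow> g x \<in> T) \<Longrightarrow>
    smooth_on S (\<lambda>x. h (g x))"
  unfolding smooth_on_def using Ck_on_compose by blast

lemma smooth_on_frechet: "smooth_on S h \<Longrightarrow> smooth_on S (\<lambda>x. frechet_derivative h (at x) v)"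
  unfolding smooth_on_def by (metis Ck_on.simps(2))

lemma smooth_on_has_derivative:
  "open S \<Longrightarrow> smooth_on S h \<Longrightarrow> x \<in> S \<Longrightarrow> (h has_derivative frechet_derivative h (at x)) (at x)"
  unfolding smooth_on_def using Ck_on_SucD(1) by blast

lemma smooth_on_continuous: "smooth_on S h \<Longrightarrow> continuous_on S h"
  unfolding smooth_on_def using Ck_on_continuous by blast

lemma smooth_on_local:
  assumes "open S" "\<And>x. x \<in> S \<Longrightarrow> \<exists>T. open T \<and> x \<in> T \<and> smooth_on (T \<inter> S) h"
  shows "smooth_on S h"
  unfolding smooth_on_def
proof
  fix k
  show "Ck_on k S h"
  proof (rule Ck_on_local[OF assms(1)])
    fix x assume "x \<in> S"
    from assms(2)[OF this] show "\<exists>T. open T \<and> x \<in> T \<and> Ck_on k (T \<inter> S) h"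
      unfolding smooth_on_def by blast
  qed
qed

lemma sum_fun_apply: "(\<Sum>i\<in>A. f i) x = (\<Sum>i\<in>A. f i x)"
  by (induction A rule: infinite_finite_induct) auto

section \<open>Smooth functions and vector fields on a manifold\<close>

locale manifold =
  fixes N :: "('a::{second_countable_topology,t2_space}, 'e::euclidean_space) atlas"
  assumes smooth_manifold: "smooth_manifold N"
begin

abbreviation "C \<equiv> smooth_functions N"
abbreviation "VF \<equiv> vector_fields N"
abbreviation "OF \<equiv> one_forms N"

section \<open>Charts and smooth functions\<close>

lemma chart_at: obtains U \<phi> where "(U, \<phi>) \<in> N" "p \<in> U"
proof -
  have "p \<in> (\<Union>(U, \<phi>)\<in>N. U)" using smooth_manifold by (simp add: smooth_manifold_def)
  then show thesis using that by auto
qed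

context
  fixes U \<phi> assumes chart: "(U, \<phi>) \<in> N"
begin

lemma chart_homeo: "open U" "open (\<phi> ` U)" "\<exists>\<phi>'. homeomorphism U (\<phi> ` U) \<phi> \<phi>'"
  using smooth_manifold chart by (auto simp: smooth_manifold_def)

lemma chart_inj: "inj_on \<phi> U"
  using chart_homeo(3) by (auto simp: homeomorphism_def intro: inj_on_inverseI)

lemma chart_inv: "p \<in> U \<Longrightarrow> inv_into U \<phi> (\<phi> p) = p"
  using chart_inj by (simp add: inv_into_f_f)

text \<open>Any continuous inverse agrees with \<open>inv_into U \<phi>\<close> on the image of the
  chart, so continuity passes to the inverse in terms of which smoothness is defined.\<close>

lemma chart_homeomorphism: "homeomorphism U (\<phi> ` U) \<phi> (inv_into U \<phi>)"
proof -
  obtain \<phi>' where h: "homeomorphism U (\<phi> ` U) \<phi> \<phi>'" using chart_homeo(3) by blast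
  show ?thesis
    by (rule homeomorphism_cong[OF h]) (use h chart_inv in \<open>auto simp: homeomorphism_def\<close>)
qed

lemma chart_continuous: "continuous_on U \<phi>" "continuous_on (\<phi> ` U) (inv_into U \<phi>)"
  using chart_homeomorphism by (auto simp: homeomorphism_def)

lemma chart_open_image: "open W \<Longrightarrow> W \<subseteq> U \<Longrightarrow> open (\<phi> ` W)"
  using homeomorphism_imp_open_map[OF chart_homeomorphism, of W] chart_homeo(1,2)
  by (metis openin_open_eq openin_open_trans openin_subtopology_self open_openin openin_open_Int inf.absorb_iff2)

lemma chart_open_preimage:
  assumes "open S" shows "open {q \<in> U. \<phi> q \<in> S}"
proof -
  have "{q \<in> U. \<phi> q \<in> S} = U \<inter> \<phi> -` S" by auto
  then show ?thesis
    using continuous_open_preimage[OF chart_continuous(1) chart_homeo(1) assms] by simp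
qed

lemma chart_image_preimage: "S \<subseteq> \<phi> ` U \<Longrightarrow> \<phi> ` {q \<in> U. \<phi> q \<in> S} = S"
  by auto

lemma smooth_functions_chart: "u \<in> C \<Longrightarrow> smooth_on (\<phi> ` U) (u \<circ> inv_into U \<phi>)"
  using chart by (auto simp: smooth_functions_def)

end

lemma transition_smooth:
  "(U, \<phi>) \<in> N \<Longrightarrow> (V, \<psi>) \<in> N \<Longrightarrow> smooth_on (\<phi> ` (U \<inter> V)) (\<psi> \<circ> inv_into U \<phi>)"
  using smooth_manifold by (fastforce simp: smooth_manifold_def)

text \<open>One chart around each point suffices: in any other chart the coordinate expression is
  composed with a smooth transition map, and smoothness is local.\<close>

lemma smooth_functionsI_chart:
  assumes "\<And>p. \<exists>U \<phi> W. (U, \<phi>) \<in> N \<and> open W \<and> p \<in> W \<and> W \<subseteq> U \<and> smooth_on (\<phi> ` W) (u \<circ> inv_into U \<phi>)"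
  shows "u \<in> C"
  unfolding smooth_functions_def
proof clarify
  fix V \<psi> assume V: "(V, \<psi>) \<in> N"
  show "smooth_on (\<psi> ` V) (u \<circ> inv_into V \<psi>)"
  proof (rule smooth_on_local[OF chart_homeo(2)[OF V]])
    fix x assume "x \<in> \<psi> ` V"
    then obtain p where p: "p \<in> V" "x = \<psi> p" by blast
    obtain U \<phi> W where W: "(U, \<phi>) \<in> N" "open W" "p \<in> W" "W \<subseteq> U"
      "smooth_on (\<phi> ` W) (u \<circ> inv_into U \<phi>)"
      using assms by blast
    let ?T = "\<psi> ` (W \<inter> V)"
    have oT: "open ?T" using chart_open_image[OF V] W(2) chart_homeo(1)[OF V] by auto
    have "smooth_on ?T (\<phi> \<circ> inv_into V \<psi>)"
      by (rule smooth_on_subset[OF _ _ transition_smooth[OF V W(1)]])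
        (use chart_open_image[OF V] chart_homeo(1)[OF V] chart_homeo(1)[OF W(1)] W(4) in auto)
    then have "smooth_on ?T (\<lambda>y. (u \<circ> inv_into U \<phi>) ((\<phi> \<circ> inv_into V \<psi>) y))"
      by (rule smooth_on_compose[OF oT chart_open_image[OF W(1,2,4)] _ W(5)])
        (auto simp: chart_inv[OF V])
    then have "smooth_on ?T (u \<circ> inv_into V \<psi>)"
      by (rule smooth_on_cong[OF oT, rotated]) (use W(4) in \<open>auto simp: chart_inv[OF V] chart_inv[OF W(1)]\<close>)
    moreover have "?T \<inter> \<psi> ` V = ?T" by blast
    ultimately show "\<exists>T. open T \<and> x \<in> T \<and> smooth_on (T \<inter> \<psi> ` V) (u \<circ> inv_into V \<psi>)"
      using oT p W(3) by (metis IntI image_eqI)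
  qed
qed

lemma smooth_functionsI_local:
  assumes "\<And>p. \<exists>W v. open W \<and> p \<in> W \<and> v \<in> C \<and> (\<forall>q\<in>W. u q = v q)"
  shows "u \<in> C"
proof (rule smooth_functionsI_chart)
  fix p
  obtain W v where W: "open W" "p \<in> W" "v \<in> C" "\<forall>q\<in>W. u q = v q" using assms by blast
  obtain U \<phi> where U: "(U, \<phi>) \<in> N" "p \<in> U" using chart_at by blast
  have o: "open (W \<inter> U)" using W(1) chart_homeo(1)[OF U(1)] by auto
  have oi: "open (\<phi> ` (W \<inter> U))" using chart_open_image[OF U(1) o] by auto
  have "smooth_on (\<phi> ` (W \<inter> U)) (v \<circ> inv_into U \<phi>)"
    by (rule smooth_on_subset[OF chart_homeo(2)[OF U(1)] _ smooth_functions_chart[OF U(1) W(3)]]) auto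
  then have "smooth_on (\<phi> ` (W \<inter> U)) (u \<circ> inv_into U \<phi>)"
    by (rule smooth_on_cong[OF oi, rotated]) (use W(4) in \<open>auto simp: chart_inv[OF U(1)]\<close>)
  then show "\<exists>U \<phi> W. (U, \<phi>) \<in> N \<and> open W \<and> p \<in> W \<and> W \<subseteq> U \<and> smooth_on (\<phi> ` W) (u \<circ> inv_into U \<phi>)"
    using U o W(2) by (intro exI[of _ U] exI[of _ \<phi>] exI[of _ "W \<inter> U"]) auto
qed

lemma smooth_functions_const [simp]: "(\<lambda>_. c) \<in> C"
  unfolding smooth_functions_def by (auto simp: o_def intro!: smooth_on_const chart_homeo)

lemma smooth_functions_0 [simp]: "0 \<in> C" and smooth_functions_1 [simp]: "1 \<in> C"
  using smooth_functions_const[of 0] smooth_functions_const[of 1]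
  by (simp_all add: zero_fun_def one_fun_def)

lemma smooth_functions_add [simp]: "u \<in> C \<Longrightarrow> v \<in> C \<Longrightarrow> u + v \<in> C"
  unfolding smooth_functions_def plus_fun_def o_def by (auto intro!: smooth_on_add chart_homeo)

lemma smooth_functions_mult [simp]: "u \<in> C \<Longrightarrow> v \<in> C \<Longrightarrow> u * v \<in> C"
  unfolding smooth_functions_def times_fun_def o_def by (auto intro!: smooth_on_mult chart_homeo)

lemma smooth_functions_uminus [simp]: "u \<in> C \<Longrightarrow> - u \<in> C"
proof -
  assume "u \<in> C"
  then have "(\<lambda>_. - 1) * u \<in> C" by simp
  moreover have "(\<lambda>_. - 1) * u = - u" by (auto simp: fun_eq_iff)
  ultimately show ?thesis by simp
qed

lemma smooth_functions_diff [simp]: "u \<in> C \<Longrightarrow> v \<in> C \<Longrightarrow> u - v \<in> C"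
  using smooth_functions_add[of u "- v"] by simp

lemma smooth_functions_sum [simp]: "(\<And>i. i \<in> A \<Longrightarrow> u i \<in> C) \<Longrightarrow> sum u A \<in> C"
  by (induction A rule: infinite_finite_induct) auto

lemma smooth_functions_compose:
  fixes h :: "real \<Rightarrow> real"
  assumes "open T" "smooth_on T h" "u \<in> C" "\<And>p. u p \<in> T"
  shows "(\<lambda>p. h (u p)) \<in> C"
  unfolding smooth_functions_def
proof clarify
  fix U \<phi> assume U: "(U, \<phi>) \<in> N"
  show "smooth_on (\<phi> ` U) ((\<lambda>p. h (u p)) \<circ> inv_into U \<phi>)"
    unfolding o_def
    by (rule smooth_on_compose[OF chart_homeo(2)[OF U] assms(1) _ assms(2)])
      (use smooth_functions_chart[OF U assms(3)] assms(4) in \<open>auto simp: o_def\<close>)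
qed

lemma smooth_functions_inverse:
  assumes "u \<in> C" "\<And>p. u p \<noteq> 0" shows "(\<lambda>p. inverse (u p)) \<in> C"
  by (rule smooth_functions_compose[of "- {0}"]) (use assms Ck_on_inverse in \<open>auto simp: smooth_on_def\<close>)

lemma smooth_functions_sqrt:
  assumes "u \<in> C" "\<And>p. u p > 0" shows "(\<lambda>p. sqrt (u p)) \<in> C"
  by (rule smooth_functions_compose[of "{0<..}"]) (use assms Ck_on_sqrt in \<open>auto simp: smooth_on_def\<close>)

lemma smooth_functions_continuous:
  assumes "u \<in> C" shows "continuous_on UNIV u"
proof (rule continuous_at_imp_continuous_on, rule ballI)
  fix p
  obtain U \<phi> where U: "(U, \<phi>) \<in> N" "p \<in> U" using chart_at by blast
  have "continuous_on U ((u \<circ> inv_into U \<phi>) \<circ> \<phi>)"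
    by (rule continuous_on_compose[OF chart_continuous(1)[OF U(1)]
          smooth_on_continuous[OF smooth_functions_chart[OF U(1) assms]]])
  then have "continuous_on U u"
    by (rule continuous_on_eq) (auto simp: chart_inv[OF U(1)])
  then show "isCont u p" using chart_homeo(1)[OF U(1)] U(2) continuous_on_eq_continuous_at by blast
qed

section \<open>Bump functions on the manifold\<close>

lemma bump_extension:
  fixes \<rho> h :: "'e \<Rightarrow> real"
  assumes U: "(U, \<phi>) \<in> N" and S: "open S" "S \<subseteq> \<phi> ` U"
    and \<rho>: "smooth_on UNIV \<rho>" "\<And>x. dist c x \<ge> s \<Longrightarrow> \<rho> x = 0" "cball c s \<subseteq> S"
    and h: "smooth_on S h"
  shows "(\<lambda>q. if q \<in> U then \<rho> (\<phi> q) * h (\<phi> q) else 0) \<in> C" (is "?u \<in> C")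
proof (rule smooth_functionsI_chart)
  fix q
  \<comment> \<open>Extension by zero is smooth because this set is compact, hence closed in a
    Hausdorff space: every point lies either in the chart domain or in the open complement, where
    the function vanishes.\<close>
  let ?K = "inv_into U \<phi> ` cball c s"
  have "compact ?K"
    by (rule compact_continuous_image[OF continuous_on_subset[OF chart_continuous(2)[OF U]]])
      (use \<rho>(3) S in auto)
  then have K: "open (- ?K)" by (simp add: compact_imp_closed open_Compl)
  have out: "?u q' = 0" if "q' \<notin> ?K" for q'
  proof (cases "q' \<in> U")
    case True
    then have "\<phi> q' \<notin> cball c s" using that chart_inv[OF U True] by force
    then show ?thesis using \<rho>(2)[of "\<phi> q'"] by auto
  qed auto
  show "\<exists>U \<phi> W. (U, \<phi>) \<in> N \<and> open W \<and> q \<in> W \<and> W \<subseteq> U \<and> smooth_on (\<phi> ` W) (?u \<circ> inv_into U \<phi>)"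
  proof (cases "q \<in> ?K")
    case True
    let ?W = "{q \<in> U. \<phi> q \<in> S}"
    have im: "\<phi> ` ?W = S" using chart_image_preimage[OF U S(2)] .
    have "q \<in> ?W" using True \<rho>(3) S(2) inv_into_into[of _ \<phi> U] f_inv_into_f[of _ \<phi> U]
      by (smt (verit, best) image_iff mem_Collect_eq subset_iff)
    moreover have "smooth_on S (?u \<circ> inv_into U \<phi>)"
    proof (rule smooth_on_cong[OF S(1)])
      show "smooth_on S (\<lambda>x. \<rho> x * h x)"
        by (intro smooth_on_mult S(1) h smooth_on_subset[OF open_UNIV _ \<rho>(1)]) auto
      show "\<rho> x * h x = (?u \<circ> inv_into U \<phi>) x" if "x \<in> S" for x
        using that S(2) inv_into_into[of x \<phi> U] f_inv_into_f[of x \<phi> U] by auto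
    qed
    ultimately show ?thesis
      using U chart_open_preimage[OF U S(1)] im by (intro exI[of _ U] exI[of _ \<phi>] exI[of _ ?W]) auto
  next
    case False
    obtain V \<psi> where V: "(V, \<psi>) \<in> N" "q \<in> V" using chart_at by blast
    have o: "open (V \<inter> - ?K)" using chart_homeo(1)[OF V(1)] K by blast
    have oi: "open (\<psi> ` (V \<inter> - ?K))" using chart_open_image[OF V(1) o] by auto
    have "smooth_on (\<psi> ` (V \<inter> - ?K)) (?u \<circ> inv_into V \<psi>)"
      by (rule smooth_on_cong[OF oi _ smooth_on_const[OF oi, of 0]])
        (auto simp: chart_inv[OF V(1)] dest: out)
    then show ?thesis using V o False by (intro exI[of _ V] exI[of _ \<psi>] exI[of _ "V \<inter> - ?K"]) auto
  qed
qed

lemma chart_ball: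
  assumes U: "(U, \<phi>) \<in> N" and W: "open W" "p \<in> W" "W \<subseteq> U"
  obtains r where "r > 0" "cball (\<phi> p) r \<subseteq> \<phi> ` W"
  using open_contains_cball[of "\<phi> ` W"] chart_open_image[OF U W(1,3)] W(2) by blast

lemma bump_exists:
  assumes "open W" "p \<in> W"
  obtains \<rho> W' where "\<rho> \<in> C" "open W'" "p \<in> W'" "W' \<subseteq> W" "\<And>q. q \<in> W' \<Longrightarrow> \<rho> q = 1" "\<And>q. q \<notin> W \<Longrightarrow> \<rho> q = 0"
proof -
  obtain U \<phi> where U: "(U, \<phi>) \<in> N" "p \<in> U" using chart_at by blast
  have o: "open (W \<inter> U)" using assms(1) chart_homeo(1)[OF U(1)] by auto
  obtain r where r: "r > 0" "cball (\<phi> p) r \<subseteq> \<phi> ` (W \<inter> U)"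
    by (rule chart_ball[OF U(1) o]) (use assms U in auto)
  obtain \<rho> :: "'e \<Rightarrow> real" where \<rho>: "smooth_on UNIV \<rho>" "\<And>x. dist (\<phi> p) x \<le> r / 2 \<Longrightarrow> \<rho> x = 1"
    "\<And>x. dist (\<phi> p) x \<ge> r \<Longrightarrow> \<rho> x = 0"
    using smooth_bump_exists[of "r / 2" r "\<phi> p"] r(1) by auto
  let ?u = "\<lambda>q. if q \<in> U then \<rho> (\<phi> q) * 1 else 0"
  have inj: "\<phi> q \<in> \<phi> ` (W \<inter> U) \<Longrightarrow> q \<in> U \<Longrightarrow> q \<in> W" for q
    using chart_inj[OF U(1)] by (auto dest: inj_onD)
  show thesis
  proof
    show "?u \<in> C"
      by (rule bump_extension[OF U(1) chart_homeo(2)[OF U(1)] _ \<rho>(1,3) _ smooth_on_const[OF chart_homeo(2)[OF U(1)]]])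
        (use r in auto)
    show "open {q \<in> U. \<phi> q \<in> ball (\<phi> p) (r / 2)}" by (rule chart_open_preimage[OF U(1)]) auto
    show "p \<in> {q \<in> U. \<phi> q \<in> ball (\<phi> p) (r / 2)}" using U r by auto
    show "{q \<in> U. \<phi> q \<in> ball (\<phi> p) (r / 2)} \<subseteq> W"
    proof
      fix q assume q: "q \<in> {q \<in> U. \<phi> q \<in> ball (\<phi> p) (r / 2)}"
      then have "\<phi> q \<in> cball (\<phi> p) r" using r(1) by auto
      then show "q \<in> W" using inj[of q] r(2) q by blast
    qed
    show "?u q = 1" if "q \<in> {q \<in> U. \<phi> q \<in> ball (\<phi> p) (r / 2)}" for q
      using that \<rho>(2)[of "\<phi> q"] by auto
    show "?u q = 0" if "q \<notin> W" for q
    proof (cases "q \<in> U")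
      case True
      then have "\<phi> q \<notin> cball (\<phi> p) r" using inj that r(2) by blast
      then show ?thesis using \<rho>(3)[of "\<phi> q"] by auto
    qed auto
  qed
qed

section \<open>Derivations and coordinate frames\<close>

context
  fixes X assumes X: "X \<in> VF"
begin

lemma vf_smooth: "u \<in> C \<Longrightarrow> X u \<in> C"
  and vf_add: "u \<in> C \<Longrightarrow> v \<in> C \<Longrightarrow> X (u + v) = X u + X v"
  and vf_cmult: "u \<in> C \<Longrightarrow> X ((\<lambda>_. c) * u) = (\<lambda>_. c) * X u"
  and vf_mult: "u \<in> C \<Longrightarrow> v \<in> C \<Longrightarrow> X (u * v) = X u * v + u * X v"
  and vf_outside: "u \<notin> C \<Longrightarrow> X u = 0"
  using X by (auto simp: vector_fields_def)

lemma vf_0: "X 0 = 0"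
  using vf_add[of 0 0] by simp

lemma vf_const: "X (\<lambda>_. c) = 0"
proof -
  have "X 1 = 0" using vf_mult[of 1 1] by simp
  then show ?thesis using vf_cmult[of 1 c] by simp
qed

lemma vf_uminus: "u \<in> C \<Longrightarrow> X (- u) = - X u"
  using vf_add[of u "- u"] vf_0 by (simp add: add_eq_0_iff)

lemma vf_diff: "u \<in> C \<Longrightarrow> v \<in> C \<Longrightarrow> X (u - v) = X u - X v"
  using vf_add[of u "- v"] vf_uminus[of v] by simp

lemma vf_sum: "(\<And>i. i \<in> A \<Longrightarrow> u i \<in> C) \<Longrightarrow> X (sum u A) = (\<Sum>i\<in>A. X (u i))"
  by (induction A rule: infinite_finite_induct) (auto simp: vf_0 vf_add)

text \<open>If \<open>\<rho>\<close> is a bump at \<open>q\<close> supported where \<open>u\<close>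
  and \<open>v\<close> agree, the product of \<open>u - v\<close> and \<open>\<rho>\<close> is zero.
  The Leibniz rule at \<open>q\<close>, where \<open>\<rho>\<close> is \<open>1\<close> and
  \<open>u - v\<close> vanishes, leaves only the value of \<open>X (u - v)\<close>.\<close>

lemma vf_local:
  assumes "u \<in> C" "v \<in> C" "open W" "q \<in> W" "\<And>x. x \<in> W \<Longrightarrow> u x = v x"
  shows "X u q = X v q"
proof -
  obtain \<rho> W' where \<rho>: "\<rho> \<in> C" "q \<in> W'" "\<And>x. x \<in> W' \<Longrightarrow> \<rho> x = 1" "\<And>x. x \<notin> W \<Longrightarrow> \<rho> x = 0"
    using bump_exists[OF assms(3,4)] by metis
  have "(u - v) * \<rho> = 0" using assms(5) \<rho>(4) by (force simp: fun_eq_iff)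
  then have "X (u - v) * \<rho> + (u - v) * X \<rho> = 0" using vf_mult[of "u - v" \<rho>] vf_0 assms \<rho>(1) by simp
  then have "X (u - v) q * \<rho> q + (u q - v q) * X \<rho> q = 0" by (simp add: fun_eq_iff)
  then show ?thesis using \<rho>(2,3) assms by (simp add: vf_diff)
qed

end

text \<open>A partial derivative makes sense only inside the chart. Multiplying its values by a
  cutoff preserves additivity and the Leibniz rule and makes it a global derivation.\<close>

lemma chart_derivation:
  assumes U: "(U, \<phi>) \<in> N" and s: "cball c s \<subseteq> \<phi> ` U"
    and \<rho>: "smooth_on UNIV \<rho>" "\<And>x. dist c x \<ge> s \<Longrightarrow> \<rho> x = 0"
  shows "(\<lambda>u. if u \<in> C then (\<lambda>q. if q \<in> U then \<rho> (\<phi> q) *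
    frechet_derivative (u \<circ> inv_into U \<phi>) (at (\<phi> q)) e else 0) else 0) \<in> VF" (is "?E \<in> VF")
proof -
  let ?u = "\<lambda>u. u \<circ> inv_into U \<phi>" and ?D = "\<lambda>u q. frechet_derivative (u \<circ> inv_into U \<phi>) (at (\<phi> q))"
  have D: "(?u u has_derivative ?D u q) (at (\<phi> q))" if "u \<in> C" "q \<in> U" for u q
    by (rule smooth_on_has_derivative[OF chart_homeo(2)[OF U] smooth_functions_chart[OF U that(1)]])
      (use that in auto)
  have smooth: "?E u \<in> C" if "u \<in> C" for u
    using bump_extension[OF U chart_homeo(2)[OF U] order_refl \<rho> s
        smooth_on_frechet[OF smooth_functions_chart[OF U that]]] that by simp
  have add: "?D (u + v) q e = ?D u q e + ?D v q e" if "u \<in> C" "v \<in> C" "q \<in> U" for u v q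
  proof -
    have "?u (u + v) = (\<lambda>x. ?u u x + ?u v x)" by (auto simp: fun_eq_iff)
    then show ?thesis
      using frechet_derivative_at[OF has_derivative_add[OF D[OF that(1,3)] D[OF that(2,3)]]] by metis
  qed
  have mult: "?D (u * v) q e = ?D u q e * v q + u q * ?D v q e" if "u \<in> C" "v \<in> C" "q \<in> U" for u v q
  proof -
    have "?u (u * v) = (\<lambda>x. ?u u x * ?u v x)" by (auto simp: fun_eq_iff)
    then have "?D (u * v) q = (\<lambda>h. ?u u (\<phi> q) * ?D v q h + ?D u q h * ?u v (\<phi> q))"
      using frechet_derivative_at[OF has_derivative_mult[OF D[OF that(1,3)] D[OF that(2,3)]]] by metis
    then show ?thesis using chart_inv[OF U that(3)] by simp
  qed
  have const: "?D (\<lambda>_. a) q e = 0" for a q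
    by (simp add: o_def)
  show ?thesis
    unfolding vector_fields_def
  proof (intro CollectI conjI ballI allI impI)
    show "?E u \<in> C" if "u \<in> C" for u using smooth[OF that] .
    show "?E (u + v) = ?E u + ?E v" if "u \<in> C" "v \<in> C" for u v
      using that by (auto simp: fun_eq_iff add algebra_simps)
    show "?E ((\<lambda>_. a) * u) = (\<lambda>_. a) * ?E u" if "u \<in> C" for u a
      using that mult[OF smooth_functions_const that, of _ a] by (auto simp: fun_eq_iff const)
    show "?E (u * v) = ?E u * v + u * ?E v" if "u \<in> C" "v \<in> C" for u v
      using that by (auto simp: fun_eq_iff mult algebra_simps)
    show "?E u = 0" if "u \<notin> C" for u using that by simp
  qed
qed

text \<open>The last clause is the point: a derivation is determined by its values on coordinates.
  Hadamard's lemma writes \<open>u\<close> near \<open>q\<close> as a constant plus products of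
  \<open>x e - x e q\<close> with smooth functions; \<open>X\<close> kills the constant, and at
  \<open>q\<close> only the terms where \<open>X\<close> hits the coordinate survive.\<close>

lemma chart_frame:
  assumes U: "(U, \<phi>) \<in> N" and W: "open W" "p \<in> W" "W \<subseteq> U"
  obtains x E W' where "open W'" "p \<in> W'" "W' \<subseteq> W"
    "\<And>e. x e \<in> C" "\<And>e. E e \<in> VF"
    "\<And>e q. q \<in> W' \<Longrightarrow> x e q = \<phi> q \<bullet> e"
    "\<And>e q u. q \<in> W' \<Longrightarrow> u \<in> C \<Longrightarrow> E e u q = frechet_derivative (u \<circ> inv_into U \<phi>) (at (\<phi> q)) e"
    "\<And>e e' q. q \<in> W' \<Longrightarrow> E e (x e') q = e \<bullet> e'"
    "\<And>X u q. X \<in> VF \<Longrightarrow> u \<in> C \<Longrightarrow> q \<in> W' \<Longrightarrow> X u q = (\<Sum>e\<in>Basis. X (x e) q * E e u q)"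
proof -
  obtain s where s: "s > 0" "cball (\<phi> p) s \<subseteq> \<phi> ` W" using chart_ball[OF assms] .
  define r where "r = s / 2"
  have r: "0 < r" "r < s" using s by (auto simp: r_def)
  obtain \<rho> :: "'e \<Rightarrow> real" where \<rho>: "smooth_on UNIV \<rho>" "\<And>x. dist (\<phi> p) x \<le> r \<Longrightarrow> \<rho> x = 1"
    "\<And>x. dist (\<phi> p) x \<ge> s \<Longrightarrow> \<rho> x = 0"
    using smooth_bump_exists[OF r] by blast
  have sU: "cball (\<phi> p) s \<subseteq> \<phi> ` U" using s W by blast
  define W' where "W' = {q \<in> U. \<phi> q \<in> ball (\<phi> p) r}"
  have bU: "ball (\<phi> p) r \<subseteq> \<phi> ` U" using sU r by auto
  have W'1: "\<rho> (\<phi> q) = 1" "q \<in> U" "\<phi> q \<in> ball (\<phi> p) r" if "q \<in> W'" for q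
    using that \<rho>(2)[of "\<phi> q"] by (auto simp: W'_def)
  have oW': "open W'" unfolding W'_def by (rule chart_open_preimage[OF U]) auto
  have lin: "bounded_linear (\<lambda>y::'e. y \<bullet> e)" for e by (rule bounded_linear_inner_left)
  define x where "x e q = (if q \<in> U then \<rho> (\<phi> q) * (\<phi> q \<bullet> e) else 0)" for e q
  define E where "E e = (\<lambda>u. if u \<in> C then (\<lambda>q. if q \<in> U then \<rho> (\<phi> q) *
    frechet_derivative (u \<circ> inv_into U \<phi>) (at (\<phi> q)) e else 0) else 0)" for e
  have xC: "x e \<in> C" for e
    unfolding x_def[abs_def]
    by (rule bump_extension[OF U chart_homeo(2)[OF U] order_refl \<rho>(1,3) sU
          smooth_on_linear[OF chart_homeo(2)[OF U] lin]])
  have EVF: "E e \<in> VF" for e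
    unfolding E_def by (rule chart_derivation[OF U sU \<rho>(1,3)])
  have xW: "x e q = \<phi> q \<bullet> e" if "q \<in> W'" for e q
    using W'1[OF that] by (simp add: x_def)
  have EW: "E e u q = frechet_derivative (u \<circ> inv_into U \<phi>) (at (\<phi> q)) e" if "q \<in> W'" "u \<in> C" for e u q
    using W'1[OF that(1)] that(2) by (simp add: E_def)
  show thesis
  proof
    show "open W'" by (rule oW')
    show "p \<in> W'" using W r by (auto simp: W'_def)
    show "W' \<subseteq> W"
    proof
      fix q assume q: "q \<in> W'"
      then have "\<phi> q \<in> \<phi> ` W" using s r by (auto simp: W'_def)
      then show "q \<in> W" using chart_inj[OF U] W(3) W'1(2)[OF q] by (auto dest: inj_onD)
    qed
    show "x e \<in> C" "E e \<in> VF" for e by fact+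
    show "x e q = \<phi> q \<bullet> e" if "q \<in> W'" for e q using xW[OF that] .
    show "E e u q = frechet_derivative (u \<circ> inv_into U \<phi>) (at (\<phi> q)) e" if "q \<in> W'" "u \<in> C" for e u q
      using EW[OF that] .
    show "E e (x e') q = e \<bullet> e'" if q: "q \<in> W'" for e e' q
    proof -
      have "((\<lambda>y. y \<bullet> e') has_derivative (\<lambda>y. y \<bullet> e')) (at (\<phi> q))"
        by (rule bounded_linear_imp_has_derivative[OF lin])
      then have "(x e' \<circ> inv_into U \<phi> has_derivative (\<lambda>y. y \<bullet> e')) (at (\<phi> q))"
      proof (rule has_derivative_transform_within_open[OF _ open_ball W'1(3)[OF q]])
        fix y assume y: "y \<in> ball (\<phi> p) r"
        then have "y \<in> \<phi> ` U" using bU by blast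
        then have "inv_into U \<phi> y \<in> W'" "\<phi> (inv_into U \<phi> y) = y"
          using y by (auto simp: W'_def chart_inv[OF U])
        then show "y \<bullet> e' = (x e' \<circ> inv_into U \<phi>) y" using xW by simp
      qed
      from frechet_derivative_at[OF this, symmetric] show ?thesis
        using EW[OF q xC] by simp
    qed
    show "X u q = (\<Sum>e\<in>Basis. X (x e) q * E e u q)" if X: "X \<in> VF" and u: "u \<in> C" and q: "q \<in> W'" for X u q
    proof -
      let ?B = "ball (\<phi> p) r"
      have sB: "smooth_on ?B (u \<circ> inv_into U \<phi>)"
        by (rule smooth_on_subset[OF chart_homeo(2)[OF U] bU smooth_functions_chart[OF U u]])
      obtain g where g: "\<And>e. smooth_on ?B (g e)"
        "\<And>e. g e (\<phi> q) = frechet_derivative (u \<circ> inv_into U \<phi>) (at (\<phi> q)) e"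
        "\<And>y. y \<in> ?B \<Longrightarrow> (u \<circ> inv_into U \<phi>) y =
          (u \<circ> inv_into U \<phi>) (\<phi> q) + (\<Sum>e\<in>Basis. ((y - \<phi> q) \<bullet> e) * g e y)"
        by (rule hadamard[OF sB open_ball convex_ball W'1(3)[OF q]]) (rule that)
      obtain t where t: "t > 0" "cball (\<phi> q) t \<subseteq> ?B"
        using open_contains_cball[of ?B] W'1(3)[OF q] by blast
      obtain \<tau> :: "'e \<Rightarrow> real" where \<tau>: "smooth_on UNIV \<tau>" "\<And>x. dist (\<phi> q) x \<le> t / 2 \<Longrightarrow> \<tau> x = 1"
        "\<And>x. dist (\<phi> q) x \<ge> t \<Longrightarrow> \<tau> x = 0"
        using smooth_bump_exists[of "t / 2" t "\<phi> q"] t(1) by auto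
      \<comment> \<open>Hadamard's coefficients live in the chart only. A second cutoff, centred at
        \<open>q\<close>, turns them into global functions, so that \<open>X\<close> can act on the
        expansion; the expansion holds only near \<open>q\<close>, which is enough by
        locality.\<close>
      define G where "G e q' = (if q' \<in> U then \<tau> (\<phi> q') * g e (\<phi> q') else 0)" for e q'
      have GC: "G e \<in> C" for e
        unfolding G_def[abs_def] by (rule bump_extension[OF U open_ball bU \<tau>(1,3) t(2) g(1)])
      define W2 where "W2 = {q' \<in> U. \<phi> q' \<in> ball (\<phi> q) (t / 2)}"
      have oW2: "open W2" unfolding W2_def by (rule chart_open_preimage[OF U]) auto
      have W2: "q' \<in> W'" "\<tau> (\<phi> q') = 1" if "q' \<in> W2" for q'
      proof -
        have "\<phi> q' \<in> cball (\<phi> q) t" using that t(1) by (auto simp: W2_def)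
        then have "\<phi> q' \<in> ?B" using t(2) by (rule rev_subsetD)
        then show "q' \<in> W'" using that by (simp add: W2_def W'_def)
        show "\<tau> (\<phi> q') = 1" using that \<tau>(2)[of "\<phi> q'"] by (simp add: W2_def)
      qed
      have qW2: "q \<in> W2" using W'1(2)[OF q] t(1) by (simp add: W2_def)
      let ?v = "(\<lambda>_. u q) + (\<Sum>e\<in>Basis. (x e - (\<lambda>_. x e q)) * G e)"
      have uv: "u q' = ?v q'" if "q' \<in> W2" for q'
        using g(3)[OF W'1(3)[OF W2(1)[OF that]]] W'1(2)[OF W2(1)[OF that]] W2(2)[OF that] W'1(2)[OF q]
        by (simp add: chart_inv[OF U] sum_fun_apply xW[OF q] xW[OF W2(1)[OF that]] G_def inner_diff_left)
      have sC: "(x e - (\<lambda>_. x e q)) * G e \<in> C" for e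
        by (intro smooth_functions_mult smooth_functions_diff smooth_functions_const xC GC)
      have vC: "?v \<in> C"
        by (intro smooth_functions_add smooth_functions_sum smooth_functions_const sC)
      have "X u q = X ?v q"
        by (rule vf_local[OF X u vC oW2 qW2 uv])
      also have "X ?v = X (\<lambda>_. u q) + (\<Sum>e\<in>Basis. X ((x e - (\<lambda>_. x e q)) * G e))"
        unfolding vf_add[OF X smooth_functions_const smooth_functions_sum[OF sC]] vf_sum[OF X sC] ..
      also have "\<dots> q = (\<Sum>e\<in>Basis. X (x e) q * G e q)"
        by (simp add: vf_const[OF X] sum_fun_apply vf_mult[OF X] vf_diff[OF X] xC GC)
      also have "\<dots> = (\<Sum>e\<in>Basis. X (x e) q * E e u q)"
        by (rule sum.cong[OF refl]) (simp add: EW[OF q u] G_def W'1[OF q] W2(2)[OF qW2] g(2))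
      finally show ?thesis .
    qed
  qed
qed

end

section \<open>Modules of vector fields and forms\<close>

text \<open>Vector fields and 1-forms are both maps into real functions on the manifold, so one
  notion of module and one of linearity serve both.\<close>

definition function_module :: "('a \<Rightarrow> real) set \<Rightarrow> ('z \<Rightarrow> 'a \<Rightarrow> real) set \<Rightarrow> bool" where
  "function_module R M \<longleftrightarrow> 0 \<in> M \<and> (\<forall>z\<in>M. \<forall>z'\<in>M. z + z' \<in> M) \<and> (\<forall>u\<in>R. \<forall>z\<in>M. fscale u z \<in> M)"

definition function_linear ::
  "('a \<Rightarrow> real) set \<Rightarrow> ('z \<Rightarrow> 'a \<Rightarrow> real) set \<Rightarrow> (('z \<Rightarrow> 'a \<Rightarrow> real) \<Rightarrow> 'a \<Rightarrow> real) \<Rightarrow> bool" where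
  "function_linear R M A \<longleftrightarrow> (\<forall>z\<in>M. \<forall>z'\<in>M. A (z + z') = A z + A z') \<and>
     (\<forall>u\<in>R. \<forall>z\<in>M. A (fscale u z) = u * A z)"

lemma fscale_apply [simp]: "fscale u z x = u * z x"
  by (simp add: fscale_def)

lemma fscale_minus_1: "fscale (\<lambda>_. - 1) z = - z"
  by (simp add: fun_eq_iff)

lemma fscale_0 [simp]: "fscale u 0 = 0"
  by (simp add: fun_eq_iff)

lemma function_linear_add: "function_linear R M A \<Longrightarrow> z \<in> M \<Longrightarrow> z' \<in> M \<Longrightarrow> A (z + z') = A z + A z'"
  and function_linear_fscale: "function_linear R M A \<Longrightarrow> u \<in> R \<Longrightarrow> z \<in> M \<Longrightarrow> A (fscale u z) = u * A z"
  by (auto simp: function_linear_def)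

context manifold
begin

lemma module_add: "function_module C M \<Longrightarrow> z \<in> M \<Longrightarrow> z' \<in> M \<Longrightarrow> z + z' \<in> M"
  and module_fscale: "function_module C M \<Longrightarrow> u \<in> C \<Longrightarrow> z \<in> M \<Longrightarrow> fscale u z \<in> M"
  and module_0: "function_module C M \<Longrightarrow> 0 \<in> M"
  by (auto simp: function_module_def)

lemma module_uminus: "function_module C M \<Longrightarrow> z \<in> M \<Longrightarrow> - z \<in> M"
  using module_fscale[OF _ smooth_functions_const[of "- 1"]] by (simp add: fscale_minus_1)

lemma module_diff: "function_module C M \<Longrightarrow> z \<in> M \<Longrightarrow> z' \<in> M \<Longrightarrow> z - z' \<in> M"
  using module_add[of M z "- z'"] module_uminus[of M z'] by simp

lemma module_sum: "function_module C M \<Longrightarrow> (\<And>i. i \<in> I \<Longrightarrow> z i \<in> M) \<Longrightarrow> sum z I \<in> M"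
  by (induction I rule: infinite_finite_induct) (auto intro: module_0 module_add)

lemma function_linear_0: "function_linear C M A \<Longrightarrow> function_module C M \<Longrightarrow> A 0 = 0"
  using function_linear_add[of C M A 0 0] module_0 by fastforce

lemma function_linear_uminus: "function_linear C M A \<Longrightarrow> z \<in> M \<Longrightarrow> A (- z) = - A z"
  using function_linear_fscale[of C M A "\<lambda>_. - 1" z] smooth_functions_const[of "- 1"]
  by (simp add: fscale_minus_1 fun_eq_iff)

lemma function_linear_diff:
  "function_linear C M A \<Longrightarrow> function_module C M \<Longrightarrow> z \<in> M \<Longrightarrow> z' \<in> M \<Longrightarrow> A (z - z') = A z - A z'"
  using function_linear_add[of C M A z "- z'"] function_linear_uminus[of M A z'] module_uminus[of M z'] by simp

lemma function_linear_sum: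
  assumes "function_linear C M A" "function_module C M" "\<And>i. i \<in> I \<Longrightarrow> z i \<in> M"
  shows "A (sum z I) = (\<Sum>i\<in>I. A (z i))"
  using assms(3)
proof (induction I rule: infinite_finite_induct)
  case (insert i I)
  have "A (sum z (insert i I)) = A (z i) + A (sum z I)"
    unfolding sum.insert[OF insert(1,2)]
    by (rule function_linear_add[OF assms(1) _ module_sum[OF assms(2)]]) (use insert in auto)
  also have "A (sum z I) = (\<Sum>i\<in>I. A (z i))" by (rule insert.IH) (use insert.prems in auto)
  also have "A (z i) + (\<Sum>i\<in>I. A (z i)) = (\<Sum>i\<in>insert i I. A (z i))"
    by (rule sum.insert[OF insert(1,2), symmetric])
  finally show ?case .
qed (auto simp: function_linear_0[OF assms(1,2)])

lemma VF_module: "function_module C VF"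
  unfolding function_module_def vector_fields_def
  by (auto simp: fun_eq_iff algebra_simps)

lemma OF_module: "function_module C OF"
  unfolding function_module_def one_forms_def
  by (auto simp: algebra_simps)

lemmas VF_closed [simp] = module_add[OF VF_module] module_fscale[OF VF_module] module_0[OF VF_module]
  module_uminus[OF VF_module] module_diff[OF VF_module]
lemmas VF_sum = module_sum[OF VF_module]
lemmas OF_closed [simp] = module_add[OF OF_module] module_fscale[OF OF_module] module_0[OF OF_module]
  module_uminus[OF OF_module] module_diff[OF OF_module]
lemmas OF_sum = module_sum[OF OF_module]

lemma form_linear: "\<alpha> \<in> OF \<Longrightarrow> function_linear C VF \<alpha>"
  by (simp add: one_forms_def function_linear_def)

lemma form_smooth [simp]: "\<alpha> \<in> OF \<Longrightarrow> X \<in> VF \<Longrightarrow> \<alpha> X \<in> C"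
  unfolding one_forms_def mem_Collect_eq by (elim conjE) (erule bspec)

lemma form_outside:
  assumes "\<alpha> \<in> OF" "X \<notin> VF" shows "\<alpha> X = 0"
  by (rule assms(1)[unfolded one_forms_def mem_Collect_eq, THEN conjunct2, THEN conjunct2,
        THEN conjunct2, rule_format, OF assms(2)])

lemma formI:
  assumes "function_linear C VF \<alpha>" "\<And>X. X \<in> VF \<Longrightarrow> \<alpha> X \<in> C" "\<And>X. X \<notin> VF \<Longrightarrow> \<alpha> X = 0"
  shows "\<alpha> \<in> OF"
  unfolding one_forms_def mem_Collect_eq
  by (intro conjI ballI allI impI)
    (rule assms(2) assms(3) function_linear_add[OF assms(1)] function_linear_fscale[OF assms(1)]; assumption)+

lemma vf_eqI: "X \<in> VF \<Longrightarrow> Y \<in> VF \<Longrightarrow> (\<And>u p. u \<in> C \<Longrightarrow> X u p = Y u p) \<Longrightarrow> X = Y"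
  by (intro ext) (metis vf_outside)

lemma form_eqI: "\<alpha> \<in> OF \<Longrightarrow> \<beta> \<in> OF \<Longrightarrow> (\<And>X p. X \<in> VF \<Longrightarrow> \<alpha> X p = \<beta> X p) \<Longrightarrow> \<alpha> = \<beta>"
  by (intro ext) (metis form_outside)

text \<open>The axioms of a derivation involve one point at a time and hold there for the single
  field \<open>Z p\<close>. Only smoothness of the values compares neighbouring points, and there
  the compatibility assumption enters.\<close>

lemma vf_glue:
  assumes "\<And>p. Z p \<in> VF"
    "\<And>p. \<exists>W. open W \<and> p \<in> W \<and> (\<forall>q\<in>W. \<forall>u\<in>C. Z q u q = Z p u q)"
  shows "(\<lambda>u p. Z p u p) \<in> VF"
  unfolding vector_fields_def
proof (intro CollectI conjI ballI allI impI)
  show "(\<lambda>p. Z p u p) \<in> C" if "u \<in> C" for u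
  proof (rule smooth_functionsI_local)
    fix p
    from assms(2)[of p] obtain W where "open W" "p \<in> W" "\<forall>q\<in>W. \<forall>u\<in>C. Z q u q = Z p u q" by blast
    then show "\<exists>W v. open W \<and> p \<in> W \<and> v \<in> C \<and> (\<forall>q\<in>W. Z q u q = v q)"
      using that assms(1)[of p] vf_smooth by blast
  qed
qed (auto simp: fun_eq_iff vf_add[OF assms(1)] vf_cmult[OF assms(1)] vf_mult[OF assms(1)] vf_outside[OF assms(1)])

section \<open>Local frames and pointwise dependence\<close>

definition local_frame :: "'a set \<Rightarrow> ('e \<Rightarrow> 'a \<Rightarrow> real) \<Rightarrow> ('e \<Rightarrow> 'a vfield) \<Rightarrow> bool" where
  "local_frame W x E \<longleftrightarrow> open W \<and> (\<forall>e. x e \<in> C) \<and> (\<forall>e. E e \<in> VF) \<and>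
     (\<forall>e e'. \<forall>q\<in>W. E e (x e') q = e \<bullet> e') \<and>
     (\<forall>X\<in>VF. \<forall>u\<in>C. \<forall>q\<in>W. X u q = (\<Sum>e\<in>Basis. X (x e) q * E e u q))"

lemma local_frameD:
  assumes "local_frame W x E"
  shows "open W" "x e \<in> C" "E e \<in> VF" "q \<in> W \<Longrightarrow> E e (x e') q = e \<bullet> e'"
    "X \<in> VF \<Longrightarrow> u \<in> C \<Longrightarrow> q \<in> W \<Longrightarrow> X u q = (\<Sum>e\<in>Basis. X (x e) q * E e u q)"
proof -
  note a = assms[unfolded local_frame_def]
  show "open W" by (rule a[THEN conjunct1])
  show "x e \<in> C" by (rule a[THEN conjunct2, THEN conjunct1, rule_format])
  show "E e \<in> VF" by (rule a[THEN conjunct2, THEN conjunct2, THEN conjunct1, rule_format])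
  show "q \<in> W \<Longrightarrow> E e (x e') q = e \<bullet> e'"
    by (rule a[THEN conjunct2, THEN conjunct2, THEN conjunct2, THEN conjunct1, rule_format])
  show "X \<in> VF \<Longrightarrow> u \<in> C \<Longrightarrow> q \<in> W \<Longrightarrow> X u q = (\<Sum>e\<in>Basis. X (x e) q * E e u q)"
    by (rule a[THEN conjunct2, THEN conjunct2, THEN conjunct2, THEN conjunct2, rule_format])
qed

lemma frame_at: obtains x E W where "p \<in> W" "local_frame W x E"
proof -
  obtain U \<phi> where U: "(U, \<phi>) \<in> N" "p \<in> U" using chart_at by blast
  show thesis
  proof (rule chart_frame[OF U(1) chart_homeo(1)[OF U(1)] U(2) order_refl])
    fix x :: "'e \<Rightarrow> 'a \<Rightarrow> real" and E :: "'e \<Rightarrow> 'a vfield" and W'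
    assume a: "open W'" "p \<in> W'" "W' \<subseteq> U" "\<And>e. x e \<in> C" "\<And>e. E e \<in> VF"
      "\<And>e e' q. q \<in> W' \<Longrightarrow> E e (x e') q = e \<bullet> e'"
      "\<And>X u q. X \<in> VF \<Longrightarrow> u \<in> C \<Longrightarrow> q \<in> W' \<Longrightarrow> X u q = (\<Sum>e\<in>Basis. X (x e) q * E e u q)"
    have "local_frame W' x E"
      unfolding local_frame_def by (intro conjI allI ballI) ((rule a; assumption)+)
    then show thesis using a(2) by (rule that[rotated])
  qed
qed

text \<open>Function-linear maps depend only on the value of their argument at the point of evaluation:
  a bump function makes them local, and a local frame then reduces the claim to finitely many
  coefficients.\<close>

lemma linear_local:
  assumes A: "function_linear C M A" and M: "function_module C M" and z: "z \<in> M"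
    and W: "open W" "q \<in> W" "\<And>q' x. q' \<in> W \<Longrightarrow> z x q' = 0"
  shows "A z q = 0"
proof -
  obtain \<rho> W' where \<rho>: "\<rho> \<in> C" "q \<in> W'" "\<And>x. x \<in> W' \<Longrightarrow> \<rho> x = 1" "\<And>x. x \<notin> W \<Longrightarrow> \<rho> x = 0"
    using bump_exists[OF W(1,2)] by metis
  have "fscale \<rho> z = 0"
  proof (intro ext)
    fix x q' show "fscale \<rho> z x q' = 0 x q'" using W(3)[of q' x] \<rho>(4)[of q'] by auto
  qed
  then have "\<rho> * A z = 0"
    using function_linear_fscale[OF A \<rho>(1) z] function_linear_0[OF A M] by simp
  then have "\<rho> q * A z q = 0" by (metis times_fun_apply zero_fun_apply)
  then show ?thesis using \<rho>(2,3) by simp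
qed

text \<open>The difference between \<open>X\<close> and its frame expansion vanishes on all of
  \<open>W\<close>, not merely at \<open>q\<close>, which is what locality of \<open>A\<close>
  requires.\<close>

lemma linear_frame_expansion:
  assumes A: "function_linear C VF A" and X: "X \<in> VF"
    and fr: "local_frame W x E" and q: "q \<in> W"
  shows "A X q = (\<Sum>e\<in>Basis. X (x e) q * A (E e) q)"
proof -
  note W = local_frameD[OF fr]
  let ?Y = "\<Sum>e\<in>Basis. fscale (X (x e)) (E e)"
  have Y: "?Y \<in> VF" by (intro VF_sum) (simp add: X W(2,3) vf_smooth)
  have "A (X - ?Y) q = 0"
  proof (rule linear_local[OF A VF_module _ W(1) q])
    show "X - ?Y \<in> VF" using X Y by simp
    show "(X - ?Y) u q' = 0" if "q' \<in> W" for q' u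
    proof (cases "u \<in> C")
      case True
      then show ?thesis using W(5)[OF X True that] by (simp add: sum_fun_apply)
    next
      case False
      then show ?thesis using vf_outside[OF \<open>X - ?Y \<in> VF\<close> False] by simp
    qed
  qed
  then have "A X q = A ?Y q" using function_linear_diff[OF A VF_module X Y] by simp
  also have "A ?Y = (\<Sum>e\<in>Basis. X (x e) * A (E e))"
    using function_linear_sum[OF A VF_module, of Basis "\<lambda>e. fscale (X (x e)) (E e)"]
    by (simp add: X W(2,3) vf_smooth function_linear_fscale[OF A])
  finally show ?thesis by (simp add: sum_fun_apply)
qed

lemma linear_pointwise_VF:
  assumes A: "function_linear C VF A" and XY: "X \<in> VF" "Y \<in> VF" "\<And>u. u \<in> C \<Longrightarrow> X u p = Y u p"
  shows "A X p = A Y p"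
proof -
  obtain x E W where p: "p \<in> W" and fr: "local_frame W x E" using frame_at .
  show ?thesis
    using linear_frame_expansion[OF A XY(1) fr p] linear_frame_expansion[OF A XY(2) fr p] XY(3) local_frameD(2)[OF fr] by simp
qed

section \<open>Differentials and functionals on 1-forms\<close>

lemma differential_form [simp]: "u \<in> C \<Longrightarrow> differential N u \<in> OF"
  by (rule formI) (auto simp: differential_def function_linear_def vf_smooth)

lemma differential_apply: "X \<in> VF \<Longrightarrow> differential N u X = X u"
  by (simp add: differential_def)

lemma differential_add: "u \<in> C \<Longrightarrow> v \<in> C \<Longrightarrow> differential N (u + v) = differential N u + differential N v"
  by (auto simp: differential_def fun_eq_iff vf_add)

lemma differential_cmult: "u \<in> C \<Longrightarrow> differential N ((\<lambda>_. c) * u) = fscale (\<lambda>_. c) (differential N u)"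
  by (auto simp: differential_def fun_eq_iff vf_cmult)

lemma differential_mult:
  "u \<in> C \<Longrightarrow> v \<in> C \<Longrightarrow> differential N (u * v) = fscale v (differential N u) + fscale u (differential N v)"
  by (auto simp: differential_def fun_eq_iff vf_mult algebra_simps)

lemma linear_coframe_expansion:
  assumes A: "function_linear C OF A" and \<alpha>: "\<alpha> \<in> OF"
    and fr: "local_frame W x E" and q: "q \<in> W"
  shows "A \<alpha> q = (\<Sum>e\<in>Basis. \<alpha> (E e) q * A (differential N (x e)) q)"
proof -
  note W = local_frameD[OF fr]
  let ?\<beta> = "\<Sum>e\<in>Basis. fscale (\<alpha> (E e)) (differential N (x e))"
  have \<beta>: "?\<beta> \<in> OF" by (intro OF_sum) (simp add: \<alpha> W(2,3))
  have "A (\<alpha> - ?\<beta>) q = 0"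
  proof (rule linear_local[OF A OF_module _ W(1) q])
    show *: "\<alpha> - ?\<beta> \<in> OF" using \<alpha> \<beta> by simp
    show "(\<alpha> - ?\<beta>) X q' = 0" if "q' \<in> W" for q' X
    proof (cases "X \<in> VF")
      case True
      then show ?thesis
        using linear_frame_expansion[OF form_linear[OF \<alpha>] True fr that]
        by (simp add: sum_fun_apply differential_apply mult.commute)
    next
      case False
      then show ?thesis using form_outside[OF * False] by simp
    qed
  qed
  then have "A \<alpha> q = A ?\<beta> q" using function_linear_diff[OF A OF_module \<alpha> \<beta>] by simp
  also have "A ?\<beta> = (\<Sum>e\<in>Basis. \<alpha> (E e) * A (differential N (x e)))"
    using function_linear_sum[OF A OF_module, of Basis "\<lambda>e. fscale (\<alpha> (E e)) (differential N (x e))"]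
    by (simp add: \<alpha> W(2,3) function_linear_fscale[OF A])
  finally show ?thesis by (simp add: sum_fun_apply)
qed

lemma linear_pointwise_OF:
  assumes A: "function_linear C OF A" and ab: "\<alpha> \<in> OF" "\<beta> \<in> OF" "\<And>X. X \<in> VF \<Longrightarrow> \<alpha> X p = \<beta> X p"
  shows "A \<alpha> p = A \<beta> p"
proof -
  obtain x E W where p: "p \<in> W" and fr: "local_frame W x E" using frame_at .
  show ?thesis
    using linear_coframe_expansion[OF A ab(1) fr p] linear_coframe_expansion[OF A ab(2) fr p] ab(3) local_frameD(3)[OF fr] by simp
qed

text \<open>The coordinate differentials span the 1-forms at each point. Identities linear over the
  smooth functions thereby reduce to exact forms, where the Jacobi identity is available.\<close>

lemma linear_eq_on_exact:
  assumes A: "function_linear C OF A" and B: "function_linear C OF B"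
    and eq: "\<And>u. u \<in> C \<Longrightarrow> A (differential N u) p = B (differential N u) p" and \<alpha>: "\<alpha> \<in> OF"
  shows "A \<alpha> p = B \<alpha> p"
proof -
  obtain x E W where p: "p \<in> W" and fr: "local_frame W x E" using frame_at .
  show ?thesis
    using linear_coframe_expansion[OF A \<alpha> fr p] linear_coframe_expansion[OF B \<alpha> fr p] eq local_frameD(2)[OF fr] by simp
qed

text \<open>Reflexivity of the module of vector fields: the representing field can only be
  \<open>u \<mapsto> A (du)\<close>, and the product rule for differentials makes it a derivation.
  This gives meaning to the description in \<open>sharp\<close>.\<close>

lemma form_functional_represented:
  assumes A: "function_linear C OF A" and smooth: "\<And>\<alpha>. \<alpha> \<in> OF \<Longrightarrow> A \<alpha> \<in> C"
  shows "\<exists>!X. X \<in> VF \<and> (\<forall>\<beta>\<in>OF. \<beta> X = A \<beta>)"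
proof
  define X where "X u = (if u \<in> C then A (differential N u) else 0)" for u
  have XVF: "X \<in> VF"
    unfolding vector_fields_def
  proof (intro CollectI conjI ballI allI impI)
    show "X (u + v) = X u + X v" if "u \<in> C" "v \<in> C" for u v
      using that by (simp add: X_def differential_add function_linear_add[OF A])
    show "X ((\<lambda>_. c) * u) = (\<lambda>_. c) * X u" if "u \<in> C" for u c
      using that by (simp add: X_def differential_cmult function_linear_fscale[OF A])
    show "X (u * v) = X u * v + u * X v" if "u \<in> C" "v \<in> C" for u v
      using that by (simp add: X_def differential_mult function_linear_add[OF A]
          function_linear_fscale[OF A] mult.commute)
  qed (simp_all add: X_def smooth)
  have lin: "function_linear C OF (\<lambda>\<beta>. \<beta> X)" by (simp add: function_linear_def)
  have "\<beta> X = A \<beta>" if "\<beta> \<in> OF" for \<beta>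
  proof
    fix p show "\<beta> X p = A \<beta> p"
      by (rule linear_eq_on_exact[OF lin A _ that]) (simp add: differential_apply XVF X_def)
  qed
  then show "X \<in> VF \<and> (\<forall>\<beta>\<in>OF. \<beta> X = A \<beta>)" using XVF by blast
  fix Y assume Y: "Y \<in> VF \<and> (\<forall>\<beta>\<in>OF. \<beta> Y = A \<beta>)"
  show "Y = X"
  proof (rule vf_eqI)
    fix u p assume "u \<in> C"
    then show "Y u p = X u p" using Y differential_apply[of Y u] by (simp add: X_def)
  qed (use Y XVF in auto)
qed

section \<open>The sharp map\<close>

context
  fixes P assumes P: "bivector_field N P"
begin

lemma bivector_smooth [simp]: "\<alpha> \<in> OF \<Longrightarrow> \<beta> \<in> OF \<Longrightarrow> P \<alpha> \<beta> \<in> C"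
  by (rule P[unfolded bivector_field_def, THEN conjunct1, rule_format])

lemma bivector_skew: "\<alpha> \<in> OF \<Longrightarrow> \<beta> \<in> OF \<Longrightarrow> P \<alpha> \<beta> = - P \<beta> \<alpha>"
  by (rule P[unfolded bivector_field_def, THEN conjunct2, THEN conjunct2, THEN conjunct2, rule_format])

lemma bivector_linear1: "\<beta> \<in> OF \<Longrightarrow> function_linear C OF (\<lambda>\<alpha>. P \<alpha> \<beta>)"
  unfolding function_linear_def
  by (intro conjI ballI)
    (erule (1) P[unfolded bivector_field_def, THEN conjunct2, THEN conjunct1, rule_format],
      assumption,
      erule P[unfolded bivector_field_def, THEN conjunct2, THEN conjunct2, THEN conjunct1, rule_format],
      assumption+)

lemma bivector_linear2:
  assumes "\<alpha> \<in> OF" shows "function_linear C OF (P \<alpha>)"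
  unfolding function_linear_def
proof (intro conjI ballI)
  fix \<beta> \<gamma> assume b: "\<beta> \<in> OF" "\<gamma> \<in> OF"
  show "P \<alpha> (\<beta> + \<gamma>) = P \<alpha> \<beta> + P \<alpha> \<gamma>"
    unfolding bivector_skew[OF assms module_add[OF OF_module b]] bivector_skew[OF assms b(1)]
      bivector_skew[OF assms b(2)] function_linear_add[OF bivector_linear1[OF assms] b] by simp
next
  fix u \<beta> assume b: "u \<in> C" "\<beta> \<in> OF"
  show "P \<alpha> (fscale u \<beta>) = u * P \<alpha> \<beta>"
    unfolding bivector_skew[OF assms module_fscale[OF OF_module b]] bivector_skew[OF assms b(2)]
      function_linear_fscale[OF bivector_linear1[OF assms] b] by simp
qed

lemma sharp_spec: "\<alpha> \<in> OF \<Longrightarrow> sharp N P \<alpha> \<in> VF \<and> (\<forall>\<beta>\<in>OF. \<beta> (sharp N P \<alpha>) = P \<alpha> \<beta>)"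
  unfolding sharp_def
  by (rule theI'[OF form_functional_represented[OF bivector_linear2]]) auto

lemma sharp_VF [simp]: "\<alpha> \<in> OF \<Longrightarrow> sharp N P \<alpha> \<in> VF"
  and form_sharp: "\<alpha> \<in> OF \<Longrightarrow> \<beta> \<in> OF \<Longrightarrow> \<beta> (sharp N P \<alpha>) = P \<alpha> \<beta>"
  using sharp_spec by auto

lemma sharp_apply: "\<alpha> \<in> OF \<Longrightarrow> u \<in> C \<Longrightarrow> sharp N P \<alpha> u = P \<alpha> (differential N u)"
  using form_sharp[of \<alpha> "differential N u"] by (simp add: differential_apply)

lemma sharp_add: "\<alpha> \<in> OF \<Longrightarrow> \<beta> \<in> OF \<Longrightarrow> sharp N P (\<alpha> + \<beta>) = sharp N P \<alpha> + sharp N P \<beta>"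
  by (rule vf_eqI) (auto simp: sharp_apply function_linear_add[OF bivector_linear1])

lemma sharp_fscale: "u \<in> C \<Longrightarrow> \<alpha> \<in> OF \<Longrightarrow> sharp N P (fscale u \<alpha>) = fscale u (sharp N P \<alpha>)"
  by (rule vf_eqI) (auto simp: sharp_apply function_linear_fscale[OF bivector_linear1])

text \<open>By skew-symmetry, differentiating \<open>f\<close> along
  \<open>sharp N P \<alpha>\<close> is, up to sign, evaluating \<open>\<alpha>\<close> on the field
  \<open>sharp N P (differential N f)\<close>, which is zero.\<close>

lemma casimir_sharp: "casimir N P f \<Longrightarrow> \<alpha> \<in> OF \<Longrightarrow> sharp N P \<alpha> f = 0"
proof -
  assume f: "casimir N P f" and a: "\<alpha> \<in> OF"
  then have fC: "f \<in> C" and 0: "sharp N P (differential N f) = 0" by (auto simp: casimir_def)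
  have "P (differential N f) \<alpha> = \<alpha> 0" using form_sharp[of "differential N f" \<alpha>] fC a 0 by simp
  then have "P (differential N f) \<alpha> = 0" using function_linear_0[OF form_linear[OF a] VF_module] by simp
  then show ?thesis
    unfolding sharp_apply[OF a fC] bivector_skew[OF a differential_form[OF fC]] by simp
qed

end

end

section \<open>Metrics and orthonormal coframes\<close>

text \<open>Applying \<open>L j\<close> to a vanishing combination isolates its \<open>j\<close>-th
  coefficient, so the vectors are independent; their number makes them a basis.\<close>

lemma biorthogonal_span:
  fixes v :: "nat \<Rightarrow> 'e::euclidean_space" and L :: "nat \<Rightarrow> 'e \<Rightarrow> real"
  assumes lin: "\<And>j. linear (L j)"
    and orth: "\<And>i j. i < DIM('e) \<Longrightarrow> j < DIM('e) \<Longrightarrow> i \<noteq> j \<Longrightarrow> L j (v i) = 0"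
    and diag: "\<And>j. j < DIM('e) \<Longrightarrow> L j (v j) \<noteq> 0"
  obtains c where "w = (\<Sum>i<DIM('e). c i *\<^sub>R v i)"
proof -
  let ?A = "{..<DIM('e)}"
  have inj: "inj_on v ?A"
  proof (rule inj_onI)
    fix i j assume ij: "i \<in> ?A" "j \<in> ?A" "v i = v j"
    then have "L j (v i) \<noteq> 0" using diag[of j] by simp
    then show "i = j" using orth[of i j] ij by auto
  qed
  have "independent (v ` ?A)"
  proof (rule independent_if_scalars_zero)
    fix f x assume s: "(\<Sum>x\<in>v ` ?A. f x *\<^sub>R x) = 0" and x: "x \<in> v ` ?A"
    then obtain j where j: "j < DIM('e)" "x = v j" by auto
    have "0 = L j (\<Sum>x\<in>v ` ?A. f x *\<^sub>R x)" using s lin[of j] by (simp add: linear_0)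
    also have "\<dots> = (\<Sum>x\<in>v ` ?A. f x * L j x)"
      using lin[of j] by (simp add: linear_sum linear_cmul)
    also have "\<dots> = (\<Sum>i\<in>?A. f (v i) * L j (v i))" by (simp add: sum.reindex[OF inj])
    also have "\<dots> = (\<Sum>i\<in>?A. if i = j then f (v j) * L j (v j) else 0)"
      by (rule sum.cong) (use orth j in auto)
    also have "\<dots> = f (v j) * L j (v j)" using j by simp
    finally show "f x = 0" using diag[OF j(1)] j(2) by simp
  qed auto
  moreover have "card (v ` ?A) = DIM('e)" using card_image[OF inj] by simp
  ultimately have "UNIV \<subseteq> span (v ` ?A)"
    by (intro card_ge_dim_independent) auto
  then have "w \<in> span (v ` ?A)" by blast
  then obtain u where "w = (\<Sum>x\<in>v ` ?A. u x *\<^sub>R x)"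
    unfolding span_finite[OF finite_imageI[OF finite_lessThan]] by blast
  then have "w = (\<Sum>i<DIM('e). u (v i) *\<^sub>R v i)" by (simp add: sum.reindex[OF inj])
  then show thesis by (rule that)
qed

text \<open>The function \<open>v\<close> is \<open>1 / sqrt \<bar>u\<bar>\<close> near \<open>p\<close>; a bump function keeps the radicand positive away
  from \<open>p\<close>.\<close>

lemma (in manifold) inverse_sqrt_local:
  assumes u: "u \<in> C" "u p \<noteq> 0"
  obtains v W where "v \<in> C" "open W" "p \<in> W" "\<And>q. q \<in> W \<Longrightarrow> v q * v q * \<bar>u q\<bar> = 1"
proof -
  have "{q. u q \<noteq> 0} = u -` (- {0})" by auto
  then have o: "open {q. u q \<noteq> 0}"
    using open_vimage[of "- {0}" u, OF _ smooth_functions_continuous[OF u(1)]]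
    by (simp add: open_Compl)
  obtain \<rho> W' where \<rho>: "\<rho> \<in> C" "open W'" "p \<in> W'" "W' \<subseteq> {q. u q \<noteq> 0}"
    "\<And>q. q \<in> W' \<Longrightarrow> \<rho> q = 1" "\<And>q. q \<notin> {q. u q \<noteq> 0} \<Longrightarrow> \<rho> q = 0"
    by (rule bump_exists[OF o, of p]) (use u in auto)
  \<comment> \<open>The first summand is positive where \<open>\<rho>\<close> is nonzero, the second
    where \<open>\<rho>\<close> is zero. Near \<open>p\<close> this is the square of
    \<open>u\<close>, which avoids the absolute value; hence the fourth root below.\<close>
  define w where "w = \<rho> * \<rho> * (u * u) + ((\<lambda>_. 1) - \<rho>) * ((\<lambda>_. 1) - \<rho>)"
  have wC: "w \<in> C" using u(1) \<rho>(1) by (simp add: w_def)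
  have wpos: "w q > 0" for q
  proof (cases "\<rho> q = 0")
    case False
    then have "u q \<noteq> 0" using \<rho>(6)[of q] by auto
    then have "(\<rho> q * u q) * (\<rho> q * u q) > 0" using False by (metis mult_eq_0_iff not_real_square_gt_zero)
    moreover have "(1 - \<rho> q) * (1 - \<rho> q) \<ge> 0" by simp
    ultimately have "(\<rho> q * u q) * (\<rho> q * u q) + (1 - \<rho> q) * (1 - \<rho> q) > 0" by linarith
    then show ?thesis by (simp add: w_def algebra_simps)
  qed (simp add: w_def)
  have 1: "(\<lambda>q. sqrt (w q)) \<in> C" by (rule smooth_functions_sqrt[OF wC wpos])
  have 2: "(\<lambda>q. sqrt (sqrt (w q))) \<in> C" by (rule smooth_functions_sqrt[OF 1]) (simp add: wpos)
  have 3: "(\<lambda>q. inverse (sqrt (sqrt (w q)))) \<in> C"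
    by (rule smooth_functions_inverse[OF 2]) (metis wpos less_irrefl real_sqrt_eq_0_iff)
  show thesis
  proof (rule that[OF 3 \<rho>(2,3)])
    fix q assume q: "q \<in> W'"
    then have uq: "u q \<noteq> 0" using \<rho>(4) by auto
    have "w q = u q * u q" using \<rho>(5)[OF q] by (simp add: w_def)
    then have s: "sqrt (w q) = \<bar>u q\<bar>" by (simp add: real_sqrt_abs2)
    have "inverse (sqrt \<bar>u q\<bar>) * inverse (sqrt \<bar>u q\<bar>) * \<bar>u q\<bar> = 1"
      using uq by (simp flip: inverse_mult_distrib)
    then show "inverse (sqrt (sqrt (w q))) * inverse (sqrt (sqrt (w q))) * \<bar>u q\<bar> = 1"
      unfolding s .
  qed
qed

section \<open>Metrics and orthonormal frames\<close>

locale metric_manifold = manifold N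
  for N :: "('a::{second_countable_topology,t2_space}, 'e::euclidean_space) atlas" +
  fixes G :: "'a metric"
  assumes metric: "pseudo_riemannian_metric N G"
begin

lemma metric_smooth: "X \<in> VF \<Longrightarrow> Y \<in> VF \<Longrightarrow> G X Y \<in> C"
  by (rule metric[unfolded pseudo_riemannian_metric_def, THEN conjunct1, rule_format])

lemma metric_sym: "X \<in> VF \<Longrightarrow> Y \<in> VF \<Longrightarrow> G X Y = G Y X"
  by (rule metric[unfolded pseudo_riemannian_metric_def, THEN conjunct2, THEN conjunct2,
        THEN conjunct2, THEN conjunct1, rule_format])

lemma metric_nondegenerate:
  assumes "X \<in> VF" "\<And>Y. Y \<in> VF \<Longrightarrow> G X Y p = 0" "u \<in> C"
  shows "X u p = 0"
  using metric[unfolded pseudo_riemannian_metric_def, THEN conjunct2, THEN conjunct2,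
      THEN conjunct2, THEN conjunct2] assms by meson

lemma metric_linear1:
  assumes Y: "Y \<in> VF" shows "function_linear C VF (\<lambda>X. G X Y)"
  unfolding function_linear_def
proof (intro conjI ballI)
  note m = metric[unfolded pseudo_riemannian_metric_def]
  show "G (X + X') Y = G X Y + G X' Y" if "X \<in> VF" "X' \<in> VF" for X X'
    by (rule m[THEN conjunct2, THEN conjunct1, rule_format, OF that Y])
  show "G (fscale u X) Y = u * G X Y" if "u \<in> C" "X \<in> VF" for u X
    by (rule m[THEN conjunct2, THEN conjunct2, THEN conjunct1, rule_format, OF that Y])
qed

lemma metric_linear2:
  assumes X: "X \<in> VF" shows "function_linear C VF (G X)"
  unfolding function_linear_def
proof (intro conjI ballI)
  show "G X (Y + Y') = G X Y + G X Y'" if Y: "Y \<in> VF" "Y' \<in> VF" for Y Y'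
    unfolding metric_sym[OF X VF_closed(1)[OF Y]] metric_sym[OF X Y(1)] metric_sym[OF X Y(2)]
    by (rule function_linear_add[OF metric_linear1[OF X] Y])
  show "G X (fscale u Y) = u * G X Y" if Y: "u \<in> C" "Y \<in> VF" for u Y
    unfolding metric_sym[OF X VF_closed(2)[OF Y]] metric_sym[OF X Y(2)]
    by (rule function_linear_fscale[OF metric_linear1[OF X] Y])
qed

definition orthonormal_on :: "'a set \<Rightarrow> nat \<Rightarrow> (nat \<Rightarrow> 'a vfield) \<Rightarrow> bool" where
  "orthonormal_on W k H \<longleftrightarrow> open W \<and> (\<forall>i<k. H i \<in> VF) \<and>
     (\<forall>q\<in>W. \<forall>i<k. \<forall>j<k. if i = j then \<bar>G (H i) (H i) q\<bar> = 1 else G (H i) (H j) q = 0)"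

lemma orthonormal_onD:
  assumes "orthonormal_on W k H"
  shows "open W" "i < k \<Longrightarrow> H i \<in> VF"
    "q \<in> W \<Longrightarrow> i < k \<Longrightarrow> G (H i) (H i) q * G (H i) (H i) q = 1"
    "q \<in> W \<Longrightarrow> i < k \<Longrightarrow> j < k \<Longrightarrow> i \<noteq> j \<Longrightarrow> G (H i) (H j) q = 0"
proof -
  note a = assms[unfolded orthonormal_on_def]
  show "open W" by (rule a[THEN conjunct1])
  show "i < k \<Longrightarrow> H i \<in> VF" by (rule a[THEN conjunct2, THEN conjunct1, rule_format])
  note b = a[THEN conjunct2, THEN conjunct2, rule_format]
  show "G (H i) (H i) q * G (H i) (H i) q = 1" if "q \<in> W" "i < k"
  proof -
    have "\<bar>G (H i) (H i) q\<bar> = 1" using b[OF that that(2)] by simp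
    then show ?thesis by (metis abs_mult_self_eq mult_1)
  qed
  show "q \<in> W \<Longrightarrow> i < k \<Longrightarrow> j < k \<Longrightarrow> i \<noteq> j \<Longrightarrow> G (H i) (H j) q = 0" using b[of q i j] by simp
qed

text \<open>In coordinates at \<open>q\<close> the frame is biorthogonal to the functionals
  \<open>G _ (H j)\<close> and hence spans. Pairing with \<open>H j\<close> determines the
  coefficients; since \<open>G (H j) (H j) q\<close> is \<open>1\<close> or \<open>-1\<close>,
  dividing by it is the same as multiplying by it.\<close>

lemma orthonormal_vf_expansion:
  assumes on: "orthonormal_on W DIM('e) H" and q: "q \<in> W" and X: "X \<in> VF" and u: "u \<in> C"
  shows "X u q = (\<Sum>i<DIM('e). G (H i) (H i) q * G X (H i) q * H i u q)"
proof -
  note H = orthonormal_onD[OF on]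
  obtain x E V where qV: "q \<in> V" and fr: "local_frame V x E" using frame_at .
  \<comment> \<open>\<open>\<tau> Y\<close> is the coordinate vector of \<open>Y\<close> at
    \<open>q\<close>; \<open>L j\<close> and \<open>M\<close> are pairing with \<open>H j\<close>
    and differentiation of \<open>u\<close>, transported to coordinate vectors.\<close>
  define \<tau> where "\<tau> Y = (\<Sum>e\<in>Basis. Y (x e) q *\<^sub>R e)" for Y :: "'a vfield"
  define L where "L j w = (\<Sum>e\<in>Basis. (w \<bullet> e) * G (E e) (H j) q)" for j and w :: 'e
  define M where "M w = (\<Sum>e\<in>Basis. (w \<bullet> e) * E e u q)" for w :: 'e
  have lin: "linear (L j)" for j
    by (rule linearI) (simp_all add: L_def inner_add_left distrib_right sum.distrib sum_distrib_left mult.assoc)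
  have linM: "linear M"
    by (rule linearI) (simp_all add: M_def inner_add_left distrib_right sum.distrib sum_distrib_left mult.assoc)
  have LG: "L j (\<tau> Y) = G Y (H j) q" if "j < DIM('e)" "Y \<in> VF" for j Y
    using linear_frame_expansion[OF metric_linear1[OF H(2)[OF that(1)]] that(2) fr qV]
    by (simp add: L_def \<tau>_def)
  have Mu: "M (\<tau> Y) = Y u q" if "Y \<in> VF" for Y
    unfolding local_frameD(5)[OF fr that u qV] by (simp add: M_def \<tau>_def)
  have diag: "L j (\<tau> (H j)) \<noteq> 0" if "j < DIM('e)" for j
    unfolding LG[OF that H(2)[OF that]] using H(3)[OF q that] by auto
  have off: "L j (\<tau> (H i)) = 0" if "i < DIM('e)" "j < DIM('e)" "i \<noteq> j" for i j
    unfolding LG[OF that(2) H(2)[OF that(1)]] by (rule H(4)[OF q that])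
  obtain c where c: "\<tau> X = (\<Sum>i<DIM('e). c i *\<^sub>R \<tau> (H i))"
    by (rule biorthogonal_span[of L "\<lambda>i. \<tau> (H i)", OF lin off diag])
  have cG: "c j = G (H j) (H j) q * G X (H j) q" if j: "j < DIM('e)" for j
  proof -
    have "G X (H j) q = L j (\<tau> X)" by (rule LG[OF j X, symmetric])
    also have "\<dots> = (\<Sum>i<DIM('e). c i * L j (\<tau> (H i)))"
      unfolding c by (simp add: linear_sum[OF lin] linear_cmul[OF lin])
    also have "\<dots> = (\<Sum>i<DIM('e). if i = j then c j * L j (\<tau> (H j)) else 0)"
      by (rule sum.cong) (use off j in auto)
    also have "\<dots> = c j * G (H j) (H j) q" using j LG[OF j H(2)[OF j]] by simp
    finally have "G (H j) (H j) q * G X (H j) q = c j * (G (H j) (H j) q * G (H j) (H j) q)" by simp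
    then show ?thesis using H(3)[OF q j] by simp
  qed
  have "X u q = M (\<tau> X)" by (rule Mu[OF X, symmetric])
  also have "\<dots> = (\<Sum>i<DIM('e). c i * M (\<tau> (H i)))"
    unfolding c by (simp add: linear_sum[OF linM] linear_cmul[OF linM])
  also have "\<dots> = (\<Sum>i<DIM('e). G (H i) (H i) q * G X (H i) q * H i u q)"
    by (rule sum.cong) (auto simp: cG Mu[OF H(2)])
  finally show ?thesis .
qed

lemma orthonormal_expansion:
  assumes on: "orthonormal_on W DIM('e) H" and q: "q \<in> W" and X: "X \<in> VF"
    and A: "function_linear C VF A"
  shows "A X q = (\<Sum>i<DIM('e). G (H i) (H i) q * G X (H i) q * A (H i) q)"
proof -
  note H = orthonormal_onD[OF on]
  let ?Y = "\<Sum>i<DIM('e). fscale (G (H i) (H i) * G X (H i)) (H i)"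
  have m: "fscale (G (H i) (H i) * G X (H i)) (H i) \<in> VF" "G (H i) (H i) * G X (H i) \<in> C"
    if "i \<in> {..<DIM('e)}" for i
    using that H(2) X metric_smooth by simp_all
  have "A X q = A ?Y q"
  proof (rule linear_pointwise_VF[OF A X VF_sum[OF m(1)]])
    show "X u q = ?Y u q" if "u \<in> C" for u
      unfolding orthonormal_vf_expansion[OF on q X that] by (simp add: sum_fun_apply)
  qed assumption
  also have "A ?Y = (\<Sum>i<DIM('e). A (fscale (G (H i) (H i) * G X (H i)) (H i)))"
    by (rule function_linear_sum[OF A VF_module m(1)])
  also have "\<dots> = (\<Sum>i<DIM('e). G (H i) (H i) * G X (H i) * A (H i))"
    by (rule sum.cong[OF refl], rule function_linear_fscale[OF A]) (use m H in auto)
  finally show ?thesis by (simp add: sum_fun_apply)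
qed

text \<open>Gram--Schmidt: as long as fewer than \<open>DIM('e)\<close> fields have been found, some projection to
  their orthogonal complement is not null at \<open>p\<close>; otherwise polarization and nondegeneracy would
  make the fields found so far span the tangent space.\<close>

lemma orthonormal_extend:
  assumes on: "orthonormal_on W k H" and p: "p \<in> W" and k: "k < DIM('e)"
  shows "\<exists>W' H'. p \<in> W' \<and> orthonormal_on W' (Suc k) H'"
proof -
  note H = orthonormal_onD[OF on]
  define S where "S X = (\<Sum>i<k. fscale (G (H i) (H i) * G X (H i)) (H i))" for X
  define pr where "pr X = X - S X" for X
  have coeff: "G (H i) (H i) * G X (H i) \<in> C" if "i \<in> {..<k}" "X \<in> VF" for i X
    using that H(2) metric_smooth by simp
  have S: "S X \<in> VF" if "X \<in> VF" for X
    unfolding S_def by (rule VF_sum) (use that H(2) coeff in simp)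
  have pr: "pr X \<in> VF" if "X \<in> VF" for X unfolding pr_def using that S by simp
  have AS: "A (S X) q = (\<Sum>i<k. G (H i) (H i) q * G X (H i) q * A (H i) q)"
    if A: "function_linear C VF A" and X: "X \<in> VF" for A X q
  proof -
    have "A (S X) = (\<Sum>i<k. A (fscale (G (H i) (H i) * G X (H i)) (H i)))"
      unfolding S_def by (rule function_linear_sum[OF A VF_module]) (use X H(2) coeff in simp)
    also have "\<dots> = (\<Sum>i<k. G (H i) (H i) * G X (H i) * A (H i))"
      by (rule sum.cong[OF refl], rule function_linear_fscale[OF A]) (use coeff X H in auto)
    finally show ?thesis by (simp add: sum_fun_apply)
  qed
  have Apr: "A (pr X) q = A X q - (\<Sum>i<k. G (H i) (H i) q * G X (H i) q * A (H i) q)"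
    if A: "function_linear C VF A" and X: "X \<in> VF" for A X q
    unfolding pr_def function_linear_diff[OF A VF_module X S[OF X]] using AS[OF A X] by simp
  have orth: "G (pr X) (H j) q = 0" if "q \<in> W" "j < k" "X \<in> VF" for q j X
  proof -
    have "(\<Sum>i<k. G (H i) (H i) q * G X (H i) q * G (H i) (H j) q) =
        (\<Sum>i<k. if i = j then G (H j) (H j) q * G X (H j) q * G (H j) (H j) q else 0)"
      by (rule sum.cong) (use H(4)[OF that(1) _ that(2)] in auto)
    also have "\<dots> = G X (H j) q * (G (H j) (H j) q * G (H j) (H j) q)" using that(2) by simp
    also have "\<dots> = G X (H j) q" using H(3)[OF that(1,2)] by simp
    finally show ?thesis unfolding Apr[OF metric_linear1[OF H(2)[OF that(2)]] that(3)] by simp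
  qed
  have "\<exists>X\<in>VF. G (pr X) (pr X) p \<noteq> 0"
  proof (rule ccontr)
    assume "\<not> ?thesis"
    then have null: "G (pr X) (pr X) p = 0" if "X \<in> VF" for X using that by blast
    have pr_add: "pr (X + Y) = pr X + pr Y" if X: "X \<in> VF" and Y: "Y \<in> VF" for X Y
    proof (rule vf_eqI)
      fix u q assume "u \<in> C"
      have 1: "S Z u q = (\<Sum>i<k. G (H i) (H i) q * G Z (H i) q * H i u q)" for Z
        by (simp add: S_def sum_fun_apply)
      have "G (X + Y) (H i) q = G X (H i) q + G Y (H i) q" if "i < k" for i
        using function_linear_add[OF metric_linear1[OF H(2)[OF that]] X Y] by simp
      then have "S (X + Y) u q = S X u q + S Y u q"
        unfolding 1 sum.distrib[symmetric] by (intro sum.cong) (auto simp: algebra_simps)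
      then show "pr (X + Y) u q = (pr X + pr Y) u q" by (simp add: pr_def)
    qed (use X Y pr in auto)
    have polar: "G (pr X) (pr Y) p = 0" if X: "X \<in> VF" and Y: "Y \<in> VF" for X Y
    proof -
      have "0 = G (pr X + pr Y) (pr X + pr Y) p" using null[of "X + Y"] X Y pr_add[OF X Y] by simp
      also have "\<dots> = G (pr X) (pr X) p + G (pr X) (pr Y) p + (G (pr Y) (pr X) p + G (pr Y) (pr Y) p)"
        using function_linear_add[OF metric_linear1, of "pr X + pr Y" "pr X" "pr Y"]
          function_linear_add[OF metric_linear2, of "pr X" "pr X" "pr Y"]
          function_linear_add[OF metric_linear2, of "pr Y" "pr X" "pr Y"] pr[OF X] pr[OF Y]
        by simp
      also have "G (pr Y) (pr X) p = G (pr X) (pr Y) p"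
        unfolding metric_sym[OF pr[OF Y] pr[OF X]] ..
      finally show ?thesis using null[OF X] null[OF Y] by simp
    qed
    have zero: "pr X u p = 0" if X: "X \<in> VF" and u: "u \<in> C" for X u
    proof (rule metric_nondegenerate[OF pr[OF X] _ u])
      fix Y assume Y: "Y \<in> VF"
      have "G (pr X) (H i) p = 0" if "i < k" for i by (rule orth[OF p that X])
      then have "G (pr X) (pr Y) p = G (pr X) Y p"
        using Apr[OF metric_linear2[OF pr[OF X]] Y] by simp
      then show "G (pr X) Y p = 0" using polar[OF X Y] by simp
    qed
    obtain x E V where pV: "p \<in> V" and fr: "local_frame V x E" using frame_at .
    define \<tau> where "\<tau> Y = (\<Sum>e\<in>Basis. Y (x e) p *\<^sub>R e)" for Y :: "'a vfield"
    \<comment> \<open>Since every \<open>pr X\<close> vanishes at \<open>p\<close>, each coordinate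
      field coincides there with its projection to the fields found so far. Then \<open>k\<close>
      vectors would span a space of dimension greater than \<open>k\<close>.\<close>
    have "e \<in> span ((\<lambda>i. \<tau> (H i)) ` {..<k})" if e: "e \<in> Basis" for e
    proof -
      have c: "E e (x e') p = (\<Sum>i<k. (G (H i) (H i) p * G (E e) (H i) p) * H i (x e') p)" for e'
        using zero[OF local_frameD(3,2)[OF fr], of e e'] by (simp add: pr_def S_def sum_fun_apply)
      have "e = (\<Sum>e'\<in>Basis. (e \<bullet> e') *\<^sub>R e')" by (simp add: euclidean_representation)
      also have "\<dots> = (\<Sum>e'\<in>Basis. E e (x e') p *\<^sub>R e')" using local_frameD(4)[OF fr pV] by simp
      also have "\<dots> = (\<Sum>e'\<in>Basis. \<Sum>i<k. (G (H i) (H i) p * G (E e) (H i) p) *\<^sub>R (H i (x e') p *\<^sub>R e'))"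
        unfolding c by (simp add: scaleR_sum_left)
      also have "\<dots> = (\<Sum>i<k. (G (H i) (H i) p * G (E e) (H i) p) *\<^sub>R \<tau> (H i))"
        unfolding \<tau>_def scaleR_sum_right by (rule sum.swap)
      also have "\<dots> \<in> span ((\<lambda>i. \<tau> (H i)) ` {..<k})"
        by (intro span_sum span_scale span_base) auto
      finally show ?thesis .
    qed
    then have "Basis \<subseteq> span ((\<lambda>i. \<tau> (H i)) ` {..<k})" by blast
    then have "dim (Basis :: 'e set) \<le> card ((\<lambda>i. \<tau> (H i)) ` {..<k})"
      by (rule dim_le_card) simp
    also have "\<dots> \<le> k" using card_image_le[of "{..<k}" "\<lambda>i. \<tau> (H i)"] by simp
    finally have "dim (Basis :: 'e set) \<le> k" .
    moreover have "dim (Basis :: 'e set) = DIM('e)"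
      using dim_eq_card_independent[OF independent_Basis] by simp
    ultimately show False using k by simp
  qed
  then obtain X where X: "X \<in> VF" and nz: "G (pr X) (pr X) p \<noteq> 0" by blast
  define Z where "Z = pr X"
  have Z: "Z \<in> VF" using pr[OF X] by (simp add: Z_def)
  obtain v W2 where v: "v \<in> C" "open W2" "p \<in> W2" "\<And>q. q \<in> W2 \<Longrightarrow> v q * v q * \<bar>G Z Z q\<bar> = 1"
    by (rule inverse_sqrt_local[OF metric_smooth[OF Z Z], of p]) (use nz in \<open>auto simp: Z_def\<close>)
  define H' where "H' = H(k := fscale v Z)"
  have H'1: "H' i = H i" if "i < k" for i using that by (simp add: H'_def)
  have H'2: "H' k = fscale v Z" by (simp add: H'_def)
  have vZ: "fscale v Z \<in> VF" using v(1) Z by simp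
  have vZH: "G (fscale v Z) Y q = v q * G Z Y q" if "Y \<in> VF" for Y q
    using function_linear_fscale[OF metric_linear1[OF that] v(1) Z] by simp
  have HZ: "G (H i) (fscale v Z) q = 0" "G (fscale v Z) (H i) q = 0" if "i < k" "q \<in> W" for i q
  proof -
    show a: "G (fscale v Z) (H i) q = 0"
      unfolding vZH[OF H(2)[OF that(1)]] using orth[OF that(2,1) X] by (simp add: Z_def)
    show "G (H i) (fscale v Z) q = 0"
      unfolding metric_sym[OF H(2)[OF that(1)] vZ] by (rule a)
  qed
  have ZZ: "\<bar>G (fscale v Z) (fscale v Z) q\<bar> = 1" if "q \<in> W2" for q
  proof -
    have "G (fscale v Z) (fscale v Z) q = v q * (v q * G Z Z q)"
      unfolding vZH[OF vZ] using function_linear_fscale[OF metric_linear2[OF Z] v(1) Z] by simp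
    then have "\<bar>G (fscale v Z) (fscale v Z) q\<bar> = v q * v q * \<bar>G Z Z q\<bar>" by (simp add: abs_mult)
    then show ?thesis using v(4)[OF that] by simp
  qed
  have "orthonormal_on (W \<inter> W2) (Suc k) H'"
    unfolding orthonormal_on_def
  proof (intro conjI ballI allI impI)
    show "open (W \<inter> W2)" using H(1) v(2) by blast
    show "H' i \<in> VF" if "i < Suc k" for i
      using that H'1[of i] H(2)[of i] vZ H'2 by (cases "i = k") auto
    show "if i = j then \<bar>G (H' i) (H' i) q\<bar> = 1 else G (H' i) (H' j) q = 0"
      if q: "q \<in> W \<inter> W2" and ij: "i < Suc k" "j < Suc k" for q i j
    proof -
      have on': "if i = j then \<bar>G (H i) (H i) q\<bar> = 1 else G (H i) (H j) q = 0" if "i < k" "j < k"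
        using on[unfolded orthonormal_on_def, THEN conjunct2, THEN conjunct2, rule_format, of q i j] that q
        by blast
      consider "i < k" "j < k" | "i = k" "j = k" | "i < k" "j = k" | "i = k" "j < k"
        using ij by linarith
      then show ?thesis
      proof cases
        case 1 then show ?thesis using on'[OF 1] H'1[OF 1(1)] H'1[OF 1(2)] by (cases "i = j") auto
      next
        case 2 then show ?thesis using ZZ[of q] q H'2 by simp
      next
        case 3 then show ?thesis using HZ(1)[of i q] q H'2 H'1[of i] by simp
      next
        case 4 then show ?thesis using HZ(2)[of j q] q H'2 H'1[of j] by simp
      qed
    qed
  qed
  then show ?thesis using p v(3) by blast
qed

lemma orthonormal_exists: "\<exists>W H. p \<in> W \<and> orthonormal_on W DIM('e) H"
proof -
  have "k \<le> DIM('e) \<Longrightarrow> \<exists>W H. p \<in> W \<and> orthonormal_on W k H" for k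
  proof (induction k)
    case 0
    have "orthonormal_on UNIV 0 H" for H by (simp add: orthonormal_on_def)
    then show ?case by blast
  next
    case (Suc k)
    then obtain W H where "p \<in> W" "orthonormal_on W k H" by auto
    then show ?case using orthonormal_extend[of W k H p] Suc.prems by simp
  qed
  then show ?thesis by blast
qed

section \<open>Musical isomorphisms and the cometric\<close>

abbreviation "g \<equiv> cometric N G"

definition raise :: "'a form \<Rightarrow> 'a vfield" where "raise = inv_into VF (flat N G)"

lemma flat_apply: "Y \<in> VF \<Longrightarrow> flat N G X Y = G X Y"
  by (simp add: flat_def)

lemma flat_form [simp]: "X \<in> VF \<Longrightarrow> flat N G X \<in> OF"
  by (rule formI)
    (auto simp: flat_def function_linear_def metric_smooth function_linear_add[OF metric_linear2]
      function_linear_fscale[OF metric_linear2])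

lemma vf_eq_metricI:
  assumes "X \<in> VF" "Y \<in> VF" "\<And>Z. Z \<in> VF \<Longrightarrow> G X Z p = G Y Z p" "u \<in> C"
  shows "X u p = Y u p"
proof -
  have "(X - Y) u p = 0"
    by (rule metric_nondegenerate[of "X - Y" p u])
      (use assms in \<open>simp_all add: function_linear_diff[OF metric_linear1 VF_module]\<close>)
  then show ?thesis by simp
qed

lemma flat_inj: "inj_on (flat N G) VF"
proof (rule inj_onI)
  fix X Y assume XY: "X \<in> VF" "Y \<in> VF" "flat N G X = flat N G Y"
  show "X = Y"
  proof (rule vf_eqI[OF XY(1,2)])
    fix u p assume "u \<in> C"
    then show "X u p = Y u p"
      by (rule vf_eq_metricI[OF XY(1,2), rotated]) (metis XY(3) flat_apply)
  qed
qed

text \<open>Around each point an orthonormal frame \<open>H\<close> yields the preimage as the sum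
  of the fields \<open>H i\<close> with coefficients \<open>G (H i) (H i) * \<alpha> (H i)\<close>.
  By nondegeneracy such local preimages agree wherever both are valid, so they glue.\<close>

lemma flat_surj:
  assumes \<alpha>: "\<alpha> \<in> OF" shows "\<exists>X\<in>VF. flat N G X = \<alpha>"
proof -
  obtain Wf Hf where WH: "p \<in> Wf p" "orthonormal_on (Wf p) DIM('e) (Hf p)" for p
    using orthonormal_exists by metis
  note H = orthonormal_onD[OF WH(2)]
  define Z where "Z p = (\<Sum>i<DIM('e). fscale (G (Hf p i) (Hf p i) * \<alpha> (Hf p i)) (Hf p i))" for p
  have coeff: "G (Hf p i) (Hf p i) * \<alpha> (Hf p i) \<in> C" if "i \<in> {..<DIM('e)}" for p i
    using that H(2) metric_smooth \<alpha> by simp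
  have Z: "Z p \<in> VF" for p
    unfolding Z_def by (rule VF_sum) (use H(2) coeff in simp)
  have GZ: "G (Z p) Y q = \<alpha> Y q" if Y: "Y \<in> VF" and q: "q \<in> Wf p" for p q Y
  proof -
    have "G (Z p) Y = (\<Sum>i<DIM('e). G (fscale (G (Hf p i) (Hf p i) * \<alpha> (Hf p i)) (Hf p i)) Y)"
      unfolding Z_def by (rule function_linear_sum[OF metric_linear1[OF Y] VF_module]) (use H(2) coeff in simp)
    also have "\<dots> = (\<Sum>i<DIM('e). G (Hf p i) (Hf p i) * \<alpha> (Hf p i) * G (Hf p i) Y)"
      by (rule sum.cong[OF refl], rule function_linear_fscale[OF metric_linear1[OF Y]])
        (use coeff H in auto)
    also have "\<dots> = (\<Sum>i<DIM('e). G (Hf p i) (Hf p i) * G Y (Hf p i) * \<alpha> (Hf p i))"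
    proof (rule sum.cong[OF refl])
      fix i assume "i \<in> {..<DIM('e)}"
      then have "Hf p i \<in> VF" using H(2) by simp
      show "G (Hf p i) (Hf p i) * \<alpha> (Hf p i) * G (Hf p i) Y = G (Hf p i) (Hf p i) * G Y (Hf p i) * \<alpha> (Hf p i)"
        unfolding metric_sym[OF \<open>Hf p i \<in> VF\<close> Y] by (simp only: mult_ac)
    qed
    finally show ?thesis
      using orthonormal_expansion[OF WH(2) q Y form_linear[OF \<alpha>]] by (simp add: sum_fun_apply)
  qed
  have X: "(\<lambda>u p. Z p u p) \<in> VF" (is "?X \<in> VF")
  proof (rule vf_glue[OF Z])
    fix p
    have "Z q u q = Z p u q" if "q \<in> Wf p" "u \<in> C" for q u
      by (rule vf_eq_metricI[OF Z Z _ that(2)]) (simp add: GZ WH(1) that(1))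
    then show "\<exists>W. open W \<and> p \<in> W \<and> (\<forall>q\<in>W. \<forall>u\<in>C. Z q u q = Z p u q)"
      using H(1) WH(1) by blast
  qed
  have "flat N G ?X = \<alpha>"
  proof (rule form_eqI)
    fix Y p assume Y: "Y \<in> VF"
    have "G ?X Y p = G (Z p) Y p"
      by (rule linear_pointwise_VF[OF metric_linear1[OF Y] X Z]) simp
    then show "flat N G ?X Y p = \<alpha> Y p" using GZ[OF Y WH(1)] Y by (simp add: flat_apply)
  qed (use X \<alpha> in auto)
  then show ?thesis using X by blast
qed

lemma flat_image: "flat N G ` VF = OF"
  using flat_surj flat_form by blast

lemma raise_VF [simp]: "\<alpha> \<in> OF \<Longrightarrow> raise \<alpha> \<in> VF"
  and flat_raise: "\<alpha> \<in> OF \<Longrightarrow> flat N G (raise \<alpha>) = \<alpha>"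
  by (simp_all add: raise_def inv_into_into f_inv_into_f flat_image)

lemma raise_flat: "X \<in> VF \<Longrightarrow> raise (flat N G X) = X"
  by (simp add: raise_def inv_into_f_f[OF flat_inj])

lemma cometric_raise: "\<alpha> \<in> OF \<Longrightarrow> \<beta> \<in> OF \<Longrightarrow> g \<alpha> \<beta> = \<alpha> (raise \<beta>)"
  unfolding cometric_def raise_def[symmetric] by (metis flat_apply flat_raise raise_VF)

lemma cometric_sym: "\<alpha> \<in> OF \<Longrightarrow> \<beta> \<in> OF \<Longrightarrow> g \<alpha> \<beta> = g \<beta> \<alpha>"
  unfolding cometric_def raise_def[symmetric] by (rule metric_sym) auto

lemma cometric_flat: "\<alpha> \<in> OF \<Longrightarrow> X \<in> VF \<Longrightarrow> g \<alpha> (flat N G X) = \<alpha> X"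
  by (simp add: cometric_raise raise_flat)

lemma cometric_flat2: "\<alpha> \<in> OF \<Longrightarrow> X \<in> VF \<Longrightarrow> g (flat N G X) \<alpha> = \<alpha> X"
  by (metis cometric_flat cometric_sym flat_form)

lemma cometric_smooth: "\<alpha> \<in> OF \<Longrightarrow> \<beta> \<in> OF \<Longrightarrow> g \<alpha> \<beta> \<in> C"
  by (simp add: cometric_raise)

lemma cometric_linear1: "\<beta> \<in> OF \<Longrightarrow> function_linear C OF (\<lambda>\<alpha>. g \<alpha> \<beta>)"
  by (auto simp: function_linear_def cometric_raise fun_eq_iff)

lemma cometric_linear2:
  assumes "\<alpha> \<in> OF" shows "function_linear C OF (g \<alpha>)"
  unfolding function_linear_def
proof (intro conjI ballI)
  show "g \<alpha> (\<beta> + \<gamma>) = g \<alpha> \<beta> + g \<alpha> \<gamma>" if b: "\<beta> \<in> OF" "\<gamma> \<in> OF" for \<beta> \<gamma>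
    unfolding cometric_sym[OF assms OF_closed(1)[OF b]] cometric_sym[OF assms b(1)]
      cometric_sym[OF assms b(2)]
    by (rule function_linear_add[OF cometric_linear1[OF assms] b])
  show "g \<alpha> (fscale u \<beta>) = u * g \<alpha> \<beta>" if b: "u \<in> C" "\<beta> \<in> OF" for u \<beta>
    unfolding cometric_sym[OF assms OF_closed(2)[OF b]] cometric_sym[OF assms b(2)]
    by (rule function_linear_fscale[OF cometric_linear1[OF assms] b])
qed

lemma form_eq_cometricI:
  assumes "\<alpha> \<in> OF" "\<beta> \<in> OF" "\<And>\<gamma>. \<gamma> \<in> OF \<Longrightarrow> g \<alpha> \<gamma> = g \<beta> \<gamma>"
  shows "\<alpha> = \<beta>"
proof (rule form_eqI[OF assms(1,2)])
  fix X p assume X: "X \<in> VF"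
  show "\<alpha> X p = \<beta> X p"
    using assms(3)[OF flat_form[OF X]] cometric_flat[OF assms(1) X] cometric_flat[OF assms(2) X] by simp
qed

text \<open>A functional on forms is first represented by a vector field, which is then lowered. The
  Koszul formula is turned into a 1-form by this.\<close>

lemma cometric_represents:
  assumes A: "function_linear C OF A" and smooth: "\<And>\<alpha>. \<alpha> \<in> OF \<Longrightarrow> A \<alpha> \<in> C"
  shows "\<exists>\<delta>\<in>OF. \<forall>\<gamma>\<in>OF. g \<delta> \<gamma> = A \<gamma>"
proof -
  obtain X where "X \<in> VF" "\<forall>\<beta>\<in>OF. \<beta> X = A \<beta>"
    using form_functional_represented[OF A smooth] by blast
  then show ?thesis by (intro bexI[of _ "flat N G X"]) (auto simp: cometric_flat2)
qed

section \<open>Orthonormal coframes and metric traces\<close>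

definition coframe_on :: "'a set \<Rightarrow> (nat \<Rightarrow> 'a form) \<Rightarrow> bool" where
  "coframe_on W \<eta> \<longleftrightarrow> open W \<and> (\<forall>i<DIM('e). \<eta> i \<in> OF) \<and>
     (\<forall>q\<in>W. \<forall>i<DIM('e). \<forall>j<DIM('e). if i = j then \<bar>g (\<eta> i) (\<eta> i) q\<bar> = 1 else g (\<eta> i) (\<eta> j) q = 0)"

lemma orthonormal_coframe_near_iff:
  "orthonormal_coframe_near N g p \<eta> \<longleftrightarrow> (\<exists>W. p \<in> W \<and> coframe_on W \<eta>)"
  unfolding orthonormal_coframe_near_def coframe_on_def by blast

lemma coframe_on_raise:
  assumes "coframe_on W \<eta>" shows "orthonormal_on W DIM('e) (\<lambda>i. raise (\<eta> i))"
proof -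
  have "G (raise (\<eta> i)) (raise (\<eta> j)) = g (\<eta> i) (\<eta> j)" for i j
    by (simp add: cometric_def raise_def)
  then show ?thesis using assms unfolding coframe_on_def orthonormal_on_def by simp
qed

lemma coframe_exists: "\<exists>\<eta>. orthonormal_coframe_near N g p \<eta>"
proof -
  obtain W H where WH: "p \<in> W" "orthonormal_on W DIM('e) H" using orthonormal_exists by blast
  note H = orthonormal_onD(2)[OF WH(2)]
  have "g (flat N G (H i)) (flat N G (H j)) = G (H i) (H j)" if "i < DIM('e)" "j < DIM('e)" for i j
    using H[OF that(1)] H[OF that(2)] by (simp add: cometric_flat flat_apply)
  then have "coframe_on W (\<lambda>i. flat N G (H i))"
    using WH(2) H unfolding coframe_on_def orthonormal_on_def by simp
  then show ?thesis using WH(1) orthonormal_coframe_near_iff by blast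
qed

lemma coframe_onD:
  assumes "coframe_on W \<eta>"
  shows "open W" "i < DIM('e) \<Longrightarrow> \<eta> i \<in> OF"
    "q \<in> W \<Longrightarrow> i < DIM('e) \<Longrightarrow> g (\<eta> i) (\<eta> i) q * g (\<eta> i) (\<eta> i) q = 1"
    "q \<in> W \<Longrightarrow> i < DIM('e) \<Longrightarrow> j < DIM('e) \<Longrightarrow> i \<noteq> j \<Longrightarrow> g (\<eta> i) (\<eta> j) q = 0"
proof -
  show "i < DIM('e) \<Longrightarrow> \<eta> i \<in> OF"
    by (rule assms[unfolded coframe_on_def, THEN conjunct2, THEN conjunct1, rule_format])
  show "open W" "q \<in> W \<Longrightarrow> i < DIM('e) \<Longrightarrow> g (\<eta> i) (\<eta> i) q * g (\<eta> i) (\<eta> i) q = 1"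
    "q \<in> W \<Longrightarrow> i < DIM('e) \<Longrightarrow> j < DIM('e) \<Longrightarrow> i \<noteq> j \<Longrightarrow> g (\<eta> i) (\<eta> j) q = 0"
    using orthonormal_onD[OF coframe_on_raise[OF assms]] by (simp_all add: cometric_def raise_def)
qed

text \<open>Composed with \<open>flat\<close>, the map \<open>A\<close> becomes linear on vector
  fields, so the expansion in the raised coframe applies.\<close>

lemma coframe_expansion:
  assumes on: "coframe_on W \<eta>" and q: "q \<in> W" and \<alpha>: "\<alpha> \<in> OF" and A: "function_linear C OF A"
  shows "A \<alpha> q = (\<Sum>i<DIM('e). g (\<eta> i) (\<eta> i) q * g \<alpha> (\<eta> i) q * A (\<eta> i) q)"
proof -
  have eta: "\<eta> i \<in> OF" if "i < DIM('e)" for i by (rule coframe_onD(2)[OF on that])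
  have fadd: "flat N G (X + Y) = flat N G X + flat N G Y" if "X \<in> VF" "Y \<in> VF" for X Y
    by (rule form_eqI) (use that in \<open>auto simp: flat_apply function_linear_add[OF metric_linear1]\<close>)
  have fscl: "flat N G (fscale u X) = fscale u (flat N G X)" if "u \<in> C" "X \<in> VF" for u X
    by (rule form_eqI) (use that in \<open>auto simp: flat_apply function_linear_fscale[OF metric_linear1]\<close>)
  have "function_linear C VF (\<lambda>X. A (flat N G X))"
    unfolding function_linear_def
    by (simp add: fadd fscl function_linear_add[OF A] function_linear_fscale[OF A])
  from orthonormal_expansion[OF coframe_on_raise[OF on] q raise_VF[OF \<alpha>] this]
  have "A \<alpha> q = (\<Sum>i<DIM('e). G (raise (\<eta> i)) (raise (\<eta> i)) q * G (raise \<alpha>) (raise (\<eta> i)) q * A (flat N G (raise (\<eta> i))) q)"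
    by (simp add: flat_raise \<alpha>)
  also have "\<dots> = (\<Sum>i<DIM('e). g (\<eta> i) (\<eta> i) q * g \<alpha> (\<eta> i) q * A (\<eta> i) q)"
    by (rule sum.cong) (auto simp: flat_raise eta cometric_def raise_def[symmetric])
  finally show ?thesis .
qed

text \<open>Expanding \<open>\<zeta>\<close> in \<open>\<eta>\<close> gives a triple sum. Summing
  over the index of \<open>\<zeta>\<close> first produces the Gram matrix of \<open>\<eta>\<close>,
  which is diagonal, so the double sum that remains collapses. The signs make this work in any
  signature, and the result makes \<open>ricci\<close> and \<open>scalar_curvature\<close> well
  defined.\<close>

lemma metric_trace_unique:
  assumes on: "coframe_on W \<eta>" "coframe_on W' \<zeta>" and q: "q \<in> W" "q \<in> W'"
    and T1: "\<And>\<beta>. \<beta> \<in> OF \<Longrightarrow> function_linear C OF (\<lambda>\<alpha>. T \<alpha> \<beta>)"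
    and T2: "\<And>\<alpha>. \<alpha> \<in> OF \<Longrightarrow> function_linear C OF (T \<alpha>)"
  shows "(\<Sum>i<DIM('e). g (\<zeta> i) (\<zeta> i) q * T (\<zeta> i) (\<zeta> i) q) = (\<Sum>j<DIM('e). g (\<eta> j) (\<eta> j) q * T (\<eta> j) (\<eta> j) q)"
proof -
  let ?n = "DIM('e)"
  let ?e = "\<lambda>i. g (\<eta> i) (\<eta> i) q" and ?z = "\<lambda>i. g (\<zeta> i) (\<zeta> i) q"
  note e = coframe_onD[OF on(1)] and z = coframe_onD[OF on(2)]
  have T: "T (\<zeta> i) (\<zeta> i) q =
      (\<Sum>j<?n. \<Sum>k<?n. (?e j * ?e k * T (\<eta> j) (\<eta> k) q) * (g (\<zeta> i) (\<eta> j) q * g (\<zeta> i) (\<eta> k) q))"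
    if i: "i < ?n" for i
  proof -
    have "T (\<zeta> i) (\<zeta> i) q = (\<Sum>j<?n. ?e j * g (\<zeta> i) (\<eta> j) q * T (\<eta> j) (\<zeta> i) q)"
      by (rule coframe_expansion[OF on(1) q(1) z(2)[OF i] T1[OF z(2)[OF i]]])
    also have "\<dots> = (\<Sum>j<?n. ?e j * g (\<zeta> i) (\<eta> j) q *
        (\<Sum>k<?n. ?e k * g (\<zeta> i) (\<eta> k) q * T (\<eta> j) (\<eta> k) q))"
      by (rule sum.cong[OF refl])
        (use coframe_expansion[OF on(1) q(1) z(2)[OF i] T2[OF e(2)]] in simp)
    finally show ?thesis by (simp add: sum_distrib_left mult_ac)
  qed
  \<comment> \<open>Completeness of \<open>\<zeta>\<close>: this is the expansion of
    \<open>\<eta> j\<close> in \<open>\<zeta>\<close>, paired with \<open>\<eta> k\<close>.\<close>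
  have gg: "(\<Sum>i<?n. ?z i * (g (\<zeta> i) (\<eta> j) q * g (\<zeta> i) (\<eta> k) q)) = g (\<eta> j) (\<eta> k) q"
    if j: "j < ?n" and k: "k < ?n" for j k
  proof -
    have "g (\<eta> j) (\<eta> k) q = (\<Sum>i<?n. ?z i * g (\<eta> j) (\<zeta> i) q * g (\<zeta> i) (\<eta> k) q)"
      by (rule coframe_expansion[OF on(2) q(2) e(2)[OF j] cometric_linear1[OF e(2)[OF k]]])
    also have "\<dots> = (\<Sum>i<?n. ?z i * (g (\<zeta> i) (\<eta> j) q * g (\<zeta> i) (\<eta> k) q))"
    proof (rule sum.cong[OF refl])
      fix i assume "i \<in> {..<?n}"
      then have "\<zeta> i \<in> OF" using z(2) by simp
      from cometric_sym[OF e(2)[OF j] this]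
      show "?z i * g (\<eta> j) (\<zeta> i) q * g (\<zeta> i) (\<eta> k) q = ?z i * (g (\<zeta> i) (\<eta> j) q * g (\<zeta> i) (\<eta> k) q)"
        by simp
    qed
    finally show ?thesis by simp
  qed
  have "(\<Sum>i<?n. ?z i * T (\<zeta> i) (\<zeta> i) q) =
      (\<Sum>i<?n. \<Sum>j<?n. \<Sum>k<?n. (?e j * ?e k * T (\<eta> j) (\<eta> k) q) * (?z i * (g (\<zeta> i) (\<eta> j) q * g (\<zeta> i) (\<eta> k) q)))"
    by (rule sum.cong[OF refl]) (simp add: T sum_distrib_left mult_ac)
  also have "\<dots> = (\<Sum>j<?n. \<Sum>i<?n. \<Sum>k<?n. (?e j * ?e k * T (\<eta> j) (\<eta> k) q) * (?z i * (g (\<zeta> i) (\<eta> j) q * g (\<zeta> i) (\<eta> k) q)))"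
    by (rule sum.swap)
  also have "\<dots> = (\<Sum>j<?n. \<Sum>k<?n. \<Sum>i<?n. (?e j * ?e k * T (\<eta> j) (\<eta> k) q) * (?z i * (g (\<zeta> i) (\<eta> j) q * g (\<zeta> i) (\<eta> k) q)))"
    by (rule sum.cong[OF refl]) (rule sum.swap)
  also have "\<dots> = (\<Sum>j<?n. \<Sum>k<?n. (?e j * ?e k * T (\<eta> j) (\<eta> k) q) * g (\<eta> j) (\<eta> k) q)"
    by (intro sum.cong refl) (simp add: sum_distrib_left[symmetric] gg)
  also have "\<dots> = (\<Sum>j<?n. \<Sum>k<?n. if k = j then ?e j * T (\<eta> j) (\<eta> j) q else 0)"
  proof (intro sum.cong refl)
    fix j k assume jk: "j \<in> {..<?n}" "k \<in> {..<?n}"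
    show "(?e j * ?e k * T (\<eta> j) (\<eta> k) q) * g (\<eta> j) (\<eta> k) q = (if k = j then ?e j * T (\<eta> j) (\<eta> j) q else 0)"
    proof (cases "k = j")
      case True
      have "?e j * ?e j * T (\<eta> j) (\<eta> j) q * ?e j = (?e j * ?e j) * (?e j * T (\<eta> j) (\<eta> j) q)"
        by (simp only: mult_ac)
      then show ?thesis using True e(3)[OF q(1), of j] jk by simp
    next
      case False
      then show ?thesis using e(4)[OF q(1), of j k] jk by simp
    qed
  qed
  also have "\<dots> = (\<Sum>j<?n. ?e j * T (\<eta> j) (\<eta> j) q)" by simp
  finally show ?thesis .
qed

end

section \<open>The contravariant Levi-Civita connection\<close>

context manifold
begin

section \<open>Lie brackets and Lie derivatives\<close>

lemma lie_bracket_VF [simp]: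
  assumes X: "X \<in> VF" and Y: "Y \<in> VF" shows "lie_bracket X Y \<in> VF"
  unfolding vector_fields_def lie_bracket_def
proof (intro CollectI conjI ballI allI impI)
  note s = vf_smooth[OF X] vf_smooth[OF Y]
  show "X (Y u) - Y (X u) \<in> C" if "u \<in> C" for u using that s by simp
  show "X (Y (u + v)) - Y (X (u + v)) = X (Y u) - Y (X u) + (X (Y v) - Y (X v))"
    if "u \<in> C" "v \<in> C" for u v
    using that s by (simp add: vf_add[OF X] vf_add[OF Y])
  show "X (Y ((\<lambda>_. c) * u)) - Y (X ((\<lambda>_. c) * u)) = (\<lambda>_. c) * (X (Y u) - Y (X u))"
    if "u \<in> C" for c u
    using that s by (simp add: vf_cmult[OF X] vf_cmult[OF Y] right_diff_distrib)
  show "X (Y (u * v)) - Y (X (u * v)) = (X (Y u) - Y (X u)) * v + u * (X (Y v) - Y (X v))"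
    if "u \<in> C" "v \<in> C" for u v
    using that s by (simp add: vf_mult[OF X] vf_mult[OF Y] vf_add[OF X] vf_add[OF Y] algebra_simps)
  show "X (Y u) - Y (X u) = 0" if "u \<notin> C" for u
    using that by (simp add: vf_outside[OF X] vf_outside[OF Y] vf_0[OF X] vf_0[OF Y])
qed

lemma lie_bracket_apply: "lie_bracket X Y u = X (Y u) - Y (X u)"
  by (simp add: lie_bracket_def)

lemma lie_bracket_add2:
  "X \<in> VF \<Longrightarrow> Y \<in> VF \<Longrightarrow> Z \<in> VF \<Longrightarrow> lie_bracket X (Y + Z) = lie_bracket X Y + lie_bracket X Z"
  by (rule vf_eqI) (simp_all add: lie_bracket_apply vf_add vf_smooth)

lemma lie_bracket_add1:
  "X \<in> VF \<Longrightarrow> Y \<in> VF \<Longrightarrow> Z \<in> VF \<Longrightarrow> lie_bracket (X + Y) Z = lie_bracket X Z + lie_bracket Y Z"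
  by (rule vf_eqI) (simp_all add: lie_bracket_apply vf_add vf_smooth)

lemma lie_bracket_fscale2:
  "X \<in> VF \<Longrightarrow> Y \<in> VF \<Longrightarrow> u \<in> C \<Longrightarrow>
    lie_bracket X (fscale u Y) = fscale u (lie_bracket X Y) + fscale (X u) Y"
  by (rule vf_eqI) (simp_all add: lie_bracket_apply vf_mult vf_smooth fscale_apply algebra_simps)

lemma lie_bracket_fscale1:
  "X \<in> VF \<Longrightarrow> Y \<in> VF \<Longrightarrow> u \<in> C \<Longrightarrow>
    lie_bracket (fscale u X) Y = fscale u (lie_bracket X Y) - fscale (Y u) X"
  by (rule vf_eqI) (simp_all add: lie_bracket_apply vf_mult vf_smooth fscale_apply algebra_simps)

lemma form_add: "\<alpha> \<in> OF \<Longrightarrow> X \<in> VF \<Longrightarrow> Y \<in> VF \<Longrightarrow> \<alpha> (X + Y) = \<alpha> X + \<alpha> Y"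
  by (rule function_linear_add[OF form_linear])

lemma form_fscale: "\<alpha> \<in> OF \<Longrightarrow> u \<in> C \<Longrightarrow> X \<in> VF \<Longrightarrow> \<alpha> (fscale u X) = u * \<alpha> X"
  by (rule function_linear_fscale[OF form_linear])

lemma form_diff: "\<alpha> \<in> OF \<Longrightarrow> X \<in> VF \<Longrightarrow> Y \<in> VF \<Longrightarrow> \<alpha> (X - Y) = \<alpha> X - \<alpha> Y"
  by (rule function_linear_diff[OF form_linear VF_module])

text \<open>When \<open>Y\<close> is multiplied by \<open>u\<close>, both summands produce
  \<open>X u * \<beta> Y\<close>, with opposite signs; what is left is linear over the
  functions.\<close>

lemma lie_derivative_form [simp]:
  assumes X: "X \<in> VF" and \<beta>: "\<beta> \<in> OF" shows "lie_derivative N X \<beta> \<in> OF"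
proof (rule formI)
  have "X (\<beta> (Y + Z)) - \<beta> (lie_bracket X (Y + Z)) =
      X (\<beta> Y) - \<beta> (lie_bracket X Y) + (X (\<beta> Z) - \<beta> (lie_bracket X Z))"
    if "Y \<in> VF" "Z \<in> VF" for Y Z
    using that X \<beta> by (simp add: lie_bracket_add2 form_add vf_add algebra_simps del: plus_fun_apply minus_apply times_fun_apply uminus_apply)
  moreover have "X (\<beta> (fscale u Y)) - \<beta> (lie_bracket X (fscale u Y)) =
      u * (X (\<beta> Y) - \<beta> (lie_bracket X Y))" if "u \<in> C" "Y \<in> VF" for u Y
    using that X \<beta> by (simp add: lie_bracket_fscale2 form_add form_fscale vf_mult vf_smooth algebra_simps del: plus_fun_apply minus_apply times_fun_apply uminus_apply)
  ultimately show "function_linear C VF (lie_derivative N X \<beta>)"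
    unfolding function_linear_def lie_derivative_def by simp
  show "lie_derivative N X \<beta> Y \<in> C" if "Y \<in> VF" for Y
    using that X \<beta> by (simp add: lie_derivative_def vf_smooth)
qed (simp add: lie_derivative_def)

section \<open>The Koszul bracket\<close>

context
  fixes P assumes P: "bivector_field N P"
begin

lemma koszul_bracket_form [simp]: "\<alpha> \<in> OF \<Longrightarrow> \<beta> \<in> OF \<Longrightarrow> koszul_bracket N P \<alpha> \<beta> \<in> OF"
  unfolding koszul_bracket_def using P by simp

lemma koszul_bracket_apply:
  "\<alpha> \<in> OF \<Longrightarrow> \<beta> \<in> OF \<Longrightarrow> Y \<in> VF \<Longrightarrow> koszul_bracket N P \<alpha> \<beta> Y =
    sharp N P \<alpha> (\<beta> Y) - \<beta> (lie_bracket (sharp N P \<alpha>) Y) -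
    (sharp N P \<beta> (\<alpha> Y) - \<alpha> (lie_bracket (sharp N P \<beta>) Y)) - Y (P \<alpha> \<beta>)"
  by (simp add: koszul_bracket_def lie_derivative_def differential_def)

lemma koszul_bracket_skew:
  assumes a: "\<alpha> \<in> OF" and b: "\<beta> \<in> OF"
  shows "koszul_bracket N P \<beta> \<alpha> = - koszul_bracket N P \<alpha> \<beta>"
proof (rule form_eqI)
  fix Y p assume Y: "Y \<in> VF"
  have "Y (P \<beta> \<alpha>) = - Y (P \<alpha> \<beta>)"
    unfolding bivector_skew[OF P b a] by (rule vf_uminus[OF Y bivector_smooth[OF P a b]])
  then show "koszul_bracket N P \<beta> \<alpha> Y p = (- koszul_bracket N P \<alpha> \<beta>) Y p"
    using koszul_bracket_apply[OF a b Y] koszul_bracket_apply[OF b a Y] by simp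
qed (use a b in simp_all)

lemma koszul_bracket_add2:
  assumes a: "\<alpha> \<in> OF" and b: "\<beta> \<in> OF" and c: "\<gamma> \<in> OF"
  shows "koszul_bracket N P \<alpha> (\<beta> + \<gamma>) = koszul_bracket N P \<alpha> \<beta> + koszul_bracket N P \<alpha> \<gamma>"
proof (rule form_eqI)
  fix Y p assume Y: "Y \<in> VF"
  have "Y (P \<alpha> (\<beta> + \<gamma>)) = Y (P \<alpha> \<beta>) + Y (P \<alpha> \<gamma>)"
    unfolding function_linear_add[OF bivector_linear2[OF P a] b c]
    using vf_add[OF Y] bivector_smooth[OF P] a b c by simp
  moreover have "sharp N P \<alpha> ((\<beta> + \<gamma>) Y) = sharp N P \<alpha> (\<beta> Y) + sharp N P \<alpha> (\<gamma> Y)"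
    using vf_add[OF sharp_VF[OF P a]] b c Y by simp
  ultimately show "koszul_bracket N P \<alpha> (\<beta> + \<gamma>) Y p = (koszul_bracket N P \<alpha> \<beta> + koszul_bracket N P \<alpha> \<gamma>) Y p"
    using a b c Y
    by (simp add: koszul_bracket_apply sharp_add[OF P] lie_bracket_add1 sharp_VF[OF P] form_add)
qed (use a b c in simp_all)

text \<open>The term \<open>Y u * P \<alpha> \<beta>\<close> arises from the Lie derivative of
  \<open>\<alpha>\<close> and from the differential of \<open>P \<alpha> (fscale u \<beta>)\<close>,
  and cancels. Only the derivative of \<open>u\<close> along \<open>sharp N P \<alpha>\<close>
  remains.\<close>

lemma koszul_bracket_fscale2:
  assumes a: "\<alpha> \<in> OF" and b: "\<beta> \<in> OF" and u: "u \<in> C"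
  shows "koszul_bracket N P \<alpha> (fscale u \<beta>) =
    fscale u (koszul_bracket N P \<alpha> \<beta>) + fscale (sharp N P \<alpha> u) \<beta>"
proof (rule form_eqI)
  note s = sharp_VF[OF P a] sharp_VF[OF P b]
  fix Y p assume Y: "Y \<in> VF"
  have 1: "Y (P \<alpha> (fscale u \<beta>)) = Y u * P \<alpha> \<beta> + u * Y (P \<alpha> \<beta>)"
    unfolding function_linear_fscale[OF bivector_linear2[OF P a] u b]
    by (rule vf_mult[OF Y u bivector_smooth[OF P a b]])
  have 2: "sharp N P \<alpha> (fscale u \<beta> Y) = sharp N P \<alpha> u * \<beta> Y + u * sharp N P \<alpha> (\<beta> Y)"
    unfolding fscale_apply by (rule vf_mult[OF s(1) u form_smooth[OF b Y]])
  have 3: "\<alpha> (lie_bracket (sharp N P (fscale u \<beta>)) Y) =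
      u * \<alpha> (lie_bracket (sharp N P \<beta>) Y) + Y u * P \<alpha> \<beta>"
  proof -
    have "\<alpha> (sharp N P \<beta>) = - P \<alpha> \<beta>"
      unfolding form_sharp[OF P b a] by (rule bivector_skew[OF P b a])
    then show ?thesis
      using a s Y u
      by (simp add: sharp_fscale[OF P u b] lie_bracket_fscale1 form_diff form_fscale vf_smooth
          del: plus_fun_apply minus_apply times_fun_apply uminus_apply)
  qed
  have 4: "sharp N P (fscale u \<beta>) (\<alpha> Y) = u * sharp N P \<beta> (\<alpha> Y)"
    by (simp add: sharp_fscale[OF P u b] fscale_apply)
  show "koszul_bracket N P \<alpha> (fscale u \<beta>) Y p =
      (fscale u (koszul_bracket N P \<alpha> \<beta>) + fscale (sharp N P \<alpha> u) \<beta>) Y p"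
    unfolding koszul_bracket_apply[OF a OF_closed(2)[OF u b] Y] 1 2 3 4
    by (simp add: koszul_bracket_apply[OF a b Y] algebra_simps)
qed (use a b u vf_smooth sharp_VF[OF P] in simp_all)

lemma koszul_bracket_add1:
  assumes a: "\<alpha> \<in> OF" and b: "\<beta> \<in> OF" and c: "\<gamma> \<in> OF"
  shows "koszul_bracket N P (\<alpha> + \<beta>) \<gamma> = koszul_bracket N P \<alpha> \<gamma> + koszul_bracket N P \<beta> \<gamma>"
  unfolding koszul_bracket_skew[OF c OF_closed(1)[OF a b]] koszul_bracket_add2[OF c a b]
    koszul_bracket_skew[OF c a] koszul_bracket_skew[OF c b] by simp

lemma koszul_bracket_fscale1:
  assumes a: "\<alpha> \<in> OF" and b: "\<beta> \<in> OF" and u: "u \<in> C"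
  shows "koszul_bracket N P (fscale u \<alpha>) \<beta> =
    fscale u (koszul_bracket N P \<alpha> \<beta>) - fscale (sharp N P \<beta> u) \<alpha>"
  unfolding koszul_bracket_skew[OF b OF_closed(2)[OF u a]] koszul_bracket_fscale2[OF b a u]
    koszul_bracket_skew[OF b a] by (simp add: fun_eq_iff)

text \<open>Lie derivatives commute with the differential, so each of the two Lie derivative terms,
  taken with its sign, contributes the differential of the Poisson bracket; the last term of the
  definition removes one of them.\<close>

lemma koszul_bracket_exact:
  assumes u: "u \<in> C" and v: "v \<in> C"
  shows "koszul_bracket N P (differential N u) (differential N v) =
    differential N (P (differential N u) (differential N v))"
proof (rule form_eqI)
  let ?u = "differential N u" and ?v = "differential N v"
  fix Y p assume Y: "Y \<in> VF"
  note s = sharp_VF[OF P differential_form[OF u]] sharp_VF[OF P differential_form[OF v]]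
  note PC = bivector_smooth[OF P differential_form[OF u] differential_form[OF v]]
  have 1: "sharp N P ?u v = P ?u ?v" by (rule sharp_apply[OF P differential_form[OF u] v])
  have 2: "sharp N P ?v u = - P ?u ?v"
    unfolding sharp_apply[OF P differential_form[OF v] u]
    by (rule bivector_skew[OF P differential_form[OF v] differential_form[OF u]])
  have "koszul_bracket N P ?u ?v Y = Y (sharp N P ?u v) - Y (sharp N P ?v u) - Y (P ?u ?v)"
    unfolding koszul_bracket_apply[OF differential_form[OF u] differential_form[OF v] Y]
      differential_apply[OF Y] differential_apply[OF lie_bracket_VF[OF s(1) Y]]
      differential_apply[OF lie_bracket_VF[OF s(2) Y]]
    by (simp add: lie_bracket_def)
  also have "\<dots> = Y (P ?u ?v)" unfolding 1 2 vf_uminus[OF Y PC] by simp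
  finally show "koszul_bracket N P ?u ?v Y p = differential N (P ?u ?v) Y p"
    by (simp add: differential_apply[OF Y])
qed (use u v bivector_smooth[OF P] in simp_all)

end

text \<open>The difference of the two sides is bilinear over the smooth functions, and on exact forms it
  vanishes by the Jacobi identity.\<close>

lemma sharp_koszul_bracket:
  assumes P: "poisson_bivector N P" and a: "\<alpha> \<in> OF" and b: "\<beta> \<in> OF"
  shows "sharp N P (koszul_bracket N P \<alpha> \<beta>) = lie_bracket (sharp N P \<alpha>) (sharp N P \<beta>)"
proof -
  have bv: "bivector_field N P" using P by (simp add: poisson_bivector_def)
  note sh = sharp_VF[OF bv] and kb = koszul_bracket_form[OF bv]
  define T where "T w \<alpha> \<beta> = sharp N P (koszul_bracket N P \<alpha> \<beta>) w - lie_bracket (sharp N P \<alpha>) (sharp N P \<beta>) w"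
    for w \<alpha> \<beta>
  have lin2: "function_linear C OF (T w \<alpha>)" if \<alpha>: "\<alpha> \<in> OF" and w: "w \<in> C" for w \<alpha>
    unfolding function_linear_def
  proof (intro conjI ballI)
    show "T w \<alpha> (\<beta> + \<gamma>) = T w \<alpha> \<beta> + T w \<alpha> \<gamma>" if "\<beta> \<in> OF" "\<gamma> \<in> OF" for \<beta> \<gamma>
      using that \<alpha>
      by (simp add: T_def koszul_bracket_add2[OF bv] sharp_add[OF bv] sh kb lie_bracket_add2)
    show "T w \<alpha> (fscale u \<beta>) = u * T w \<alpha> \<beta>" if "u \<in> C" "\<beta> \<in> OF" for u \<beta>
      using that \<alpha>
      by (simp add: T_def koszul_bracket_fscale2[OF bv] sharp_add[OF bv] sharp_fscale[OF bv] sh kb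
          lie_bracket_fscale2 vf_smooth[OF sh] fscale_apply algebra_simps)
  qed
  have skew: "T w \<beta> \<alpha> = - T w \<alpha> \<beta>" if \<alpha>: "\<alpha> \<in> OF" and \<beta>: "\<beta> \<in> OF" and w: "w \<in> C" for w \<alpha> \<beta>
  proof -
    have "sharp N P (- koszul_bracket N P \<alpha> \<beta>) w = - sharp N P (koszul_bracket N P \<alpha> \<beta>) w"
      using sharp_fscale[OF bv, of "\<lambda>_. - 1" "koszul_bracket N P \<alpha> \<beta>"] kb[OF \<alpha> \<beta>]
      by (simp add: fscale_minus_1)
    then show ?thesis unfolding T_def koszul_bracket_skew[OF bv \<alpha> \<beta>] by (simp add: lie_bracket_def)
  qed
  have lin1: "function_linear C OF (\<lambda>\<alpha>. T w \<alpha> \<beta>)" if \<beta>: "\<beta> \<in> OF" and w: "w \<in> C" for w \<beta>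
    unfolding function_linear_def
  proof (intro conjI ballI)
    show "T w (\<alpha> + \<gamma>) \<beta> = T w \<alpha> \<beta> + T w \<gamma> \<beta>" if g: "\<alpha> \<in> OF" "\<gamma> \<in> OF" for \<alpha> \<gamma>
      unfolding skew[OF \<beta> OF_closed(1)[OF g] w] skew[OF \<beta> g(1) w] skew[OF \<beta> g(2) w]
        function_linear_add[OF lin2[OF \<beta> w] g] by simp
    show "T w (fscale u \<alpha>) \<beta> = u * T w \<alpha> \<beta>" if g: "u \<in> C" "\<alpha> \<in> OF" for u \<alpha>
      unfolding skew[OF \<beta> OF_closed(2)[OF g] w] skew[OF \<beta> g(2) w]
        function_linear_fscale[OF lin2[OF \<beta> w] g] by simp
  qed
  have zero: "function_linear C OF (\<lambda>_. 0)" by (simp add: function_linear_def)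
  have exact: "T w (differential N u) (differential N v) = 0" if u: "u \<in> C" and v: "v \<in> C" and w: "w \<in> C" for u v w
  proof -
    let ?b = "poisson_bracket N P"
    have pb: "sharp N P (differential N a) b = ?b a b" if "a \<in> C" "b \<in> C" for a b
      using sharp_apply[OF bv differential_form[OF that(1)] that(2)] by (simp add: poisson_bracket_def)
    have pbC: "?b a b \<in> C" if "a \<in> C" "b \<in> C" for a b
      unfolding poisson_bracket_def using bivector_smooth[OF bv] that by simp
    have pbs: "?b a b = - ?b b a" if "a \<in> C" "b \<in> C" for a b
      unfolding poisson_bracket_def by (rule bivector_skew[OF bv]) (use that in simp_all)
    have J: "?b u (?b v w) + ?b v (?b w u) + ?b w (?b u v) = 0"
      using P u v w unfolding poisson_bivector_def by blast
    have 1: "sharp N P (koszul_bracket N P (differential N u) (differential N v)) w = - ?b w (?b u v)"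
      unfolding koszul_bracket_exact[OF bv u v] poisson_bracket_def[symmetric] pb[OF pbC[OF u v] w]
      by (rule pbs[OF pbC[OF u v] w])
    have 2: "lie_bracket (sharp N P (differential N u)) (sharp N P (differential N v)) w =
        ?b u (?b v w) + ?b v (?b w u)"
      unfolding lie_bracket_def pb[OF v w] pb[OF u w] pb[OF u pbC[OF v w]]
        pbs[OF u w] vf_uminus[OF sh[OF differential_form[OF v]] pbC[OF w u]] pb[OF v pbC[OF w u]] by simp
    have "- ?b w (?b u v) - (?b u (?b v w) + ?b v (?b w u)) =
        - (?b u (?b v w) + ?b v (?b w u) + ?b w (?b u v))" by (simp add: algebra_simps)
    then show ?thesis unfolding T_def 1 2 J by simp
  qed
  \<comment> \<open>Linearity is used in one slot at a time: first \<open>\<beta>\<close> becomes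
    arbitrary while the first slot stays exact, then the first slot is freed.\<close>
  have 1: "T w (differential N u) \<beta> p = 0" if "u \<in> C" "w \<in> C" "\<beta> \<in> OF" for u w p \<beta>
    using linear_eq_on_exact[OF lin2[OF differential_form[OF that(1)] that(2)] zero _ that(3), of p]
      exact[OF that(1) _ that(2)] by simp
  have 2: "T w \<alpha> \<beta> p = 0" if "w \<in> C" for w p
    using linear_eq_on_exact[OF lin1[OF b that] zero _ a, of p] 1[OF _ that b] by simp
  show ?thesis
  proof (rule vf_eqI)
    fix u p assume "u \<in> C"
    from 2[OF this, of p] show "sharp N P (koszul_bracket N P \<alpha> \<beta>) u p = lie_bracket (sharp N P \<alpha>) (sharp N P \<beta>) u p"
      by (simp add: T_def)
  qed (use a b sh kb in simp_all)
qed

end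

section \<open>The Koszul formula and the connection it defines\<close>

locale poisson_metric = metric_manifold N G
  for N :: "('a::{second_countable_topology,t2_space}, 'e::euclidean_space) atlas" and G :: "'a metric" +
  fixes P :: "'a bivector"
  assumes poisson: "poisson_bivector N P"
begin

lemma bivector: "bivector_field N P"
  using poisson by (simp add: poisson_bivector_def)

abbreviation "sh \<equiv> sharp N P"
abbreviation "kb \<equiv> koszul_bracket N P"

lemmas sh_VF [simp] = sharp_VF[OF bivector]
lemmas kb_form [simp] = koszul_bracket_form[OF bivector]
lemmas sh_smooth [simp] = vf_smooth[OF sh_VF]
declare cometric_smooth [simp]

lemma cometric_add1: "\<alpha> \<in> OF \<Longrightarrow> \<beta> \<in> OF \<Longrightarrow> \<gamma> \<in> OF \<Longrightarrow> g (\<alpha> + \<beta>) \<gamma> = g \<alpha> \<gamma> + g \<beta> \<gamma>"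
  and cometric_add2: "\<alpha> \<in> OF \<Longrightarrow> \<beta> \<in> OF \<Longrightarrow> \<gamma> \<in> OF \<Longrightarrow> g \<gamma> (\<alpha> + \<beta>) = g \<gamma> \<alpha> + g \<gamma> \<beta>"
  and cometric_diff1: "\<alpha> \<in> OF \<Longrightarrow> \<beta> \<in> OF \<Longrightarrow> \<gamma> \<in> OF \<Longrightarrow> g (\<alpha> - \<beta>) \<gamma> = g \<alpha> \<gamma> - g \<beta> \<gamma>"
  and cometric_fscale1: "u \<in> C \<Longrightarrow> \<alpha> \<in> OF \<Longrightarrow> \<gamma> \<in> OF \<Longrightarrow> g (fscale u \<alpha>) \<gamma> = u * g \<alpha> \<gamma>"
  and cometric_fscale2: "u \<in> C \<Longrightarrow> \<alpha> \<in> OF \<Longrightarrow> \<gamma> \<in> OF \<Longrightarrow> g \<gamma> (fscale u \<alpha>) = u * g \<gamma> \<alpha>"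
  and cometric_uminus1: "\<alpha> \<in> OF \<Longrightarrow> \<gamma> \<in> OF \<Longrightarrow> g (- \<alpha>) \<gamma> = - g \<alpha> \<gamma>"
  by (rule function_linear_add[OF cometric_linear1] function_linear_add[OF cometric_linear2]
      function_linear_diff[OF cometric_linear1 OF_module] function_linear_fscale[OF cometric_linear1]
      function_linear_fscale[OF cometric_linear2] function_linear_uminus[OF cometric_linear1]; assumption)+

lemmas cometric_simps = cometric_add1 cometric_add2 cometric_diff1 cometric_fscale1 cometric_fscale2
lemmas kb_simps = koszul_bracket_add1[OF bivector] koszul_bracket_add2[OF bivector]
  koszul_bracket_fscale1[OF bivector] koszul_bracket_fscale2[OF bivector]
lemmas sh_simps = sharp_add[OF bivector] sharp_fscale[OF bivector] fscale_apply
  vf_add[OF sh_VF] vf_mult[OF sh_VF]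

text \<open>The right-hand side of the Koszul formula, which for the Levi-Civita connection equals
  twice the pairing of \<open>D \<alpha> \<beta>\<close> with \<open>\<gamma>\<close>.\<close>

definition koszul_form :: "'a form \<Rightarrow> 'a form \<Rightarrow> 'a form \<Rightarrow> 'a \<Rightarrow> real" where
  "koszul_form \<alpha> \<beta> \<gamma> = sh \<alpha> (g \<beta> \<gamma>) + sh \<beta> (g \<alpha> \<gamma>) - sh \<gamma> (g \<alpha> \<beta>)
     + g (kb \<alpha> \<beta>) \<gamma> + g (kb \<gamma> \<alpha>) \<beta> + g (kb \<gamma> \<beta>) \<alpha>"

lemma koszul_form_smooth [simp]:
  "\<alpha> \<in> OF \<Longrightarrow> \<beta> \<in> OF \<Longrightarrow> \<gamma> \<in> OF \<Longrightarrow> koszul_form \<alpha> \<beta> \<gamma> \<in> C"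
  unfolding koszul_form_def by (intro smooth_functions_add smooth_functions_diff) simp_all

context
  fixes \<alpha> \<beta> \<gamma> and p :: 'a
  assumes mem: "\<alpha> \<in> OF" "\<beta> \<in> OF" "\<gamma> \<in> OF"
begin

private lemma sym: "g \<beta> \<alpha> = g \<alpha> \<beta>" "g \<gamma> \<alpha> = g \<alpha> \<gamma>" "g \<gamma> \<beta> = g \<beta> \<gamma>"
  using mem by (auto intro: cometric_sym)

lemma koszul_form_add1: "\<delta> \<in> OF \<Longrightarrow> koszul_form (\<alpha> + \<delta>) \<beta> \<gamma> p = koszul_form \<alpha> \<beta> \<gamma> p + koszul_form \<delta> \<beta> \<gamma> p"
  and koszul_form_add2: "\<delta> \<in> OF \<Longrightarrow> koszul_form \<alpha> (\<beta> + \<delta>) \<gamma> p = koszul_form \<alpha> \<beta> \<gamma> p + koszul_form \<alpha> \<delta> \<gamma> p"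
  and koszul_form_add3: "\<delta> \<in> OF \<Longrightarrow> koszul_form \<alpha> \<beta> (\<gamma> + \<delta>) p = koszul_form \<alpha> \<beta> \<gamma> p + koszul_form \<alpha> \<beta> \<delta> p"
  using mem by (simp_all add: koszul_form_def cometric_simps kb_simps sh_simps)

text \<open>Both the derivatives of cometric values and the brackets produce derivatives of
  \<open>u\<close>. These cancel in the first and third slots; in the second, those along
  \<open>sh \<gamma>\<close> cancel and those along \<open>sh \<alpha>\<close> add up. This is the
  behaviour required of a connection.\<close>

lemma koszul_form_fscale1: "u \<in> C \<Longrightarrow> koszul_form (fscale u \<alpha>) \<beta> \<gamma> p = u p * koszul_form \<alpha> \<beta> \<gamma> p"
  and koszul_form_fscale2: "u \<in> C \<Longrightarrow> koszul_form \<alpha> (fscale u \<beta>) \<gamma> p =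
    u p * koszul_form \<alpha> \<beta> \<gamma> p + 2 * (sh \<alpha> u p * g \<beta> \<gamma> p)"
  and koszul_form_fscale3: "u \<in> C \<Longrightarrow> koszul_form \<alpha> \<beta> (fscale u \<gamma>) p = u p * koszul_form \<alpha> \<beta> \<gamma> p"
  using mem by (simp_all add: koszul_form_def cometric_simps kb_simps sh_simps sym algebra_simps)

text \<open>Apart from the term with \<open>kb \<alpha> \<beta>\<close>, which is skew, the
  expression is symmetric in \<open>\<alpha>\<close> and \<open>\<beta>\<close>.\<close>

lemma koszul_form_torsion: "koszul_form \<alpha> \<beta> \<gamma> p - koszul_form \<beta> \<alpha> \<gamma> p = 2 * g (kb \<alpha> \<beta>) \<gamma> p"
  using mem cometric_uminus1[of "kb \<alpha> \<beta>" \<gamma>]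
  by (simp add: koszul_form_def sym koszul_bracket_skew[OF bivector mem(1,2)])

text \<open>Apart from the first term, the expression is skew under the exchange of
  \<open>\<beta>\<close> and \<open>\<gamma>\<close>.\<close>

lemma koszul_form_metric: "koszul_form \<alpha> \<beta> \<gamma> p + koszul_form \<alpha> \<gamma> \<beta> p = 2 * sh \<alpha> (g \<beta> \<gamma>) p"
  using mem cometric_uminus1[of "kb \<alpha> \<beta>" \<gamma>] cometric_uminus1[of "kb \<alpha> \<gamma>" \<beta>]
    cometric_uminus1[of "kb \<beta> \<gamma>" \<alpha>]
  by (simp add: koszul_form_def sym koszul_bracket_skew[OF bivector mem(1,2)]
      koszul_bracket_skew[OF bivector mem(1,3)] koszul_bracket_skew[OF bivector mem(2,3)])

end

text \<open>Metric compatibility for the three choices of the differentiating form, combined with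
  the torsion identity, eliminates all connection terms but one. Since the cometric is
  nondegenerate, this forces uniqueness.\<close>

lemma levi_civita_koszul:
  assumes D: "is_levi_civita N P g D" and a: "\<alpha> \<in> OF" and b: "\<beta> \<in> OF" and c: "\<gamma> \<in> OF"
  shows "2 * g (D \<alpha> \<beta>) \<gamma> p = koszul_form \<alpha> \<beta> \<gamma> p"
proof -
  note d = D[unfolded is_levi_civita_def]
  have DO: "D x y \<in> OF" if "x \<in> OF" "y \<in> OF" for x y
    by (rule d[THEN conjunct1, rule_format, OF that])
  note d' = d[THEN conjunct2, THEN conjunct2, THEN conjunct2, THEN conjunct2, THEN conjunct2]
  have tor: "g (kb x y) z p = g (D x y) z p - g (D y x) z p" if "x \<in> OF" "y \<in> OF" "z \<in> OF" for x y z
    unfolding d'[THEN conjunct1, rule_format, OF that(1,2), symmetric]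
      cometric_diff1[OF DO[OF that(1,2)] DO[OF that(2,1)] that(3)] by simp
  have met: "sh x (g y z) p = g (D x y) z p + g (D x z) y p" if "x \<in> OF" "y \<in> OF" "z \<in> OF" for x y z
    unfolding d'[THEN conjunct2, rule_format, OF that] cometric_sym[OF that(2) DO[OF that(1,3)]] by simp
  show ?thesis
    unfolding koszul_form_def using met[OF a b c] met[OF b a c] met[OF c a b] tor[OF a b c] tor[OF c a b] tor[OF c b a]
    by simp
qed

text \<open>Half the Koszul form is linear over the functions in \<open>\<gamma>\<close> and hence
  is the pairing with a 1-form. Each axiom of the connection is read off by pairing with an
  arbitrary \<open>\<delta>\<close> and using the corresponding property of
  \<open>koszul_form\<close>.\<close>

lemma levi_civita_exists: "\<exists>D. is_levi_civita N P g D"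
proof -
  have ex: "\<exists>\<delta>\<in>OF. \<forall>\<gamma>\<in>OF. g \<delta> \<gamma> = (\<lambda>_. 1 / 2) * koszul_form \<alpha> \<beta> \<gamma>"
    if ab: "\<alpha> \<in> OF" "\<beta> \<in> OF" for \<alpha> \<beta>
  proof (rule cometric_represents)
    show "function_linear C OF (\<lambda>\<gamma>. (\<lambda>_. 1 / 2) * koszul_form \<alpha> \<beta> \<gamma>)"
      unfolding function_linear_def
    proof (intro conjI ballI ext)
      show "((\<lambda>_. 1 / 2) * koszul_form \<alpha> \<beta> (\<gamma> + \<delta>)) p =
          ((\<lambda>_. 1 / 2) * koszul_form \<alpha> \<beta> \<gamma> + (\<lambda>_. 1 / 2) * koszul_form \<alpha> \<beta> \<delta>) p"
        if "\<gamma> \<in> OF" "\<delta> \<in> OF" for \<gamma> \<delta> p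
        using koszul_form_add3[OF ab that, of p] by (simp add: add_divide_distrib)
      show "((\<lambda>_. 1 / 2) * koszul_form \<alpha> \<beta> (fscale u \<gamma>)) p = (u * ((\<lambda>_. 1 / 2) * koszul_form \<alpha> \<beta> \<gamma>)) p"
        if "u \<in> C" "\<gamma> \<in> OF" for u \<gamma> p
        using koszul_form_fscale3[OF ab that(2,1), of p] by simp
    qed
    show "(\<lambda>_. 1 / 2) * koszul_form \<alpha> \<beta> \<gamma> \<in> C" if "\<gamma> \<in> OF" for \<gamma> using ab that by simp
  qed
  \<comment> \<open>The default \<open>0\<close> is prescribed by \<open>is_levi_civita\<close>; it
    is what makes the connection unique as a function on all arguments.\<close>
  define D where "D \<alpha> \<beta> = (if \<alpha> \<in> OF \<and> \<beta> \<in> OF then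
      SOME \<delta>. \<delta> \<in> OF \<and> (\<forall>\<gamma>\<in>OF. g \<delta> \<gamma> = (\<lambda>_. 1 / 2) * koszul_form \<alpha> \<beta> \<gamma>) else 0)" for \<alpha> \<beta>
  have D: "D \<alpha> \<beta> \<in> OF \<and> (\<forall>\<gamma>\<in>OF. g (D \<alpha> \<beta>) \<gamma> = (\<lambda>_. 1 / 2) * koszul_form \<alpha> \<beta> \<gamma>)"
    if ab: "\<alpha> \<in> OF" "\<beta> \<in> OF" for \<alpha> \<beta>
  proof -
    let ?Q = "\<lambda>\<delta>. \<delta> \<in> OF \<and> (\<forall>\<gamma>\<in>OF. g \<delta> \<gamma> = (\<lambda>_. 1 / 2) * koszul_form \<alpha> \<beta> \<gamma>)"
    obtain \<delta> where "?Q \<delta>" using ex[OF ab] by blast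
    then have q: "?Q (SOME \<delta>. ?Q \<delta>)" by (rule someI[where P="?Q"])
    have eq: "D \<alpha> \<beta> = (SOME \<delta>. ?Q \<delta>)" unfolding D_def using ab by (simp only: simp_thms if_True)
    show ?thesis unfolding eq by (rule q)
  qed
  have DO: "D \<alpha> \<beta> \<in> OF" if "\<alpha> \<in> OF" "\<beta> \<in> OF" for \<alpha> \<beta> using D[OF that] by blast
  have gD: "g (D \<alpha> \<beta>) \<gamma> p = koszul_form \<alpha> \<beta> \<gamma> p / 2" if "\<alpha> \<in> OF" "\<beta> \<in> OF" "\<gamma> \<in> OF" for \<alpha> \<beta> \<gamma> p
  proof -
    have "g (D \<alpha> \<beta>) \<gamma> = (\<lambda>_. 1 / 2) * koszul_form \<alpha> \<beta> \<gamma>" using D[OF that(1,2)] that(3) by blast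
    then show ?thesis by simp
  qed
  have eqI: "x = y" if "x \<in> OF" "y \<in> OF" "\<And>\<gamma> p. \<gamma> \<in> OF \<Longrightarrow> g x \<gamma> p = g y \<gamma> p" for x y
    by (rule form_eq_cometricI[OF that(1,2)]) (rule ext, rule that(3))
  have addl: "D (\<alpha> + \<beta>) \<gamma> = D \<alpha> \<gamma> + D \<beta> \<gamma>" if "\<alpha> \<in> OF" "\<beta> \<in> OF" "\<gamma> \<in> OF" for \<alpha> \<beta> \<gamma>
  proof (rule eqI)
    fix \<delta> p assume \<delta>: "\<delta> \<in> OF"
    show "g (D (\<alpha> + \<beta>) \<gamma>) \<delta> p = g (D \<alpha> \<gamma> + D \<beta> \<gamma>) \<delta> p"
      using that \<delta> koszul_form_add1[OF that(1,3) \<delta> that(2), of p]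
      by (simp add: gD cometric_add1 DO add_divide_distrib)
  qed (use that DO in simp_all)
  have addr: "D \<alpha> (\<beta> + \<gamma>) = D \<alpha> \<beta> + D \<alpha> \<gamma>" if "\<alpha> \<in> OF" "\<beta> \<in> OF" "\<gamma> \<in> OF" for \<alpha> \<beta> \<gamma>
  proof (rule eqI)
    fix \<delta> p assume \<delta>: "\<delta> \<in> OF"
    show "g (D \<alpha> (\<beta> + \<gamma>)) \<delta> p = g (D \<alpha> \<beta> + D \<alpha> \<gamma>) \<delta> p"
      using that \<delta> koszul_form_add2[OF that(1,2) \<delta> that(3), of p]
      by (simp add: gD cometric_add1 DO add_divide_distrib)
  qed (use that DO in simp_all)
  have scl: "D (fscale u \<alpha>) \<beta> = fscale u (D \<alpha> \<beta>)" if "u \<in> C" "\<alpha> \<in> OF" "\<beta> \<in> OF" for u \<alpha> \<beta>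
  proof (rule eqI)
    fix \<delta> p assume \<delta>: "\<delta> \<in> OF"
    show "g (D (fscale u \<alpha>) \<beta>) \<delta> p = g (fscale u (D \<alpha> \<beta>)) \<delta> p"
      using that \<delta> koszul_form_fscale1[OF that(2,3) \<delta> that(1), of p]
      by (simp add: gD cometric_fscale1 DO)
  qed (use that DO in simp_all)
  have scr: "D \<alpha> (fscale u \<beta>) = fscale u (D \<alpha> \<beta>) + fscale (sh \<alpha> u) \<beta>"
    if "u \<in> C" "\<alpha> \<in> OF" "\<beta> \<in> OF" for u \<alpha> \<beta>
  proof (rule eqI)
    fix \<delta> p assume \<delta>: "\<delta> \<in> OF"
    show "g (D \<alpha> (fscale u \<beta>)) \<delta> p = g (fscale u (D \<alpha> \<beta>) + fscale (sh \<alpha> u) \<beta>) \<delta> p"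
      using that \<delta> koszul_form_fscale2[OF that(2,3) \<delta> that(1), of p]
      by (simp add: gD cometric_fscale1 cometric_add1 DO add_divide_distrib)
  qed (use that DO in simp_all)
  have tor: "D \<alpha> \<beta> - D \<beta> \<alpha> = kb \<alpha> \<beta>" if "\<alpha> \<in> OF" "\<beta> \<in> OF" for \<alpha> \<beta>
  proof (rule eqI)
    fix \<delta> p assume \<delta>: "\<delta> \<in> OF"
    show "g (D \<alpha> \<beta> - D \<beta> \<alpha>) \<delta> p = g (kb \<alpha> \<beta>) \<delta> p"
      using that \<delta> koszul_form_torsion[OF that \<delta>, of p]
      by (simp add: gD cometric_diff1 DO)
  qed (use that DO in simp_all)
  have met: "sh \<alpha> (g \<beta> \<gamma>) = g (D \<alpha> \<beta>) \<gamma> + g \<beta> (D \<alpha> \<gamma>)" if "\<alpha> \<in> OF" "\<beta> \<in> OF" "\<gamma> \<in> OF" for \<alpha> \<beta> \<gamma>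
  proof
    fix p
    show "sh \<alpha> (g \<beta> \<gamma>) p = (g (D \<alpha> \<beta>) \<gamma> + g \<beta> (D \<alpha> \<gamma>)) p"
      unfolding cometric_sym[OF that(2) DO[OF that(1,3)]]
      using koszul_form_metric[OF that, of p] that by (simp add: gD)
  qed
  have const: "sh \<alpha> (\<lambda>_. c) = 0" if "\<alpha> \<in> OF" for \<alpha> c by (rule vf_const[OF sh_VF[OF that]])
  have "is_levi_civita N P g D"
    unfolding is_levi_civita_def
  proof (intro conjI ballI allI impI)
    show "D \<alpha> (fscale (\<lambda>_. c) \<beta>) = fscale (\<lambda>_. c) (D \<alpha> \<beta>)" if "\<alpha> \<in> OF" "\<beta> \<in> OF" for c \<alpha> \<beta>
      unfolding scr[OF smooth_functions_const that] const[OF that(1)] by (simp add: fun_eq_iff)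
    show "D \<alpha> \<beta> = 0" if "\<not> (\<alpha> \<in> OF \<and> \<beta> \<in> OF)" for \<alpha> \<beta>
      unfolding D_def using that by (simp only: if_False)
  qed (fact DO addl addr scl[OF smooth_functions_const] scl scr tor met | rule DO addl addr scl scr tor met smooth_functions_const; assumption?)+
  then show ?thesis by blast
qed

lemma levi_civita_unique:
  assumes D: "is_levi_civita N P g D" and D': "is_levi_civita N P g D'"
  shows "D = D'"
proof (intro ext[of D D'] ext[of "D _" "D' _"])
  fix \<alpha> \<beta>
  note d = D[unfolded is_levi_civita_def] and d' = D'[unfolded is_levi_civita_def]
  show "D \<alpha> \<beta> = D' \<alpha> \<beta>"
  proof (cases "\<alpha> \<in> OF \<and> \<beta> \<in> OF")
    case True
    then have ab: "\<alpha> \<in> OF" "\<beta> \<in> OF" by auto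
    show ?thesis
    proof (rule form_eq_cometricI)
      show "D \<alpha> \<beta> \<in> OF" by (rule d[THEN conjunct1, rule_format, OF ab])
      show "D' \<alpha> \<beta> \<in> OF" by (rule d'[THEN conjunct1, rule_format, OF ab])
      fix \<gamma> assume c: "\<gamma> \<in> OF"
      show "g (D \<alpha> \<beta>) \<gamma> = g (D' \<alpha> \<beta>) \<gamma>"
      proof
        fix p show "g (D \<alpha> \<beta>) \<gamma> p = g (D' \<alpha> \<beta>) \<gamma> p"
          using levi_civita_koszul[OF D ab c, of p] levi_civita_koszul[OF D' ab c, of p] by linarith
      qed
    qed
  next
    case False
    have "D \<alpha> \<beta> = 0" by (rule d[THEN conjunct2, THEN conjunct1, rule_format, OF False])
    moreover have "D' \<alpha> \<beta> = 0" by (rule d'[THEN conjunct2, THEN conjunct1, rule_format, OF False])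
    ultimately show ?thesis by simp
  qed
qed

abbreviation "\<D> \<equiv> levi_civita N P g"

lemma levi_civita: "is_levi_civita N P g \<D>"
  unfolding levi_civita_def
  by (rule theI'[where P="is_levi_civita N P g"])
    (intro ex_ex1I levi_civita_exists levi_civita_unique)

lemma D_form [simp]: "\<alpha> \<in> OF \<Longrightarrow> \<beta> \<in> OF \<Longrightarrow> \<D> \<alpha> \<beta> \<in> OF"
  by (rule levi_civita[unfolded is_levi_civita_def, THEN conjunct1, rule_format])

lemma D_add1: "\<alpha> \<in> OF \<Longrightarrow> \<beta> \<in> OF \<Longrightarrow> \<gamma> \<in> OF \<Longrightarrow> \<D> (\<alpha> + \<beta>) \<gamma> = \<D> \<alpha> \<gamma> + \<D> \<beta> \<gamma>"
  by (rule levi_civita[unfolded is_levi_civita_def, THEN conjunct2, THEN conjunct2, THEN conjunct1,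
        rule_format, THEN conjunct1])

lemma D_add2: "\<alpha> \<in> OF \<Longrightarrow> \<beta> \<in> OF \<Longrightarrow> \<gamma> \<in> OF \<Longrightarrow> \<D> \<alpha> (\<beta> + \<gamma>) = \<D> \<alpha> \<beta> + \<D> \<alpha> \<gamma>"
  by (rule levi_civita[unfolded is_levi_civita_def, THEN conjunct2, THEN conjunct2, THEN conjunct1,
        rule_format, THEN conjunct2])

lemma D_fscale1: "u \<in> C \<Longrightarrow> \<alpha> \<in> OF \<Longrightarrow> \<beta> \<in> OF \<Longrightarrow> \<D> (fscale u \<alpha>) \<beta> = fscale u (\<D> \<alpha> \<beta>)"
  by (rule levi_civita[unfolded is_levi_civita_def, THEN conjunct2, THEN conjunct2, THEN conjunct2,
        THEN conjunct2, THEN conjunct1, rule_format, THEN conjunct1])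

lemma D_fscale2: "u \<in> C \<Longrightarrow> \<alpha> \<in> OF \<Longrightarrow> \<beta> \<in> OF \<Longrightarrow>
    \<D> \<alpha> (fscale u \<beta>) = fscale u (\<D> \<alpha> \<beta>) + fscale (sh \<alpha> u) \<beta>"
  by (rule levi_civita[unfolded is_levi_civita_def, THEN conjunct2, THEN conjunct2, THEN conjunct2,
        THEN conjunct2, THEN conjunct1, rule_format, THEN conjunct2])

lemma D_uminus1: "\<alpha> \<in> OF \<Longrightarrow> \<beta> \<in> OF \<Longrightarrow> \<D> (- \<alpha>) \<beta> = - \<D> \<alpha> \<beta>"
  using D_fscale1[OF smooth_functions_const[of "- 1"]] by (simp add: fscale_minus_1)

lemma D_0: "\<alpha> \<in> OF \<Longrightarrow> \<D> 0 \<alpha> = 0" "\<alpha> \<in> OF \<Longrightarrow> \<D> \<alpha> 0 = 0"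
  using D_add1[of 0 0 \<alpha>] D_add2[of \<alpha> 0 0] by simp_all

section \<open>Curvature\<close>

abbreviation "\<R> \<equiv> curvature N P g"

lemma curvature_form [simp]: "\<alpha> \<in> OF \<Longrightarrow> \<beta> \<in> OF \<Longrightarrow> \<gamma> \<in> OF \<Longrightarrow> \<R> \<alpha> \<beta> \<gamma> \<in> OF"
  by (simp add: curvature_def)

context
  fixes \<alpha> \<beta> \<gamma>
  assumes mem: "\<alpha> \<in> OF" "\<beta> \<in> OF" "\<gamma> \<in> OF"
begin

private lemmas D_simps = D_add1 D_add2 D_fscale1 D_fscale2

lemma curvature_skew: "\<R> \<beta> \<alpha> \<gamma> = - \<R> \<alpha> \<beta> \<gamma>"
  unfolding curvature_def koszul_bracket_skew[OF bivector mem(1,2)]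
    D_uminus1[OF kb_form[OF mem(1,2)] mem(3)] by simp

lemma curvature_add1:
  assumes "\<delta> \<in> OF" shows "\<R> (\<alpha> + \<delta>) \<beta> \<gamma> = \<R> \<alpha> \<beta> \<gamma> + \<R> \<delta> \<beta> \<gamma>"
proof (intro ext)
  fix X p show "\<R> (\<alpha> + \<delta>) \<beta> \<gamma> X p = (\<R> \<alpha> \<beta> \<gamma> + \<R> \<delta> \<beta> \<gamma>) X p"
    using mem assms by (simp add: curvature_def kb_simps D_simps)
qed

lemma curvature_fscale1:
  assumes "u \<in> C" shows "\<R> (fscale u \<alpha>) \<beta> \<gamma> = fscale u (\<R> \<alpha> \<beta> \<gamma>)"
proof (intro ext)
  fix X p
  have h: "\<D> (fscale u (kb \<alpha> \<beta>) - fscale (sh \<beta> u) \<alpha>) \<gamma> = fscale u (\<D> (kb \<alpha> \<beta>) \<gamma>) - fscale (sh \<beta> u) (\<D> \<alpha> \<gamma>)"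
    using D_add1[of "fscale u (kb \<alpha> \<beta>)" "- fscale (sh \<beta> u) \<alpha>" \<gamma>] mem assms by (simp add: D_uminus1 D_fscale1)
  show "\<R> (fscale u \<alpha>) \<beta> \<gamma> X p = fscale u (\<R> \<alpha> \<beta> \<gamma>) X p"
    using mem assms by (simp add: curvature_def kb_simps h D_simps algebra_simps)
qed

lemma curvature_add3:
  assumes "\<delta> \<in> OF" shows "\<R> \<alpha> \<beta> (\<gamma> + \<delta>) = \<R> \<alpha> \<beta> \<gamma> + \<R> \<alpha> \<beta> \<delta>"
proof (intro ext)
  fix X p show "\<R> \<alpha> \<beta> (\<gamma> + \<delta>) X p = (\<R> \<alpha> \<beta> \<gamma> + \<R> \<alpha> \<beta> \<delta>) X p"
    using mem assms by (simp add: curvature_def D_simps)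
qed

text \<open>First derivatives of \<open>u\<close> cancel. The second-order terms leave the
  commutator of \<open>sh \<alpha>\<close> and \<open>sh \<beta>\<close> minus
  \<open>sh (kb \<alpha> \<beta>)\<close>, applied to \<open>u\<close>; this vanishes because
  \<open>sharp\<close> respects brackets, so tensoriality rests on the Jacobi identity.\<close>

lemma curvature_fscale3:
  assumes "u \<in> C" shows "\<R> \<alpha> \<beta> (fscale u \<gamma>) = fscale u (\<R> \<alpha> \<beta> \<gamma>)"
proof (intro ext)
  fix X p
  have h: "sh (kb \<alpha> \<beta>) u p = sh \<alpha> (sh \<beta> u) p - sh \<beta> (sh \<alpha> u) p"
    unfolding sharp_koszul_bracket[OF poisson mem(1,2)] lie_bracket_def by simp
  show "\<R> \<alpha> \<beta> (fscale u \<gamma>) X p = fscale u (\<R> \<alpha> \<beta> \<gamma>) X p"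
    using mem assms by (simp add: curvature_def h D_simps algebra_simps)
qed

end

definition Rm :: "'a form \<Rightarrow> 'a form \<Rightarrow> 'a form \<Rightarrow> 'a form \<Rightarrow> 'a \<Rightarrow> real" where
  "Rm \<alpha> \<beta> \<gamma> \<delta> = g (\<R> \<alpha> \<beta> \<gamma>) \<delta>"

lemma Rm_linear1:
  "\<beta> \<in> OF \<Longrightarrow> \<gamma> \<in> OF \<Longrightarrow> \<delta> \<in> OF \<Longrightarrow> function_linear C OF (\<lambda>\<alpha>. Rm \<alpha> \<beta> \<gamma> \<delta>)"
  unfolding function_linear_def Rm_def
  by (simp add: curvature_add1 curvature_fscale1 cometric_add1 cometric_fscale1
      del: plus_fun_apply times_fun_apply)

lemma Rm_linear3:
  "\<alpha> \<in> OF \<Longrightarrow> \<beta> \<in> OF \<Longrightarrow> \<delta> \<in> OF \<Longrightarrow> function_linear C OF (\<lambda>\<gamma>. Rm \<alpha> \<beta> \<gamma> \<delta>)"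
  unfolding function_linear_def Rm_def
  by (simp add: curvature_add3 curvature_fscale3 cometric_add1 cometric_fscale1
      del: plus_fun_apply times_fun_apply)

lemma Rm_linear4:
  "\<alpha> \<in> OF \<Longrightarrow> \<beta> \<in> OF \<Longrightarrow> \<gamma> \<in> OF \<Longrightarrow> function_linear C OF (Rm \<alpha> \<beta> \<gamma>)"
  unfolding Rm_def by (rule cometric_linear2) simp

lemma Rm_linear2:
  assumes a: "\<alpha> \<in> OF" and c: "\<gamma> \<in> OF" and d: "\<delta> \<in> OF"
  shows "function_linear C OF (\<lambda>\<beta>. Rm \<alpha> \<beta> \<gamma> \<delta>)"
proof -
  have skew: "Rm \<alpha> \<beta> \<gamma> \<delta> = - Rm \<beta> \<alpha> \<gamma> \<delta>" if "\<beta> \<in> OF" for \<beta>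
    unfolding Rm_def curvature_skew[OF that a c]
    by (rule cometric_uminus1) (use that a c d in simp_all)
  show ?thesis
    unfolding function_linear_def
  proof (intro conjI ballI)
    show "Rm \<alpha> (\<beta> + \<beta>') \<gamma> \<delta> = Rm \<alpha> \<beta> \<gamma> \<delta> + Rm \<alpha> \<beta>' \<gamma> \<delta>" if b: "\<beta> \<in> OF" "\<beta>' \<in> OF" for \<beta> \<beta>'
      unfolding skew[OF OF_closed(1)[OF b]] skew[OF b(1)] skew[OF b(2)]
        function_linear_add[OF Rm_linear1[OF a c d] b] by simp
    show "Rm \<alpha> (fscale u \<beta>) \<gamma> \<delta> = u * Rm \<alpha> \<beta> \<gamma> \<delta>" if b: "u \<in> C" "\<beta> \<in> OF" for u \<beta>
      unfolding skew[OF OF_closed(2)[OF b]] skew[OF b(2)]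
        function_linear_fscale[OF Rm_linear1[OF a c d] b] by simp
  qed
qed

lemma Rm_smooth [simp]: "\<alpha> \<in> OF \<Longrightarrow> \<beta> \<in> OF \<Longrightarrow> \<gamma> \<in> OF \<Longrightarrow> \<delta> \<in> OF \<Longrightarrow> Rm \<alpha> \<beta> \<gamma> \<delta> \<in> C"
  by (simp add: Rm_def)

text \<open>The sum is a metric trace over the two middle slots of \<open>Rm\<close>, so all
  coframes around \<open>p\<close> give the same value and the description in \<open>ricci\<close>
  denotes it.\<close>

lemma ricci_eq:
  assumes on: "coframe_on W \<eta>" and p: "p \<in> W" and a: "\<alpha> \<in> OF" and b: "\<beta> \<in> OF"
  shows "ricci N P g \<alpha> \<beta> p = (\<Sum>i<DIM('e). g (\<eta> i) (\<eta> i) p * Rm \<alpha> (\<eta> i) (\<eta> i) \<beta> p)"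
  unfolding ricci_def Rm_def[symmetric]
proof (rule the_equality)
  show "\<exists>\<zeta>. orthonormal_coframe_near N g p \<zeta> \<and>
    (\<Sum>i<DIM('e). g (\<eta> i) (\<eta> i) p * Rm \<alpha> (\<eta> i) (\<eta> i) \<beta> p) =
    (\<Sum>i<DIM('e). g (\<zeta> i) (\<zeta> i) p * Rm \<alpha> (\<zeta> i) (\<zeta> i) \<beta> p)"
    using on p orthonormal_coframe_near_iff by blast
  fix r assume "\<exists>\<zeta>. orthonormal_coframe_near N g p \<zeta> \<and>
    r = (\<Sum>i<DIM('e). g (\<zeta> i) (\<zeta> i) p * Rm \<alpha> (\<zeta> i) (\<zeta> i) \<beta> p)"
  then obtain \<zeta> W' where z: "coframe_on W' \<zeta>" "p \<in> W'"
    and r: "r = (\<Sum>i<DIM('e). g (\<zeta> i) (\<zeta> i) p * Rm \<alpha> (\<zeta> i) (\<zeta> i) \<beta> p)"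
    using orthonormal_coframe_near_iff by blast
  show "r = (\<Sum>i<DIM('e). g (\<eta> i) (\<eta> i) p * Rm \<alpha> (\<eta> i) (\<eta> i) \<beta> p)"
    unfolding r
    by (rule metric_trace_unique[OF on z(1) p z(2), of "\<lambda>x y. Rm \<alpha> x y \<beta>"])
      (rule Rm_linear2[OF a _ b] Rm_linear3[OF a _ b]; assumption)+
qed

text \<open>The definition nests two independent choices of coframe. The inner one is replaced by
  \<open>\<eta>\<close> through the formula for \<open>ricci\<close>, the outer one because the
  resulting \<open>T\<close> is bilinear over the functions.\<close>

lemma scalar_curvature_eq:
  assumes on: "coframe_on W \<eta>" and p: "p \<in> W"
  shows "scalar_curvature N P g p =
    (\<Sum>i<DIM('e). \<Sum>j<DIM('e). g (\<eta> i) (\<eta> i) p * g (\<eta> j) (\<eta> j) p * Rm (\<eta> i) (\<eta> j) (\<eta> j) (\<eta> i) p)"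
proof -
  define T where "T x y = (\<Sum>j<DIM('e). g (\<eta> j) (\<eta> j) * Rm x (\<eta> j) (\<eta> j) y)" for x y
  note e = coframe_onD(2)[OF on]
  have T1: "function_linear C OF (\<lambda>x. T x y)" if "y \<in> OF" for y
    unfolding function_linear_def
  proof (intro conjI ballI)
    show "T (x + x') y = T x y + T x' y" if "x \<in> OF" "x' \<in> OF" for x x'
      unfolding T_def sum.distrib[symmetric] using that \<open>y \<in> OF\<close> e
      by (intro sum.cong refl) (simp add: function_linear_add[OF Rm_linear1] distrib_left del: plus_fun_apply times_fun_apply)
    show "T (fscale u x) y = u * T x y" if "u \<in> C" "x \<in> OF" for u x
      unfolding T_def sum_distrib_left using that \<open>y \<in> OF\<close> e
      by (intro sum.cong refl) (simp add: function_linear_fscale[OF Rm_linear1] mult_ac del: plus_fun_apply times_fun_apply)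
  qed
  have T2: "function_linear C OF (T x)" if "x \<in> OF" for x
    unfolding function_linear_def
  proof (intro conjI ballI)
    show "T x (y + y') = T x y + T x y'" if "y \<in> OF" "y' \<in> OF" for y y'
      unfolding T_def sum.distrib[symmetric] using that \<open>x \<in> OF\<close> e
      by (intro sum.cong refl) (simp add: function_linear_add[OF Rm_linear4] distrib_left del: plus_fun_apply times_fun_apply)
    show "T x (fscale u y) = u * T x y" if "u \<in> C" "y \<in> OF" for u y
      unfolding T_def sum_distrib_left using that \<open>x \<in> OF\<close> e
      by (intro sum.cong refl) (simp add: function_linear_fscale[OF Rm_linear4] mult_ac del: plus_fun_apply times_fun_apply)
  qed
  have ric: "ricci N P g x y p = T x y p" if "x \<in> OF" "y \<in> OF" for x y
    unfolding ricci_eq[OF on p that] T_def by (simp add: sum_fun_apply)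
  have "scalar_curvature N P g p = (\<Sum>i<DIM('e). g (\<eta> i) (\<eta> i) p * T (\<eta> i) (\<eta> i) p)"
    unfolding scalar_curvature_def
  proof (rule the_equality)
    have "(\<Sum>i<DIM('e). g (\<eta> i) (\<eta> i) p * T (\<eta> i) (\<eta> i) p) =
        (\<Sum>i<DIM('e). g (\<eta> i) (\<eta> i) p * ricci N P g (\<eta> i) (\<eta> i) p)"
      by (intro sum.cong refl) (simp add: ric e)
    then show "\<exists>\<zeta>. orthonormal_coframe_near N g p \<zeta> \<and>
      (\<Sum>i<DIM('e). g (\<eta> i) (\<eta> i) p * T (\<eta> i) (\<eta> i) p) =
      (\<Sum>i<DIM('e). g (\<zeta> i) (\<zeta> i) p * ricci N P g (\<zeta> i) (\<zeta> i) p)"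
      using on p orthonormal_coframe_near_iff by blast
    fix r assume "\<exists>\<zeta>. orthonormal_coframe_near N g p \<zeta> \<and>
      r = (\<Sum>i<DIM('e). g (\<zeta> i) (\<zeta> i) p * ricci N P g (\<zeta> i) (\<zeta> i) p)"
    then obtain \<zeta> W' where z: "coframe_on W' \<zeta>" "p \<in> W'"
      and r: "r = (\<Sum>i<DIM('e). g (\<zeta> i) (\<zeta> i) p * ricci N P g (\<zeta> i) (\<zeta> i) p)"
      using orthonormal_coframe_near_iff by blast
    have "r = (\<Sum>i<DIM('e). g (\<zeta> i) (\<zeta> i) p * T (\<zeta> i) (\<zeta> i) p)"
      unfolding r by (intro sum.cong refl) (simp add: ric coframe_onD(2)[OF z(1)])
    also have "\<dots> = (\<Sum>i<DIM('e). g (\<eta> i) (\<eta> i) p * T (\<eta> i) (\<eta> i) p)"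
      by (rule metric_trace_unique[OF on z(1) p z(2) T1 T2])
    finally show "r = (\<Sum>i<DIM('e). g (\<eta> i) (\<eta> i) p * T (\<eta> i) (\<eta> i) p)" .
  qed
  then show ?thesis by (simp add: T_def sum_fun_apply sum_distrib_left mult.assoc)
qed

text \<open>A single coframe computes the curvature throughout a neighbourhood, by sums and products
  of smooth functions. This is where the smoothness of the warping function in the theorem comes
  from.\<close>

lemma scalar_curvature_smooth: "scalar_curvature N P g \<in> C"
proof (rule smooth_functionsI_local)
  fix p
  obtain W \<eta> where on: "p \<in> W" "coframe_on W \<eta>"
    using coframe_exists[of p] orthonormal_coframe_near_iff by blast
  note e = coframe_onD(2)[OF on(2)]
  let ?v = "\<Sum>i<DIM('e). \<Sum>j<DIM('e). g (\<eta> i) (\<eta> i) * g (\<eta> j) (\<eta> j) * Rm (\<eta> i) (\<eta> j) (\<eta> j) (\<eta> i)"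
  have "?v \<in> C" by (intro smooth_functions_sum smooth_functions_mult) (simp_all add: e)
  moreover have "\<forall>q\<in>W. scalar_curvature N P g q = ?v q"
    using scalar_curvature_eq[OF on(2)] by (simp add: sum_fun_apply)
  ultimately show "\<exists>W v. open W \<and> p \<in> W \<and> v \<in> C \<and> (\<forall>q\<in>W. scalar_curvature N P g q = v q)"
    using on coframe_onD(1) by blast
qed

end

section \<open>Lifts along the factors of a product\<close>

text \<open>The projection \<open>k\<close> of a product onto a factor, and the slices \<open>s m\<close> of that factor through
  the points \<open>m\<close> of the product.\<close>

locale factor = tot: manifold M + bas: manifold N
  for M :: "('m::{second_countable_topology,t2_space}, 'em::euclidean_space) atlas"
    and N :: "('n::{second_countable_topology,t2_space}, 'en::euclidean_space) atlas" +
  fixes k :: "'m \<Rightarrow> 'n" and s :: "'m \<Rightarrow> 'n \<Rightarrow> 'm"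
  assumes k_s [simp]: "k (s m b) = b"
    and s_k [simp]: "s m (k m) = m"
    and s_s [simp]: "s (s m b) = s m"
    and k_open: "open W \<Longrightarrow> open (k -` W)"
    and pull_smooth [simp]: "u \<in> bas.C \<Longrightarrow> u \<circ> k \<in> tot.C"
    and slice_smooth [simp]: "v \<in> tot.C \<Longrightarrow> v \<circ> s m \<in> bas.C"
    and lift_smooth: "X \<in> bas.VF \<Longrightarrow> v \<in> tot.C \<Longrightarrow> (\<lambda>m. X (v \<circ> s m) (k m)) \<in> tot.C"
begin

definition push :: "'m vfield \<Rightarrow> 'm \<Rightarrow> 'n vfield" where
  "push X m = (\<lambda>u b. X (u \<circ> k) (s m b))"

definition lift :: "'n vfield \<Rightarrow> 'm vfield" where
  "lift X = (\<lambda>u. if u \<in> tot.C then (\<lambda>m. X (u \<circ> s m) (k m)) else 0)"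

definition form_lift :: "'n form \<Rightarrow> 'm form" where
  "form_lift \<alpha> = (\<lambda>X. if X \<in> tot.VF then (\<lambda>m. \<alpha> (push X m) (k m)) else 0)"

text \<open>The pullback of \<open>\<gamma>\<close> along the inclusion of the slice through
  \<open>m\<close>.\<close>

definition slice_form :: "'m form \<Rightarrow> 'm \<Rightarrow> 'n form" where
  "slice_form \<gamma> m = (\<lambda>X. if X \<in> bas.VF then \<gamma> (lift X) \<circ> s m else 0)"

lemma pull_slice [simp]: "(u \<circ> k) \<circ> s m = u"
  by (simp add: fun_eq_iff)

lemma pull_smooth_iff [simp]: "u \<circ> k \<in> tot.C \<longleftrightarrow> u \<in> bas.C"
  using slice_smooth[of "u \<circ> k"] by (auto simp del: slice_smooth)

lemma comp_arith:
  fixes u v :: "'x \<Rightarrow> real"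
  shows "(u + v) \<circ> h = (u \<circ> h) + (v \<circ> h)" "(u - v) \<circ> h = (u \<circ> h) - (v \<circ> h)"
    "(u * v) \<circ> h = (u \<circ> h) * (v \<circ> h)" "(\<lambda>_. c) \<circ> h = (\<lambda>_. c)" "(- u) \<circ> h = - (u \<circ> h)" "0 \<circ> h = (0 :: _ \<Rightarrow> real)"
  by (simp_all add: fun_eq_iff)

lemma push_VF [simp]:
  assumes X: "X \<in> tot.VF" shows "push X m \<in> bas.VF"
  unfolding vector_fields_def
proof (intro CollectI conjI ballI allI impI)
  have eq: "push X m u = X (u \<circ> k) \<circ> s m" for u by (simp add: push_def fun_eq_iff)
  note sm = tot.vf_smooth[OF X]
  show "push X m u \<in> bas.C" if "u \<in> bas.C" for u
    unfolding eq by (rule slice_smooth[OF sm[OF pull_smooth[OF that]]])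
  show "push X m (u + v) = push X m u + push X m v" if "u \<in> bas.C" "v \<in> bas.C" for u v
    unfolding eq comp_arith using that by (simp add: tot.vf_add[OF X] comp_arith)
  show "push X m ((\<lambda>_. c) * u) = (\<lambda>_. c) * push X m u" if "u \<in> bas.C" for c u
    unfolding eq comp_arith using that by (simp add: tot.vf_cmult[OF X] comp_arith)
  show "push X m (u * v) = push X m u * v + u * push X m v" if "u \<in> bas.C" "v \<in> bas.C" for u v
    unfolding eq comp_arith using that by (simp add: tot.vf_mult[OF X] comp_arith)
  show "push X m u = 0" if "u \<notin> bas.C" for u
    unfolding eq using that by (simp add: tot.vf_outside[OF X] comp_arith)
qed

lemma lift_apply: "u \<in> tot.C \<Longrightarrow> lift X u m = X (u \<circ> s m) (k m)"
  by (simp add: lift_def)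

lemma lift_VF [simp]:
  assumes X: "X \<in> bas.VF" shows "lift X \<in> tot.VF"
  unfolding vector_fields_def
proof (intro CollectI conjI ballI allI impI)
  show "lift X u \<in> tot.C" if "u \<in> tot.C" for u
    using lift_smooth[OF X that] that by (simp add: lift_def)
  show "lift X (u + v) = lift X u + lift X v" if "u \<in> tot.C" "v \<in> tot.C" for u v
    using that by (simp add: fun_eq_iff lift_apply comp_arith bas.vf_add[OF X])
  show "lift X ((\<lambda>_. c) * u) = (\<lambda>_. c) * lift X u" if "u \<in> tot.C" for c u
    using that by (simp add: fun_eq_iff lift_apply comp_arith bas.vf_cmult[OF X])
  show "lift X (u * v) = lift X u * v + u * lift X v" if "u \<in> tot.C" "v \<in> tot.C" for u v
    using that by (simp add: fun_eq_iff lift_apply comp_arith bas.vf_mult[OF X])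
  show "lift X u = 0" if "u \<notin> tot.C" for u using that by (simp add: lift_def)
qed

lemma lift_pull: "u \<in> bas.C \<Longrightarrow> lift X (u \<circ> k) = X u \<circ> k"
  by (simp add: fun_eq_iff lift_apply)

lemma push_lift [simp]: "X \<in> bas.VF \<Longrightarrow> push (lift X) m = X"
proof (intro ext)
  fix u b assume X: "X \<in> bas.VF"
  show "push (lift X) m u b = X u b"
    by (cases "u \<in> bas.C") (simp_all add: push_def lift_def bas.vf_outside[OF X])
qed

lemma lift_slice: "u \<in> tot.C \<Longrightarrow> lift X u \<circ> s m = X (u \<circ> s m)"
  by (simp add: fun_eq_iff lift_apply)

lemma lift_lie_bracket:
  assumes X: "X \<in> bas.VF" and Y: "Y \<in> bas.VF"
  shows "lie_bracket (lift X) (lift Y) = lift (lie_bracket X Y)"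
proof (rule tot.vf_eqI)
  fix u m assume u: "u \<in> tot.C"
  show "lie_bracket (lift X) (lift Y) u m = lift (lie_bracket X Y) u m"
    using u tot.vf_smooth[OF lift_VF[OF X] u] tot.vf_smooth[OF lift_VF[OF Y] u]
    by (simp add: lift_apply lie_bracket_def lift_slice)
qed (use X Y in simp_all)

lemma lift_add: "X \<in> bas.VF \<Longrightarrow> Y \<in> bas.VF \<Longrightarrow> lift (X + Y) = lift X + lift Y"
  by (rule tot.vf_eqI) (simp_all add: lift_apply)

lemma lift_fscale: "u \<in> bas.C \<Longrightarrow> X \<in> bas.VF \<Longrightarrow> lift (fscale u X) = fscale (u \<circ> k) (lift X)"
  by (rule tot.vf_eqI) (simp_all add: lift_apply)

lemma push_add: "push (X + Y) m = push X m + push Y m"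
  by (simp add: push_def fun_eq_iff)

lemma push_fscale: "push (fscale u X) m = fscale (u \<circ> s m) (push X m)"
  by (simp add: push_def fun_eq_iff)

lemma form_lift_apply: "X \<in> tot.VF \<Longrightarrow> form_lift \<alpha> X m = \<alpha> (push X m) (k m)"
  by (simp add: form_lift_def)

text \<open>The field \<open>push X m\<close> changes with \<open>m\<close>, so smoothness of
  expressions in it is not immediate. Expanded in a frame of the factor, its coefficients are
  \<open>X (x e \<circ> k)\<close>, smooth functions on the total space.\<close>

lemma push_expansion_local:
  assumes X: "X \<in> tot.VF"
  obtains W x E where "open W" "m0 \<in> W" "\<And>e. x e \<in> bas.C" "\<And>e::'en. E e \<in> bas.VF"
    "\<And>A m. function_linear bas.C bas.VF A \<Longrightarrow> m \<in> W \<Longrightarrow>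
      A (push X m) (k m) = (\<Sum>e\<in>Basis. X (x e \<circ> k) m * A (E e) (k m))"
proof -
  obtain x E W where p: "k m0 \<in> W" and fr: "bas.local_frame W x E" using bas.frame_at .
  show thesis
  proof (rule that[of "k -` W" x E])
    show "open (k -` W)" by (rule k_open[OF bas.local_frameD(1)[OF fr]])
    show "m0 \<in> k -` W" using p by simp
    show "x e \<in> bas.C" "E e \<in> bas.VF" for e by (rule bas.local_frameD[OF fr])+
    show "A (push X m) (k m) = (\<Sum>e\<in>Basis. X (x e \<circ> k) m * A (E e) (k m))"
      if "function_linear bas.C bas.VF A" "m \<in> k -` W" for A m
      using bas.linear_frame_expansion[OF that(1) push_VF[OF X] fr, of "k m" m] that(2)
      by (simp add: push_def)
  qed
qed

lemma form_lift_form [simp]: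
  assumes \<alpha>: "\<alpha> \<in> bas.OF" shows "form_lift \<alpha> \<in> tot.OF"
proof (rule tot.formI)
  show "function_linear tot.C tot.VF (form_lift \<alpha>)"
    unfolding function_linear_def
    by (auto simp: fun_eq_iff form_lift_apply push_add push_fscale bas.form_add[OF \<alpha>]
        bas.form_fscale[OF \<alpha>])
  show "form_lift \<alpha> X \<in> tot.C" if X: "X \<in> tot.VF" for X
  proof (rule tot.smooth_functionsI_local)
    fix m0
    obtain W x E where W: "open W" "m0 \<in> W" "\<And>e. x e \<in> bas.C" "\<And>e::'en. E e \<in> bas.VF"
      "\<And>A m. function_linear bas.C bas.VF A \<Longrightarrow> m \<in> W \<Longrightarrow>
        A (push X m) (k m) = (\<Sum>e\<in>Basis. X (x e \<circ> k) m * A (E e) (k m))"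
      by (rule push_expansion_local[OF X, of m0]) (rule that)
    let ?v = "\<Sum>e\<in>Basis. X (x e \<circ> k) * (\<alpha> (E e) \<circ> k)"
    have "?v \<in> tot.C"
      by (intro tot.smooth_functions_sum tot.smooth_functions_mult tot.vf_smooth[OF X] pull_smooth W(3)
          bas.form_smooth[OF \<alpha>] W(4))
    moreover have "\<forall>m\<in>W. form_lift \<alpha> X m = ?v m"
    proof
      fix m assume "m \<in> W"
      then show "form_lift \<alpha> X m = ?v m"
        unfolding form_lift_apply[OF X] W(5)[OF bas.form_linear[OF \<alpha>] \<open>m \<in> W\<close>]
        by (simp add: sum_fun_apply)
    qed
    ultimately show "\<exists>W v. open W \<and> m0 \<in> W \<and> v \<in> tot.C \<and> (\<forall>q\<in>W. form_lift \<alpha> X q = v q)"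
      using W(1,2) by blast
  qed
qed (simp add: form_lift_def)

lemma form_lift_lift: "X \<in> bas.VF \<Longrightarrow> form_lift \<alpha> (lift X) = \<alpha> X \<circ> k"
  by (simp add: fun_eq_iff form_lift_apply)

lemma form_lift_diff: "form_lift (\<alpha> - \<beta>) = form_lift \<alpha> - form_lift \<beta>"
  by (simp add: form_lift_def fun_eq_iff)

lemma form_lift_differential: "u \<in> bas.C \<Longrightarrow> form_lift (differential N u) = differential M (u \<circ> k)"
  by (rule tot.form_eqI) (simp_all add: form_lift_apply tot.differential_apply bas.differential_apply, simp add: push_def)

lemma slice_form_form [simp]:
  assumes \<gamma>: "\<gamma> \<in> tot.OF" shows "slice_form \<gamma> m \<in> bas.OF"
proof (rule bas.formI)
  show "function_linear bas.C bas.VF (slice_form \<gamma> m)"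
    unfolding function_linear_def
    by (auto simp: slice_form_def lift_add lift_fscale tot.form_add[OF \<gamma>] tot.form_fscale[OF \<gamma>] comp_arith
        simp del: comp_apply)
  show "slice_form \<gamma> m X \<in> bas.C" if "X \<in> bas.VF" for X
    using that \<gamma> by (simp add: slice_form_def)
qed (simp add: slice_form_def)

end

text \<open>A product seen symmetrically in its factors, so that each fact about the first one has a
  mirror image through \<open>swap\<close>. \<open>tangent_sum\<close> says that a tangent vector is
  the sum of its components along the two slices.\<close>

locale complementary = one: factor M N1 k1 s1 + two: factor M N2 k2 s2
  for M :: "('m::{second_countable_topology,t2_space}, 'em::euclidean_space) atlas"
    and N1 :: "('n1::{second_countable_topology,t2_space}, 'e1::euclidean_space) atlas" and k1 s1
    and N2 :: "('n2::{second_countable_topology,t2_space}, 'e2::euclidean_space) atlas" and k2 s2 +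
  assumes cross1 [simp]: "k2 (s1 m b) = k2 m" and cross2 [simp]: "k1 (s2 m w) = k1 m"
    and tangent_sum: "X \<in> one.tot.VF \<Longrightarrow> u \<in> one.tot.C \<Longrightarrow>
      X u m = one.push X m (u \<circ> s1 m) (k1 m) + two.push X m (u \<circ> s2 m) (k2 m)"
    and dim_sum: "DIM('em) = DIM('e1) + DIM('e2)"

sublocale complementary \<subseteq> swap: complementary M N2 k2 s2 N1 k1 s1
  by unfold_locales (simp_all add: tangent_sum dim_sum)

context complementary
begin

abbreviation "C \<equiv> one.tot.C"
abbreviation "VF \<equiv> one.tot.VF"
abbreviation "OF \<equiv> one.tot.OF"

lemma lift_pull_other: "X \<in> one.bas.VF \<Longrightarrow> u \<in> two.bas.C \<Longrightarrow> one.lift X (u \<circ> k2) = 0"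
proof
  fix m assume X: "X \<in> one.bas.VF" and u: "u \<in> two.bas.C"
  have "(u \<circ> k2) \<circ> s1 m = (\<lambda>_. u (k2 m))" by (simp add: fun_eq_iff)
  then show "one.lift X (u \<circ> k2) m = 0 m"
    using u by (simp add: one.lift_apply one.bas.vf_const[OF X] del: comp_apply)
qed

lemma push_lift_other: "X \<in> one.bas.VF \<Longrightarrow> two.push (one.lift X) m = 0"
proof (intro ext)
  fix u w assume X: "X \<in> one.bas.VF"
  show "two.push (one.lift X) m u w = 0 u w"
  proof (cases "u \<in> two.bas.C")
    case True
    then show ?thesis using lift_pull_other[OF X True] by (simp add: two.push_def)
  next
    case False
    then show ?thesis by (simp add: two.push_def one.lift_def)
  qed
qed

lemma form_lift_lift_other: "\<beta> \<in> two.bas.OF \<Longrightarrow> X \<in> one.bas.VF \<Longrightarrow> two.form_lift \<beta> (one.lift X) = 0"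
  by (simp add: fun_eq_iff two.form_lift_apply push_lift_other
      two.bas.function_linear_0[OF two.bas.form_linear two.bas.VF_module])

text \<open>The two lifts freeze the components of \<open>X\<close> along the slices through
  \<open>m\<close>, so the identity is asserted at \<open>m\<close> only. This is all that a map
  linear over the functions sees.\<close>

lemma vf_decomposition:
  assumes "X \<in> VF" "u \<in> C"
  shows "X u m = (one.lift (one.push X m) + two.lift (two.push X m)) u m"
  using tangent_sum[OF assms, of m] assms by (simp add: one.lift_apply two.lift_apply)

lemma linear_vf_decomposition:
  assumes A: "function_linear C VF A" and X: "X \<in> VF"
  shows "A X m = A (one.lift (one.push X m)) m + A (two.lift (two.push X m)) m"
proof -
  have "A X m = A (one.lift (one.push X m) + two.lift (two.push X m)) m"
    by (rule one.tot.linear_pointwise_VF[OF A X]) (use X vf_decomposition in simp_all)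
  also have "\<dots> = A (one.lift (one.push X m)) m + A (two.lift (two.push X m)) m"
    using function_linear_add[OF A, of "one.lift (one.push X m)" "two.lift (two.push X m)"] X by simp
  finally show ?thesis .
qed

lemma form_decomposition:
  assumes \<gamma>: "\<gamma> \<in> OF" and X: "X \<in> VF"
  shows "\<gamma> X m = (one.form_lift (one.slice_form \<gamma> m) + two.form_lift (two.slice_form \<gamma> m)) X m"
  using linear_vf_decomposition[OF one.tot.form_linear[OF \<gamma>] X, of m] X
  by (simp add: one.form_lift_apply two.form_lift_apply one.slice_form_def two.slice_form_def)

text \<open>At \<open>m\<close> the form \<open>\<gamma>\<close> has the same values as the sum of
  the lifts of its two slice forms, and \<open>A\<close> depends only on those values. The lifts
  change with \<open>m\<close>, so the conclusion is drawn pointwise.\<close>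

lemma linear_zero_on_lifts:
  assumes A: "function_linear C OF A"
    and 1: "\<And>\<alpha>. \<alpha> \<in> one.bas.OF \<Longrightarrow> A (one.form_lift \<alpha>) m = 0"
    and 2: "\<And>\<alpha>. \<alpha> \<in> two.bas.OF \<Longrightarrow> A (two.form_lift \<alpha>) m = 0"
    and \<gamma>: "\<gamma> \<in> OF"
  shows "A \<gamma> m = 0"
proof -
  let ?a = "one.form_lift (one.slice_form \<gamma> m)" and ?b = "two.form_lift (two.slice_form \<gamma> m)"
  have "A \<gamma> m = A (?a + ?b) m"
    by (rule one.tot.linear_pointwise_OF[OF A \<gamma>]) (use \<gamma> form_decomposition[OF \<gamma>] in simp_all)
  also have "\<dots> = A ?a m + A ?b m"
    using function_linear_add[OF A, of ?a ?b] \<gamma> by simp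
  finally show ?thesis using 1 2 \<gamma> by simp
qed

lemma linear_eq_on_lifts:
  assumes A: "function_linear C OF A" and B: "function_linear C OF B"
    and 1: "\<And>\<alpha>. \<alpha> \<in> one.bas.OF \<Longrightarrow> A (one.form_lift \<alpha>) = B (one.form_lift \<alpha>)"
    and 2: "\<And>\<alpha>. \<alpha> \<in> two.bas.OF \<Longrightarrow> A (two.form_lift \<alpha>) = B (two.form_lift \<alpha>)"
    and \<gamma>: "\<gamma> \<in> OF"
  shows "A \<gamma> = B \<gamma>"
proof
  fix m
  have "function_linear C OF (\<lambda>\<gamma>. A \<gamma> - B \<gamma>)"
    unfolding function_linear_def
    by (auto simp: fun_eq_iff function_linear_add[OF A] function_linear_add[OF B]
        function_linear_fscale[OF A] function_linear_fscale[OF B] algebra_simps)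
  from linear_zero_on_lifts[OF this _ _ \<gamma>, of m] show "A \<gamma> m = B \<gamma> m" using 1 2 by simp
qed

lemma form_eq_on_lifts:
  assumes "\<gamma> \<in> OF" "\<delta> \<in> OF"
    "\<And>X. X \<in> one.bas.VF \<Longrightarrow> \<gamma> (one.lift X) = \<delta> (one.lift X)"
    "\<And>X. X \<in> two.bas.VF \<Longrightarrow> \<gamma> (two.lift X) = \<delta> (two.lift X)"
  shows "\<gamma> = \<delta>"
proof (rule one.tot.form_eqI[OF assms(1,2)])
  fix X m assume X: "X \<in> VF"
  show "\<gamma> X m = \<delta> X m"
    using linear_vf_decomposition[OF one.tot.form_linear[OF assms(1)] X, of m]
      linear_vf_decomposition[OF one.tot.form_linear[OF assms(2)] X, of m] assms(3,4) X by simp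
qed

end

text \<open>Contexts with a symmetric interpretation such as \<open>swap\<close> are reopened whenever the mirror
  images of their latest facts are needed.\<close>

context complementary
begin

text \<open>Both components of the bracket are tested on functions pulled back from a factor. One of
  the two fields kills such functions and the other keeps them pulled back from the same factor, so
  both compositions vanish.\<close>

lemma lift_lie_bracket_other:
  assumes X: "X \<in> one.bas.VF" and Y: "Y \<in> two.bas.VF"
  shows "lie_bracket (one.lift X) (two.lift Y) = 0"
proof (rule one.tot.vf_eqI)
  let ?Z = "lie_bracket (one.lift X) (two.lift Y)"
  show Z: "?Z \<in> VF" using X Y by simp
  have a: "one.push ?Z m u b = 0" if "u \<in> one.bas.C" for m u b
    unfolding one.push_def lie_bracket_def swap.lift_pull_other[OF Y that]
      one.lift_pull[OF that] swap.lift_pull_other[OF Y one.bas.vf_smooth[OF X that]]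
    by (simp add: one.tot.vf_0[OF one.lift_VF[OF X]])
  have b: "two.push ?Z m u b = 0" if "u \<in> two.bas.C" for m u b
    unfolding two.push_def lie_bracket_def lift_pull_other[OF X that]
      two.lift_pull[OF that] lift_pull_other[OF X two.bas.vf_smooth[OF Y that]]
    by (simp add: one.tot.vf_0[OF two.lift_VF[OF Y]])
  fix u m assume u: "u \<in> C"
  show "?Z u m = 0 u m"
    using tangent_sum[OF Z u, of m] a[OF one.slice_smooth[OF u]] b[OF two.slice_smooth[OF u]] by simp
qed simp

lemma lie_derivative_lift:
  assumes X: "X \<in> one.bas.VF" and \<beta>: "\<beta> \<in> one.bas.OF"
  shows "lie_derivative M (one.lift X) (one.form_lift \<beta>) = one.form_lift (lie_derivative N1 X \<beta>)"
proof (rule form_eq_on_lifts)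
  fix Y assume Y: "Y \<in> one.bas.VF"
  show "lie_derivative M (one.lift X) (one.form_lift \<beta>) (one.lift Y) =
      one.form_lift (lie_derivative N1 X \<beta>) (one.lift Y)"
    unfolding one.form_lift_lift[OF Y] using X Y \<beta>
    by (simp add: lie_derivative_def one.form_lift_lift one.lift_lie_bracket one.lift_pull one.comp_arith
        del: comp_apply)
next
  fix Y assume Y: "Y \<in> two.bas.VF"
  show "lie_derivative M (one.lift X) (one.form_lift \<beta>) (two.lift Y) =
      one.form_lift (lie_derivative N1 X \<beta>) (two.lift Y)"
    unfolding swap.form_lift_lift_other[OF one.bas.lie_derivative_form[OF X \<beta>] Y] using X Y \<beta>
    by (simp add: lie_derivative_def swap.form_lift_lift_other lift_lie_bracket_other
        one.tot.vf_0[OF one.lift_VF[OF X]]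
        one.tot.function_linear_0[OF one.tot.form_linear[OF one.form_lift_form[OF \<beta>]] one.tot.VF_module])
qed (use X \<beta> in simp_all)

lemma lie_derivative_lift_other:
  assumes X: "X \<in> one.bas.VF" and \<beta>: "\<beta> \<in> two.bas.OF"
  shows "lie_derivative M (one.lift X) (two.form_lift \<beta>) = 0"
proof (rule form_eq_on_lifts)
  fix Y assume Y: "Y \<in> one.bas.VF"
  show "lie_derivative M (one.lift X) (two.form_lift \<beta>) (one.lift Y) = 0 (one.lift Y)"
    using X Y \<beta> by (simp add: lie_derivative_def form_lift_lift_other one.lift_lie_bracket
        one.tot.vf_0[OF one.lift_VF[OF X]])
next
  fix Y assume Y: "Y \<in> two.bas.VF"
  show "lie_derivative M (one.lift X) (two.form_lift \<beta>) (two.lift Y) = 0 (two.lift Y)"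
    using X Y \<beta> by (simp add: lie_derivative_def two.form_lift_lift lift_pull_other lift_lie_bracket_other
        one.tot.function_linear_0[OF one.tot.form_linear[OF two.form_lift_form[OF \<beta>]] one.tot.VF_module])
qed (use X \<beta> in simp_all)

end

section \<open>Poisson structures and warped metrics on products\<close>

context poisson_metric
begin

text \<open>The covariant derivative of the bivector field along \<open>\<alpha>\<close>, evaluated
  on \<open>\<beta>\<close> and \<open>\<gamma>\<close>; its vanishing is the condition in
  \<open>pseudo_riemannian_poisson\<close>.\<close>

definition parallel_defect :: "'a form \<Rightarrow> 'a form \<Rightarrow> 'a form \<Rightarrow> 'a \<Rightarrow> real" where
  "parallel_defect \<alpha> \<beta> \<gamma> = sh \<alpha> (P \<beta> \<gamma>) - P (\<D> \<alpha> \<beta>) \<gamma> - P \<beta> (\<D> \<alpha> \<gamma>)"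

lemmas P_simps = function_linear_add[OF bivector_linear1[OF bivector]]
  function_linear_add[OF bivector_linear2[OF bivector]]
  function_linear_fscale[OF bivector_linear1[OF bivector]]
  function_linear_fscale[OF bivector_linear2[OF bivector]]

text \<open>In the last two slots the derivative of \<open>u\<close> comes once from the Leibniz
  rule for \<open>sh \<alpha>\<close> and once from the connection, with opposite signs.\<close>

lemma parallel_defect_linear:
  assumes "\<alpha> \<in> OF" "\<beta> \<in> OF" "\<gamma> \<in> OF"
  shows "function_linear C OF (\<lambda>\<alpha>. parallel_defect \<alpha> \<beta> \<gamma>)"
    "function_linear C OF (\<lambda>\<beta>. parallel_defect \<alpha> \<beta> \<gamma>)"
    "function_linear C OF (parallel_defect \<alpha> \<beta>)"
  using assms bivector_smooth[OF bivector]
  by (auto simp: function_linear_def fun_eq_iff parallel_defect_def P_simps sh_simps D_add1 D_add2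
      D_fscale1 D_fscale2 algebra_simps)

end

locale poisson_product = complementary M N1 k1 s1 N2 k2 s2
  for M :: "('m::{second_countable_topology,t2_space}, 'em::euclidean_space) atlas"
    and N1 :: "('n1::{second_countable_topology,t2_space}, 'e1::euclidean_space) atlas" and k1 s1
    and N2 :: "('n2::{second_countable_topology,t2_space}, 'e2::euclidean_space) atlas" and k2 s2 +
  fixes P1 :: "'n1 bivector" and P2 :: "'n2 bivector" and P :: "'m bivector"
  assumes bv1: "bivector_field N1 P1" and bv2: "bivector_field N2 P2" and bv: "bivector_field M P"
    and P_11: "\<alpha> \<in> one.bas.OF \<Longrightarrow> \<beta> \<in> one.bas.OF \<Longrightarrow>
      P (one.form_lift \<alpha>) (one.form_lift \<beta>) = P1 \<alpha> \<beta> \<circ> k1"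
    and P_12: "\<alpha> \<in> one.bas.OF \<Longrightarrow> \<gamma> \<in> two.bas.OF \<Longrightarrow> P (one.form_lift \<alpha>) (two.form_lift \<gamma>) = 0"
    and P_22: "\<gamma> \<in> two.bas.OF \<Longrightarrow> \<delta> \<in> two.bas.OF \<Longrightarrow>
      P (two.form_lift \<gamma>) (two.form_lift \<delta>) = P2 \<gamma> \<delta> \<circ> k2"

lemma (in poisson_product) P_21:
  assumes "\<gamma> \<in> two.bas.OF" "\<alpha> \<in> one.bas.OF" shows "P (two.form_lift \<gamma>) (one.form_lift \<alpha>) = 0"
  unfolding one.tot.bivector_skew[OF bv two.form_lift_form[OF assms(1)] one.form_lift_form[OF assms(2)]]
    P_12[OF assms(2,1)] by simp

sublocale poisson_product \<subseteq> pswap: poisson_product M N2 k2 s2 N1 k1 s1 P2 P1 P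
  by unfold_locales (simp_all add: bv1 bv2 bv P_11 P_21 P_22)

context poisson_product
begin

text \<open>A function on the product need not come from a factor. Its differential is therefore
  treated as an arbitrary form, and the two sides are compared on lifts.\<close>

lemma sharp_lift:
  assumes a: "\<alpha> \<in> one.bas.OF"
  shows "sharp M P (one.form_lift \<alpha>) = one.lift (sharp N1 P1 \<alpha>)"
proof (rule one.tot.vf_eqI)
  note L = one.form_lift_form[OF a] and sh1 = one.bas.sharp_VF[OF bv1 a]
  show "sharp M P (one.form_lift \<alpha>) \<in> VF" by (rule one.tot.sharp_VF[OF bv L])
  show X: "one.lift (sharp N1 P1 \<alpha>) \<in> VF" using sh1 by simp
  have lin: "function_linear C OF (\<lambda>\<gamma>. \<gamma> (one.lift (sharp N1 P1 \<alpha>)))" by (simp add: function_linear_def)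
  fix u m assume u: "u \<in> C"
  have "sharp M P (one.form_lift \<alpha>) u = P (one.form_lift \<alpha>) (differential M u)"
    by (rule one.tot.sharp_apply[OF bv L u])
  also have "\<dots> = differential M u (one.lift (sharp N1 P1 \<alpha>))"
  proof (rule linear_eq_on_lifts[OF one.tot.bivector_linear2[OF bv L] lin])
    show "P (one.form_lift \<alpha>) (one.form_lift \<beta>) = one.form_lift \<beta> (one.lift (sharp N1 P1 \<alpha>))"
      if "\<beta> \<in> one.bas.OF" for \<beta>
      unfolding P_11[OF a that] one.form_lift_lift[OF sh1] one.bas.form_sharp[OF bv1 a that] ..
    show "P (one.form_lift \<alpha>) (two.form_lift \<beta>) = two.form_lift \<beta> (one.lift (sharp N1 P1 \<alpha>))"
      if "\<beta> \<in> two.bas.OF" for \<beta>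
      unfolding P_12[OF a that] form_lift_lift_other[OF that sh1] ..
  qed (use u in simp)
  also have "\<dots> = one.lift (sharp N1 P1 \<alpha>) u" by (rule one.tot.differential_apply[OF X])
  finally show "sharp M P (one.form_lift \<alpha>) u m = one.lift (sharp N1 P1 \<alpha>) u m" by simp
qed

lemma sharp_lift_pull:
  assumes a: "\<alpha> \<in> one.bas.OF" and v: "v \<in> one.bas.C"
  shows "sharp M P (one.form_lift \<alpha>) (v \<circ> k1) = sharp N1 P1 \<alpha> v \<circ> k1"
  unfolding sharp_lift[OF a] by (rule one.lift_pull[OF v])

lemma sharp_lift_pull_other:
  assumes a: "\<alpha> \<in> one.bas.OF" and v: "v \<in> two.bas.C"
  shows "sharp M P (one.form_lift \<alpha>) (v \<circ> k2) = 0"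
  unfolding sharp_lift[OF a] by (rule lift_pull_other[OF one.bas.sharp_VF[OF bv1 a] v])

lemma koszul_bracket_lift:
  assumes a: "\<alpha> \<in> one.bas.OF" and b: "\<beta> \<in> one.bas.OF"
  shows "koszul_bracket M P (one.form_lift \<alpha>) (one.form_lift \<beta>) = one.form_lift (koszul_bracket N1 P1 \<alpha> \<beta>)"
  unfolding koszul_bracket_def sharp_lift[OF a] sharp_lift[OF b]
    lie_derivative_lift[OF one.bas.sharp_VF[OF bv1 a] b]
    lie_derivative_lift[OF one.bas.sharp_VF[OF bv1 b] a] P_11[OF a b]
    one.form_lift_differential[OF one.bas.bivector_smooth[OF bv1 a b], symmetric]
    one.form_lift_diff ..

end

context poisson_product
begin

lemma koszul_bracket_lift_other:
  assumes a: "\<alpha> \<in> one.bas.OF" and b: "\<beta> \<in> two.bas.OF"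
  shows "koszul_bracket M P (one.form_lift \<alpha>) (two.form_lift \<beta>) = 0"
proof -
  have "differential M 0 = 0"
    by (auto simp: differential_def fun_eq_iff one.tot.vf_0)
  then show ?thesis
    unfolding koszul_bracket_def sharp_lift[OF a] pswap.sharp_lift[OF b] P_12[OF a b]
      lie_derivative_lift_other[OF one.bas.sharp_VF[OF bv1 a] b]
      swap.lie_derivative_lift_other[OF two.bas.sharp_VF[OF bv2 b] a] by simp
qed

text \<open>Against lifts from the first factor this is the Casimir property of \<open>f\<close>;
  lifts from the second factor have sharps that kill pullbacks from the first.\<close>

lemma casimir_pull:
  assumes f: "casimir N1 P1 f" and \<gamma>: "\<gamma> \<in> OF"
  shows "sharp M P \<gamma> (f \<circ> k1) = 0"
proof -
  have fC: "f \<in> one.bas.C" using f by (simp add: casimir_def)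
  have lin: "function_linear C OF (\<lambda>\<gamma>. sharp M P \<gamma> (f \<circ> k1))"
    by (auto simp: function_linear_def one.tot.sharp_add[OF bv] one.tot.sharp_fscale[OF bv]
        fscale_apply)
  have zero: "function_linear C OF (\<lambda>_. 0)" by (simp add: function_linear_def)
  show ?thesis
  proof (rule linear_eq_on_lifts[OF lin zero _ _ \<gamma>])
    show "sharp M P (one.form_lift \<alpha>) (f \<circ> k1) = 0" if "\<alpha> \<in> one.bas.OF" for \<alpha>
      unfolding sharp_lift_pull[OF that fC] one.bas.casimir_sharp[OF bv1 f that]
      by (simp add: fun_eq_iff)
    show "sharp M P (two.form_lift \<alpha>) (f \<circ> k1) = 0" if "\<alpha> \<in> two.bas.OF" for \<alpha>
      by (rule pswap.sharp_lift_pull_other[OF that fC])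
  qed
qed

end

text \<open>The weights \<open>a\<close> and \<open>c\<close> of the two factors are Casimir functions on the total space; the
  warped product of the theorem has \<open>a = 1\<close> and \<open>c = f \<circ> \<pi>\<close>.  Two weights keep the situation
  symmetric in the factors.\<close>

locale warped_product = poisson_product M N1 k1 s1 N2 k2 s2 P1 P2 P +
    pm1: poisson_metric N1 G1 P1 + pm2: poisson_metric N2 G2 P2 + pm: poisson_metric M G P
  for M :: "('m::{second_countable_topology,t2_space}, 'em::euclidean_space) atlas"
    and N1 :: "('n1::{second_countable_topology,t2_space}, 'e1::euclidean_space) atlas" and k1 s1
    and N2 :: "('n2::{second_countable_topology,t2_space}, 'e2::euclidean_space) atlas" and k2 s2
    and P1 P2 P G1 G2 G +
  fixes a c :: "'m \<Rightarrow> real"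
  assumes a_smooth: "a \<in> one.tot.C" and c_smooth: "c \<in> one.tot.C"
    and a_nz: "a m \<noteq> 0" and c_nz: "c m \<noteq> 0"
    and a_casimir: "\<gamma> \<in> one.tot.OF \<Longrightarrow> sharp M P \<gamma> a = 0"
    and c_casimir: "\<gamma> \<in> one.tot.OF \<Longrightarrow> sharp M P \<gamma> c = 0"
    and G_eq: "X \<in> one.tot.VF \<Longrightarrow> Y \<in> one.tot.VF \<Longrightarrow> G X Y m =
      (a m)\<^sup>2 * G1 (one.push X m) (one.push Y m) (k1 m) + (c m)\<^sup>2 * G2 (two.push X m) (two.push Y m) (k2 m)"

sublocale warped_product \<subseteq> wswap: warped_product M N2 k2 s2 N1 k1 s1 P2 P1 P G2 G1 G c a
  by unfold_locales
    (simp_all add: a_smooth c_smooth a_nz c_nz a_casimir c_casimir G_eq)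

context warped_product
begin

text \<open>The factor by which the cometric is rescaled on lifts from the first factor; its mirror
  image in \<open>wswap\<close> is the inverse square of \<open>c\<close>.\<close>

definition wa :: "'m \<Rightarrow> real" where "wa m = inverse (a m * a m)"

lemma wa_cancel: "a m * (a m * (wa m * x)) = x" "wa m * (a m * a m) = 1"
  using a_nz[of m] by (simp_all add: wa_def field_simps)

lemma wa_smooth: "wa \<in> C"
  unfolding wa_def[abs_def]
  using one.tot.smooth_functions_inverse[of "a * a"] a_smooth a_nz by simp

lemma wa_casimir:
  assumes "\<gamma> \<in> OF" shows "sharp M P \<gamma> wa = 0"
proof
  fix m
  note X = one.tot.sharp_VF[OF bv assms]
  have aa: "sharp M P \<gamma> (a * a) = 0"
    unfolding one.tot.vf_mult[OF X a_smooth a_smooth] a_casimir[OF assms] by simp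
  have "wa * (a * a) = (\<lambda>_. 1)" by (simp add: fun_eq_iff wa_cancel)
  then have "sharp M P \<gamma> wa * (a * a) + wa * sharp M P \<gamma> (a * a) = 0"
    using one.tot.vf_mult[OF X wa_smooth, of "a * a"] one.tot.vf_const[OF X, of 1] a_smooth by simp
  then have "sharp M P \<gamma> wa m * (a m * a m) = 0" unfolding aa by (simp add: fun_eq_iff)
  then show "sharp M P \<gamma> wa m = 0 m" using a_nz by simp
qed

text \<open>The vector field metrically dual to the lifted form is guessed as the lift of
  \<open>pm1.raise \<beta>\<close> times \<open>wa\<close> and verified by lowering it: the factor
  \<open>wa\<close> cancels the weight \<open>a\<close> squared in \<open>G\<close>.\<close>

lemma cometric_lift:
  assumes \<gamma>: "\<gamma> \<in> OF" and b: "\<beta> \<in> one.bas.OF"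
  shows "pm.g \<gamma> (one.form_lift \<beta>) = wa * \<gamma> (one.lift (pm1.raise \<beta>))"
proof -
  let ?X = "pm1.raise \<beta>"
  have X: "?X \<in> one.bas.VF" by (rule pm1.raise_VF[OF b])
  let ?Z = "fscale wa (one.lift ?X)"
  have Z: "?Z \<in> VF" using X wa_smooth by simp
  have "flat M G ?Z = one.form_lift \<beta>"
  proof (rule one.tot.form_eqI)
    fix Y m assume Y: "Y \<in> VF"
    note p1 = one.push_VF[OF Y, of m] and p2 = two.push_VF[OF Y, of m]
    have 1: "one.push ?Z m = fscale (wa \<circ> s1 m) ?X"
      by (simp add: one.push_fscale one.push_lift[OF X])
    have 2: "two.push ?Z m = 0"
      by (simp add: two.push_fscale push_lift_other[OF X])
    have g1: "G1 (fscale (wa \<circ> s1 m) ?X) (one.push Y m) (k1 m) = wa m * G1 ?X (one.push Y m) (k1 m)"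
      unfolding function_linear_fscale[OF pm1.metric_linear1[OF p1] one.slice_smooth[OF wa_smooth] X]
      by simp
    have g2: "G2 0 (two.push Y m) = 0"
      by (rule two.bas.function_linear_0[OF pm2.metric_linear1[OF p2] two.bas.VF_module])
    have b1: "G1 ?X (one.push Y m) = \<beta> (one.push Y m)"
      using pm1.flat_apply[OF p1, of ?X] pm1.flat_raise[OF b] by simp
    show "flat M G ?Z Y m = one.form_lift \<beta> Y m"
      unfolding pm.flat_apply[OF Y] G_eq[OF Z Y] 1 2 g1 g2 b1 one.form_lift_apply[OF Y]
      by (simp add: power2_eq_square mult.assoc wa_cancel)
  qed (use Z b in simp_all)
  then have "pm.g \<gamma> (one.form_lift \<beta>) = \<gamma> ?Z" using pm.cometric_flat[OF \<gamma> Z] by simp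
  also have "\<dots> = wa * \<gamma> (one.lift ?X)"
    by (rule one.tot.form_fscale[OF \<gamma> wa_smooth]) (use X in simp)
  finally show ?thesis .
qed

lemma cometric_11:
  assumes a: "\<alpha> \<in> one.bas.OF" and b: "\<beta> \<in> one.bas.OF"
  shows "pm.g (one.form_lift \<alpha>) (one.form_lift \<beta>) = wa * (pm1.g \<alpha> \<beta> \<circ> k1)"
  unfolding cometric_lift[OF one.form_lift_form[OF a] b] one.form_lift_lift[OF pm1.raise_VF[OF b]]
    pm1.cometric_raise[OF a b] ..

lemma cometric_21:
  assumes a: "\<alpha> \<in> two.bas.OF" and b: "\<beta> \<in> one.bas.OF"
  shows "pm.g (two.form_lift \<alpha>) (one.form_lift \<beta>) = 0"
  unfolding cometric_lift[OF two.form_lift_form[OF a] b] form_lift_lift_other[OF a pm1.raise_VF[OF b]]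
  by simp

end

context warped_product
begin

lemmas cometric_12 = wswap.cometric_21 and cometric_22 = wswap.cometric_11

abbreviation "L1 \<equiv> one.form_lift"
abbreviation "L2 \<equiv> two.form_lift"

text \<open>Since \<open>wa\<close> is Casimir, it passes through the derivation like a constant. In
  this way all derivatives of the weight drop out of the Koszul formula.\<close>

lemma sharp_weighted:
  assumes x: "\<alpha> \<in> one.bas.OF" and v: "v \<in> one.bas.C"
  shows "sharp M P (L1 \<alpha>) (wa * (v \<circ> k1)) = wa * (sharp N1 P1 \<alpha> v \<circ> k1)"
  using one.tot.vf_mult[OF pm.sh_VF[OF one.form_lift_form[OF x]] wa_smooth one.pull_smooth[OF v]]
    wa_casimir[OF one.form_lift_form[OF x]] sharp_lift_pull[OF x v] by simp

lemma sharp_weighted_other: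
  assumes x: "\<alpha> \<in> two.bas.OF" and v: "v \<in> one.bas.C"
  shows "sharp M P (L2 \<alpha>) (wa * (v \<circ> k1)) = 0"
  using one.tot.vf_mult[OF pm.sh_VF[OF two.form_lift_form[OF x]] wa_smooth one.pull_smooth[OF v]]
    wa_casimir[OF two.form_lift_form[OF x]] pswap.sharp_lift_pull_other[OF x v] by simp

lemma sharp_0: "\<gamma> \<in> OF \<Longrightarrow> sharp M P \<gamma> 0 = 0"
  by (rule one.tot.vf_0[OF pm.sh_VF])

lemma cometric_0: "\<gamma> \<in> OF \<Longrightarrow> pm.g 0 \<gamma> = 0" "\<gamma> \<in> OF \<Longrightarrow> pm.g \<gamma> 0 = 0"
  by (rule one.tot.function_linear_0[OF pm.cometric_linear1 one.tot.OF_module]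
      one.tot.function_linear_0[OF pm.cometric_linear2 one.tot.OF_module]; assumption)+

end

section \<open>The connection on lifts\<close>

context warped_product
begin

lemma koszul_form_111:
  assumes "\<alpha> \<in> one.bas.OF" "\<beta> \<in> one.bas.OF" "\<gamma> \<in> one.bas.OF"
  shows "pm.koszul_form (L1 \<alpha>) (L1 \<beta>) (L1 \<gamma>) m = wa m * pm1.koszul_form \<alpha> \<beta> \<gamma> (k1 m)"
  using assms
  by (simp add: pm.koszul_form_def pm1.koszul_form_def cometric_11 koszul_bracket_lift sharp_weighted
      algebra_simps)

text \<open>Every term contains a mixed cometric value, a bracket of lifts from different factors,
  or a derivative along the second factor of a weighted pullback from the first. All of these are
  zero.\<close>

lemma koszul_form_112:
  assumes "\<alpha> \<in> one.bas.OF" "\<beta> \<in> one.bas.OF" "\<gamma> \<in> two.bas.OF"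
  shows "pm.koszul_form (L1 \<alpha>) (L1 \<beta>) (L2 \<gamma>) m = 0"
  using assms
  by (simp add: pm.koszul_form_def cometric_11 cometric_12 koszul_bracket_lift
      pswap.koszul_bracket_lift_other sharp_weighted_other sharp_0 cometric_0)

lemma koszul_form_121:
  assumes "\<alpha> \<in> one.bas.OF" "\<beta> \<in> two.bas.OF" "\<gamma> \<in> one.bas.OF"
  shows "pm.koszul_form (L1 \<alpha>) (L2 \<beta>) (L1 \<gamma>) m = 0"
  using assms
  by (simp add: pm.koszul_form_def cometric_11 cometric_12 cometric_21 koszul_bracket_lift
      koszul_bracket_lift_other sharp_weighted_other sharp_0 cometric_0)

lemma koszul_form_122:
  assumes "\<alpha> \<in> one.bas.OF" "\<beta> \<in> two.bas.OF" "\<gamma> \<in> two.bas.OF"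
  shows "pm.koszul_form (L1 \<alpha>) (L2 \<beta>) (L2 \<gamma>) m = 0"
  using assms
  by (simp add: pm.koszul_form_def cometric_22 cometric_12 cometric_21 pswap.koszul_bracket_lift
      pswap.koszul_bracket_lift_other koszul_bracket_lift_other wswap.sharp_weighted_other sharp_0 cometric_0)

lemma D_eq_by_lifts:
  assumes "x \<in> OF" "y \<in> OF" "z \<in> OF"
    "\<And>\<gamma> m. \<gamma> \<in> one.bas.OF \<Longrightarrow> pm.koszul_form x y (L1 \<gamma>) m = 2 * pm.g z (L1 \<gamma>) m"
    "\<And>\<gamma> m. \<gamma> \<in> two.bas.OF \<Longrightarrow> pm.koszul_form x y (L2 \<gamma>) m = 2 * pm.g z (L2 \<gamma>) m"
  shows "pm.\<D> x y = z"
proof (rule pm.form_eq_cometricI)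
  show D: "pm.\<D> x y \<in> OF" using assms by simp
  show "z \<in> OF" by fact
  fix \<gamma> assume \<gamma>: "\<gamma> \<in> OF"
  note K = pm.levi_civita_koszul[OF pm.levi_civita assms(1,2)]
  show "pm.g (pm.\<D> x y) \<gamma> = pm.g z \<gamma>"
  proof (rule linear_eq_on_lifts[OF pm.cometric_linear2[OF D] pm.cometric_linear2[OF assms(3)] _ _ \<gamma>])
    show "pm.g (pm.\<D> x y) (L1 \<delta>) = pm.g z (L1 \<delta>)" if "\<delta> \<in> one.bas.OF" for \<delta>
    proof
      fix m show "pm.g (pm.\<D> x y) (L1 \<delta>) m = pm.g z (L1 \<delta>) m"
        using K[OF one.form_lift_form[OF that], of m] assms(4)[OF that, of m] by simp
    qed
    show "pm.g (pm.\<D> x y) (L2 \<delta>) = pm.g z (L2 \<delta>)" if "\<delta> \<in> two.bas.OF" for \<delta>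
    proof
      fix m show "pm.g (pm.\<D> x y) (L2 \<delta>) m = pm.g z (L2 \<delta>) m"
        using K[OF two.form_lift_form[OF that], of m] assms(5)[OF that, of m] by simp
    qed
  qed
qed

text \<open>The weight \<open>wa\<close> appears once on each side of the Koszul formula, so the
  connection of the factor solves it whatever the weight is.\<close>

lemma D_11:
  assumes "\<alpha> \<in> one.bas.OF" "\<beta> \<in> one.bas.OF"
  shows "pm.\<D> (L1 \<alpha>) (L1 \<beta>) = L1 (pm1.\<D> \<alpha> \<beta>)"
proof (rule D_eq_by_lifts)
  note D = pm1.D_form[OF assms]
  show "pm.koszul_form (L1 \<alpha>) (L1 \<beta>) (L1 \<gamma>) m = 2 * pm.g (L1 (pm1.\<D> \<alpha> \<beta>)) (L1 \<gamma>) m"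
    if "\<gamma> \<in> one.bas.OF" for \<gamma> m
    unfolding koszul_form_111[OF assms that] cometric_11[OF D that]
      pm1.levi_civita_koszul[OF pm1.levi_civita assms that, symmetric] by simp
  show "pm.koszul_form (L1 \<alpha>) (L1 \<beta>) (L2 \<gamma>) m = 2 * pm.g (L1 (pm1.\<D> \<alpha> \<beta>)) (L2 \<gamma>) m"
    if "\<gamma> \<in> two.bas.OF" for \<gamma> m
    unfolding koszul_form_112[OF assms that] cometric_12[OF D that] by simp
qed (use assms in simp_all)

lemma D_12:
  assumes "\<alpha> \<in> one.bas.OF" "\<beta> \<in> two.bas.OF"
  shows "pm.\<D> (L1 \<alpha>) (L2 \<beta>) = 0"
  by (rule D_eq_by_lifts)
    (use assms in \<open>simp_all add: koszul_form_121 koszul_form_122 cometric_0\<close>)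

end

section \<open>Curvature of the warped product\<close>

context warped_product
begin

lemmas D_21 = wswap.D_12 and D_22 = wswap.D_11

lemma curvature_111:
  assumes "\<alpha> \<in> one.bas.OF" "\<beta> \<in> one.bas.OF" "\<gamma> \<in> one.bas.OF"
  shows "pm.\<R> (L1 \<alpha>) (L1 \<beta>) (L1 \<gamma>) = L1 (pm1.\<R> \<alpha> \<beta> \<gamma>)"
  unfolding curvature_def
  using assms by (simp add: D_11 koszul_bracket_lift one.form_lift_diff
      del: minus_apply)

lemma curvature_122:
  assumes "\<alpha> \<in> one.bas.OF" "\<beta> \<in> two.bas.OF" "\<gamma> \<in> two.bas.OF"
  shows "pm.\<R> (L1 \<alpha>) (L2 \<beta>) (L2 \<gamma>) = 0"
  unfolding curvature_def
  using assms by (simp add: D_12 D_22 koszul_bracket_lift_other pm.D_0)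

lemma Rm_1111:
  assumes "\<alpha> \<in> one.bas.OF" "\<beta> \<in> one.bas.OF" "\<gamma> \<in> one.bas.OF" "\<delta> \<in> one.bas.OF"
  shows "pm.Rm (L1 \<alpha>) (L1 \<beta>) (L1 \<gamma>) (L1 \<delta>) m = wa m * pm1.Rm \<alpha> \<beta> \<gamma> \<delta> (k1 m)"
  using assms by (simp add: pm.Rm_def pm1.Rm_def curvature_111 cometric_11)

lemma Rm_1221:
  assumes "\<alpha> \<in> one.bas.OF" "\<beta> \<in> two.bas.OF"
  shows "pm.Rm (L1 \<alpha>) (L2 \<beta>) (L2 \<beta>) (L1 \<alpha>) = 0"
  using assms by (simp add: pm.Rm_def curvature_122 cometric_0)

lemma Rm_fscale:
  assumes "u \<in> C" "v \<in> C" "x \<in> OF" "y \<in> OF"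
  shows "pm.Rm (fscale u x) (fscale v y) (fscale v y) (fscale u x) m =
    u m * u m * (v m * v m) * pm.Rm x y y x m"
  using assms
    function_linear_fscale[OF pm.Rm_linear1, of "fscale v y" "fscale v y" "fscale u x" u x]
    function_linear_fscale[OF pm.Rm_linear2, of x "fscale v y" "fscale u x" v y]
    function_linear_fscale[OF pm.Rm_linear3, of x y "fscale u x" v y]
    function_linear_fscale[OF pm.Rm_linear4, of x y y u x]
  by (simp add: mult_ac)

end

lemma sum_lessThan_add: "(\<Sum>i<m + n. h i) = (\<Sum>i<m. h i) + (\<Sum>j<n. h (m + j))"
  for h :: "nat \<Rightarrow> 'x::comm_monoid_add"
  by (induction n) (simp_all add: add.assoc)

context warped_product
begin

lemma cometric_fscale_11:
  assumes "\<alpha> \<in> one.bas.OF" "\<beta> \<in> one.bas.OF"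
  shows "pm.g (fscale a (L1 \<alpha>)) (fscale a (L1 \<beta>)) m = pm1.g \<alpha> \<beta> (k1 m)"
proof -
  have "pm.g (fscale a (L1 \<alpha>)) (fscale a (L1 \<beta>)) m = a m * (a m * (wa m * pm1.g \<alpha> \<beta> (k1 m)))"
    using assms a_smooth by (simp add: pm.cometric_fscale1 pm.cometric_fscale2 cometric_11)
  then show ?thesis by (simp add: wa_cancel)
qed

lemma cometric_fscale_12:
  assumes "\<alpha> \<in> one.bas.OF" "\<beta> \<in> two.bas.OF"
  shows "pm.g (fscale a (L1 \<alpha>)) (fscale c (L2 \<beta>)) m = 0"
  using assms a_smooth c_smooth by (simp add: pm.cometric_fscale1 pm.cometric_fscale2 cometric_12)

text \<open>The four slots contribute the fourth power of \<open>a\<close>, while pairing with the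
  cometric contributes \<open>wa\<close>, its inverse square. The square of the warping function in
  the theorem originates here.\<close>

lemma Rm_fscale_1111:
  assumes "\<alpha> \<in> one.bas.OF" "\<beta> \<in> one.bas.OF"
  shows "pm.Rm (fscale a (L1 \<alpha>)) (fscale a (L1 \<beta>)) (fscale a (L1 \<beta>)) (fscale a (L1 \<alpha>)) m =
    (a m)\<^sup>2 * pm1.Rm \<alpha> \<beta> \<beta> \<alpha> (k1 m)"
  unfolding Rm_fscale[OF a_smooth a_smooth one.form_lift_form[OF assms(1)] one.form_lift_form[OF assms(2)]]
    Rm_1111[OF assms assms(2,1)]
  by (simp add: power2_eq_square mult.assoc wa_cancel)

lemma Rm_fscale_1221:
  assumes "\<alpha> \<in> one.bas.OF" "\<beta> \<in> two.bas.OF"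
  shows "pm.Rm (fscale a (L1 \<alpha>)) (fscale c (L2 \<beta>)) (fscale c (L2 \<beta>)) (fscale a (L1 \<alpha>)) m = 0"
  unfolding Rm_fscale[OF a_smooth c_smooth one.form_lift_form[OF assms(1)] two.form_lift_form[OF assms(2)]]
    Rm_1221[OF assms] by simp

end

context warped_product
begin

text \<open>Rescaled coframes of the two factors form a coframe of the total space with unchanged
  signs, and in this coframe the curvature sum splits into blocks.\<close>

theorem scalar_curvature_warped:
  "scalar_curvature M P pm.g m =
    (a m)\<^sup>2 * scalar_curvature N1 P1 pm1.g (k1 m) + (c m)\<^sup>2 * scalar_curvature N2 P2 pm2.g (k2 m)"
proof -
  let ?n1 = "DIM('e1)" and ?n2 = "DIM('e2)"
  obtain W1 \<eta> where on1: "k1 m \<in> W1" "pm1.coframe_on W1 \<eta>"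
    using pm1.coframe_exists[of "k1 m"] pm1.orthonormal_coframe_near_iff by blast
  obtain W2 \<zeta> where on2: "k2 m \<in> W2" "pm2.coframe_on W2 \<zeta>"
    using pm2.coframe_exists[of "k2 m"] pm2.orthonormal_coframe_near_iff by blast
  note e = pm1.coframe_onD[OF on1(2)] and z = pm2.coframe_onD[OF on2(2)]
  \<comment> \<open>The first \<open>?n1\<close> indices run through the coframe of the first
    factor, the remaining ones, shifted by \<open>?n1\<close>, through that of the second.\<close>
  define \<theta> where "\<theta> i = (if i < ?n1 then fscale a (L1 (\<eta> i)) else fscale c (L2 (\<zeta> (i - ?n1))))" for i
  have t1: "\<theta> i = fscale a (L1 (\<eta> i))" if "i < ?n1" for i using that by (simp add: \<theta>_def)
  have t2: "\<theta> (?n1 + i) = fscale c (L2 (\<zeta> i))" for i by (simp add: \<theta>_def)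
  let ?W = "k1 -` W1 \<inter> k2 -` W2"
  have g11: "pm.g (\<theta> i) (\<theta> j) q = pm1.g (\<eta> i) (\<eta> j) (k1 q)" if "i < ?n1" "j < ?n1" for i j q
    unfolding t1[OF that(1)] t1[OF that(2)] by (rule cometric_fscale_11[OF e(2) e(2)]) fact+
  have g22: "pm.g (\<theta> (?n1 + i)) (\<theta> (?n1 + j)) q = pm2.g (\<zeta> i) (\<zeta> j) (k2 q)"
    if "i < ?n2" "j < ?n2" for i j q
    unfolding t2 by (rule wswap.cometric_fscale_11[OF z(2) z(2)]) fact+
  have g12: "pm.g (\<theta> i) (\<theta> (?n1 + j)) q = 0" if "i < ?n1" "j < ?n2" for i j q
    unfolding t1[OF that(1)] t2 by (rule cometric_fscale_12[OF e(2) z(2)]) fact+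
  have g21: "pm.g (\<theta> (?n1 + j)) (\<theta> i) q = 0" if "i < ?n1" "j < ?n2" for i j q
    unfolding t1[OF that(1)] t2 by (rule wswap.cometric_fscale_12[OF z(2) e(2)]) fact+
  have tO: "\<theta> i \<in> OF" if "i < DIM('em)" for i
    using that dim_sum a_smooth c_smooth e(2) z(2) by (simp add: \<theta>_def)
  have split: "i < ?n1 \<or> (\<exists>i'<?n2. i = ?n1 + i')" if "i < DIM('em)" for i
  proof (cases "i < ?n1")
    case False
    then show ?thesis using that dim_sum by (intro disjI2 exI[of _ "i - ?n1"]) simp
  qed simp
  have on: "pm.coframe_on ?W \<theta>"
    unfolding pm.coframe_on_def
  proof (intro conjI ballI allI impI)
    show "open ?W" using one.k_open[OF e(1)] two.k_open[OF z(1)] by blast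
    show "\<theta> i \<in> OF" if "i < DIM('em)" for i by (rule tO[OF that])
    fix q i j assume q: "q \<in> ?W" and i: "i < DIM('em)" and j: "j < DIM('em)"
    have E: "if i = j then \<bar>pm1.g (\<eta> i) (\<eta> i) (k1 q)\<bar> = 1 else pm1.g (\<eta> i) (\<eta> j) (k1 q) = 0"
      if "i < ?n1" "j < ?n1" for i j
      using on1(2)[unfolded pm1.coframe_on_def, THEN conjunct2, THEN conjunct2, rule_format, of "k1 q" i j] q that
      by simp
    have Z: "if i = j then \<bar>pm2.g (\<zeta> i) (\<zeta> i) (k2 q)\<bar> = 1 else pm2.g (\<zeta> i) (\<zeta> j) (k2 q) = 0"
      if "i < ?n2" "j < ?n2" for i j
      using on2(2)[unfolded pm2.coframe_on_def, THEN conjunct2, THEN conjunct2, rule_format, of "k2 q" i j] q that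
      by simp
    show "if i = j then \<bar>pm.g (\<theta> i) (\<theta> i) q\<bar> = 1 else pm.g (\<theta> i) (\<theta> j) q = 0"
      using split[OF i]
    proof
      assume i1: "i < ?n1"
      from split[OF j] show ?thesis
      proof
        assume j1: "j < ?n1"
        show ?thesis unfolding g11[OF i1 j1] g11[OF i1 i1] by (rule E[OF i1 j1])
      next
        assume "\<exists>j'<?n2. j = ?n1 + j'"
        then obtain j' where j': "j' < ?n2" "j = ?n1 + j'" by blast
        show ?thesis unfolding j'(2) g12[OF i1 j'(1)] using i1 by simp
      qed
    next
      assume "\<exists>i'<?n2. i = ?n1 + i'"
      then obtain i' where i': "i' < ?n2" "i = ?n1 + i'" by blast
      from split[OF j] show ?thesis
      proof
        assume j1: "j < ?n1"
        show ?thesis unfolding i'(2) g21[OF j1 i'(1)] using j1 by simp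
      next
        assume "\<exists>j'<?n2. j = ?n1 + j'"
        then obtain j' where j': "j' < ?n2" "j = ?n1 + j'" by blast
        show ?thesis unfolding i'(2) j'(2) g22[OF i'(1) j'(1)] g22[OF i'(1) i'(1)]
          using Z[OF i'(1) j'(1)] by simp
      qed
    qed
  qed
  have mW: "m \<in> ?W" using on1 on2 by simp
  define T where "T i j = pm.g (\<theta> i) (\<theta> i) m * pm.g (\<theta> j) (\<theta> j) m * pm.Rm (\<theta> i) (\<theta> j) (\<theta> j) (\<theta> i) m"
    for i j
  have T11: "T i j = (a m)\<^sup>2 * (pm1.g (\<eta> i) (\<eta> i) (k1 m) * pm1.g (\<eta> j) (\<eta> j) (k1 m) *
      pm1.Rm (\<eta> i) (\<eta> j) (\<eta> j) (\<eta> i) (k1 m))" if ij: "i < ?n1" "j < ?n1" for i j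
    unfolding T_def g11[OF ij(1,1)] g11[OF ij(2,2)]
    unfolding t1[OF ij(1)] t1[OF ij(2)] Rm_fscale_1111[OF e(2)[OF ij(1)] e(2)[OF ij(2)]] by simp
  have T22: "T (?n1 + i) (?n1 + j) = (c m)\<^sup>2 * (pm2.g (\<zeta> i) (\<zeta> i) (k2 m) * pm2.g (\<zeta> j) (\<zeta> j) (k2 m) *
      pm2.Rm (\<zeta> i) (\<zeta> j) (\<zeta> j) (\<zeta> i) (k2 m))" if ij: "i < ?n2" "j < ?n2" for i j
    unfolding T_def g22[OF ij(1,1)] g22[OF ij(2,2)]
    unfolding t2 wswap.Rm_fscale_1111[OF z(2)[OF ij(1)] z(2)[OF ij(2)]] by simp
  have T12: "T i (?n1 + j) = 0" if ij: "i < ?n1" "j < ?n2" for i j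
    unfolding T_def t1[OF ij(1)] t2 Rm_fscale_1221[OF e(2)[OF ij(1)] z(2)[OF ij(2)]] by simp
  have T21: "T (?n1 + j) i = 0" if ij: "i < ?n1" "j < ?n2" for i j
    unfolding T_def t1[OF ij(1)] t2 wswap.Rm_fscale_1221[OF z(2)[OF ij(2)] e(2)[OF ij(1)]] by simp
  have "scalar_curvature M P pm.g m = (\<Sum>i<DIM('em). \<Sum>j<DIM('em). T i j)"
    unfolding T_def by (rule pm.scalar_curvature_eq[OF on mW])
  \<comment> \<open>The two mixed blocks vanish, since curvatures of planes spanned by one lift from
    each factor are zero.\<close>
  also have "\<dots> = (\<Sum>i<?n1. \<Sum>j<?n1. T i j) + (\<Sum>i<?n2. \<Sum>j<?n2. T (?n1 + i) (?n1 + j))"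
    unfolding dim_sum sum_lessThan_add by (simp add: T12 T21)
  also have "(\<Sum>i<?n1. \<Sum>j<?n1. T i j) = (a m)\<^sup>2 * scalar_curvature N1 P1 pm1.g (k1 m)"
    unfolding pm1.scalar_curvature_eq[OF on1(2,1)] sum_distrib_left
    by (intro sum.cong refl) (simp add: T11)
  also have "(\<Sum>i<?n2. \<Sum>j<?n2. T (?n1 + i) (?n1 + j)) = (c m)\<^sup>2 * scalar_curvature N2 P2 pm2.g (k2 m)"
    unfolding pm2.scalar_curvature_eq[OF on2(2,1)] sum_distrib_left
    by (intro sum.cong refl) (simp add: T22)
  finally show ?thesis .
qed

end

section \<open>Change of the warping function\<close>

context warped_product
begin

text \<open>Only the Levi-Civita connection enters the parallelism of the bivector field, and on lifts it
  does not depend on the weights.\<close>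

lemma parallel_transfer:
  assumes w': "warped_product M N1 k1 s1 N2 k2 s2 P1 P2 P G1 G2 G' a' c'"
    and par: "\<And>x y z. x \<in> OF \<Longrightarrow> y \<in> OF \<Longrightarrow> z \<in> OF \<Longrightarrow> pm.parallel_defect x y z = 0"
    and mem: "x \<in> OF" "y \<in> OF" "z \<in> OF"
  shows "poisson_metric.parallel_defect M G' P x y z = 0"
proof -
  interpret w': warped_product M N1 k1 s1 N2 k2 s2 P1 P2 P G1 G2 G' a' c' by (rule w')
  define lifts where "lifts = L1 ` one.bas.OF \<union> L2 ` two.bas.OF"
  have L: "x \<in> lifts \<Longrightarrow> x \<in> OF" for x by (auto simp: lifts_def)
  have D: "w'.pm.\<D> x y = pm.\<D> x y" if "x \<in> lifts" "y \<in> lifts" for x y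
    using that by (auto simp: lifts_def D_11 D_12 D_21 D_22 w'.D_11 w'.D_12 w'.D_21 w'.D_22)
  have 0: "w'.pm.parallel_defect x y z m = 0" if "x \<in> lifts" "y \<in> lifts" "z \<in> lifts" for x y z m
    using par[OF that[THEN L]] that
    by (simp add: w'.pm.parallel_defect_def pm.parallel_defect_def D fun_eq_iff)
  have zero: "A \<gamma> m = 0" if "function_linear C OF A" "\<And>x. x \<in> lifts \<Longrightarrow> A x m = 0" "\<gamma> \<in> OF" for A \<gamma> m
    by (rule linear_zero_on_lifts[OF that(1) _ _ that(3)]) (auto intro!: that(2) simp: lifts_def)
  note lin = w'.pm.parallel_defect_linear
  \<comment> \<open>The slots are freed one at a time, starting with the last, because linearity in
    one slot is used with the other two held fixed.\<close>
  have 1: "w'.pm.parallel_defect x y z m = 0" if "x \<in> lifts" "y \<in> lifts" "z \<in> OF" for x y z m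
    using zero[OF lin(3)[OF L[OF that(1)] L[OF that(2)] that(3)] 0[OF that(1,2)] that(3)] .
  have 2: "w'.pm.parallel_defect x y z m = 0" if "x \<in> lifts" "y \<in> OF" "z \<in> OF" for x y z m
    using zero[OF lin(2)[OF L[OF that(1)] that(2,3)] 1[OF that(1) _ that(3)] that(2)] .
  have 3: "w'.pm.parallel_defect x y z m = 0" for m
    using zero[OF lin(1)[OF mem] 2[OF _ mem(2,3)] mem(1)] .
  then show ?thesis by (simp add: fun_eq_iff)
qed

end

section \<open>The warped metric\<close>

context factor
begin

text \<open>Both arguments of \<open>G\<close> vary with \<open>m\<close>. Only the first is
  expanded in a frame; the second then enters through the lifts of the forms
  \<open>flat N G (E e)\<close>, whose smoothness is known.\<close>

lemma metric_push_smooth: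
  assumes G: "metric_manifold N G" and X: "X \<in> tot.VF" and Y: "Y \<in> tot.VF"
  shows "(\<lambda>m. G (push X m) (push Y m) (k m)) \<in> tot.C"
proof (rule tot.smooth_functionsI_local)
  interpret metric_manifold N G by (rule G)
  fix m0
  obtain W x E where W: "open W" "m0 \<in> W" "\<And>e. x e \<in> bas.C" "\<And>e::'en. E e \<in> bas.VF"
    "\<And>A m. function_linear bas.C bas.VF A \<Longrightarrow> m \<in> W \<Longrightarrow>
      A (push X m) (k m) = (\<Sum>e\<in>Basis. X (x e \<circ> k) m * A (E e) (k m))"
    by (rule push_expansion_local[OF X, of m0]) (rule that)
  let ?v = "\<Sum>e\<in>Basis. X (x e \<circ> k) * form_lift (flat N G (E e)) Y"
  have "?v \<in> tot.C"
    by (intro tot.smooth_functions_sum tot.smooth_functions_mult tot.vf_smooth[OF X] pull_smooth W(3)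
        tot.form_smooth[OF form_lift_form[OF flat_form[OF W(4)]] Y])
  moreover have "\<forall>m\<in>W. G (push X m) (push Y m) (k m) = ?v m"
  proof
    fix m assume m: "m \<in> W"
    have "G (push X m) (push Y m) (k m) = (\<Sum>e\<in>Basis. X (x e \<circ> k) m * G (E e) (push Y m) (k m))"
      by (rule W(5)[OF metric_linear1[OF push_VF[OF Y]] m])
    also have "\<dots> = ?v m"
      by (simp add: sum_fun_apply form_lift_apply[OF Y] flat_apply[OF push_VF[OF Y]])
    finally show "G (push X m) (push Y m) (k m) = ?v m" .
  qed
  ultimately show "\<exists>W v. open W \<and> m0 \<in> W \<and> v \<in> tot.C \<and> (\<forall>m\<in>W. G (push X m) (push Y m) (k m) = v m)"
    using W(1,2) by blast
qed

end

context complementary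
begin

text \<open>For nondegeneracy, \<open>X\<close> is tested against lifts from one factor at a time,
  on which the other summand of \<open>G\<close> vanishes. As \<open>f\<close> has no zeros, both
  components of \<open>X\<close> are null at the point, hence so is \<open>X\<close>.\<close>

lemma warped_pseudo_riemannian:
  assumes m1: "metric_manifold N1 G1" and m2: "metric_manifold N2 G2"
    and f: "f \<in> one.bas.C" "\<And>b. f b \<noteq> 0"
    and G: "\<And>X Y m. G X Y m = G1 (one.push X m) (one.push Y m) (k1 m) +
      (f (k1 m))\<^sup>2 * G2 (two.push X m) (two.push Y m) (k2 m)"
  shows "pseudo_riemannian_metric M G"
proof -
  interpret m1: metric_manifold N1 G1 by (rule m1)
  interpret m2: metric_manifold N2 G2 by (rule m2)
  have smooth: "G X Y \<in> C" if "X \<in> VF" "Y \<in> VF" for X Y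
  proof -
    have eq: "G X Y = (\<lambda>m. G1 (one.push X m) (one.push Y m) (k1 m)) +
        (f \<circ> k1) * (f \<circ> k1) * (\<lambda>m. G2 (two.push X m) (two.push Y m) (k2 m))"
      by (simp add: fun_eq_iff G power2_eq_square)
    show ?thesis
      unfolding eq
      by (intro one.tot.smooth_functions_add one.tot.smooth_functions_mult one.pull_smooth f(1)
          one.metric_push_smooth[OF m1 that] two.metric_push_smooth[OF m2 that])
  qed
  have add: "G (X + Y) Z = G X Z + G Y Z" if "X \<in> VF" "Y \<in> VF" "Z \<in> VF" for X Y Z
  proof
    fix m
    show "G (X + Y) Z m = (G X Z + G Y Z) m"
      using function_linear_add[OF m1.metric_linear1[OF one.push_VF[OF that(3)]]
          one.push_VF[OF that(1)] one.push_VF[OF that(2)], of m m m]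
        function_linear_add[OF m2.metric_linear1[OF two.push_VF[OF that(3)]]
          two.push_VF[OF that(1)] two.push_VF[OF that(2)], of m m m]
      by (simp add: G one.push_add two.push_add algebra_simps)
  qed
  have scl: "G (fscale u X) Y = u * G X Y" if "u \<in> C" "X \<in> VF" "Y \<in> VF" for u X Y
  proof
    fix m
    show "G (fscale u X) Y m = (u * G X Y) m"
      using function_linear_fscale[OF m1.metric_linear1[OF one.push_VF[OF that(3)]]
          one.slice_smooth[OF that(1)] one.push_VF[OF that(2)], of m m m]
        function_linear_fscale[OF m2.metric_linear1[OF two.push_VF[OF that(3)]]
          two.slice_smooth[OF that(1)] two.push_VF[OF that(2)], of m m m]
      by (simp add: G one.push_fscale two.push_fscale algebra_simps)
  qed
  have sym: "G X Y = G Y X" if "X \<in> VF" "Y \<in> VF" for X Y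
  proof
    fix m
    show "G X Y m = G Y X m"
      unfolding G m1.metric_sym[OF one.push_VF[OF that(1)] one.push_VF[OF that(2)]]
        m2.metric_sym[OF two.push_VF[OF that(1)] two.push_VF[OF that(2)]] ..
  qed
  have nd: "X u m = 0" if X: "X \<in> VF" and null: "\<forall>Y\<in>VF. G X Y m = 0" and u: "u \<in> C" for X u m
  proof -
    note p1 = one.push_VF[OF X, of m] and p2 = two.push_VF[OF X, of m]
    have 1: "one.push X m v (k1 m) = 0" if v: "v \<in> one.bas.C" for v
    proof (rule m1.metric_nondegenerate[OF p1 _ v])
      fix Y assume Y: "Y \<in> one.bas.VF"
      have "G2 (two.push X m) 0 = 0"
        by (rule two.bas.function_linear_0[OF m2.metric_linear2[OF p2] two.bas.VF_module])
      then show "G1 (one.push X m) Y (k1 m) = 0"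
        using null[rule_format, OF one.lift_VF[OF Y]] by (simp add: G one.push_lift[OF Y] push_lift_other[OF Y])
    qed
    have 2: "two.push X m v (k2 m) = 0" if v: "v \<in> two.bas.C" for v
    proof (rule m2.metric_nondegenerate[OF p2 _ v])
      fix Y assume Y: "Y \<in> two.bas.VF"
      have "G1 (one.push X m) 0 = 0"
        by (rule one.bas.function_linear_0[OF m1.metric_linear2[OF p1] one.bas.VF_module])
      then show "G2 (two.push X m) Y (k2 m) = 0"
        using null[rule_format, OF two.lift_VF[OF Y]] f(2)
        by (simp add: G two.push_lift[OF Y] swap.push_lift_other[OF Y])
    qed
    show ?thesis
      unfolding tangent_sum[OF X u, of m] 1[OF one.slice_smooth[OF u]] 2[OF two.slice_smooth[OF u]] by simp
  qed
  show ?thesis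
    unfolding pseudo_riemannian_metric_def
  proof (intro conjI ballI allI impI)
    show "G X Y = G Y X" if "X \<in> VF" "Y \<in> VF" for X Y by (rule sym[OF that])
  qed (rule smooth add scl nd; assumption)+
qed

end

section \<open>The product atlas\<close>

text \<open>The pair is the sum of its two axis components, each a composition of smooth maps with
  linear ones.\<close>

lemma smooth_on_prod_map:
  fixes h1 :: "'e::euclidean_space \<Rightarrow> 'e1::euclidean_space" and h2 :: "'f::euclidean_space \<Rightarrow> 'f1::euclidean_space"
  assumes "open S" "open T" "smooth_on S h1" "smooth_on T h2"
  shows "smooth_on (S \<times> T) (\<lambda>z. (h1 (fst z), h2 (snd z)))"
proof -
  note o = open_Times[OF assms(1,2)]
  have 1: "smooth_on (S \<times> T) (\<lambda>z. (h1 (fst z), 0 :: 'f1))"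
    by (rule smooth_on_compose[OF o open_UNIV _ smooth_on_linear[OF open_UNIV], of "\<lambda>z. h1 (fst z)" "\<lambda>x. (x, 0)"])
      (auto intro!: smooth_on_compose[OF o assms(1) smooth_on_linear[OF o] assms(3)] bounded_linear_fst
        bounded_linear_Pair bounded_linear_ident bounded_linear_zero)
  have 2: "smooth_on (S \<times> T) (\<lambda>z. (0 :: 'e1, h2 (snd z)))"
    by (rule smooth_on_compose[OF o open_UNIV _ smooth_on_linear[OF open_UNIV], of "\<lambda>z. h2 (snd z)" "\<lambda>x. (0, x)"])
      (auto intro!: smooth_on_compose[OF o assms(2) smooth_on_linear[OF o] assms(4)] bounded_linear_snd
        bounded_linear_Pair bounded_linear_ident bounded_linear_zero)
  show ?thesis using smooth_on_add[OF o 1 2] by simp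
qed

lemma smooth_on_Pair_left:
  fixes w :: "'f::euclidean_space"
  assumes "open S" shows "smooth_on S (\<lambda>x::'e::euclidean_space. (x, w))"
proof -
  have "smooth_on S (\<lambda>x::'e. (x, 0) + (0, w))"
    by (rule smooth_on_add[OF assms smooth_on_linear[OF assms] smooth_on_const[OF assms]])
      (intro bounded_linear_Pair bounded_linear_ident bounded_linear_zero)
  then show ?thesis by simp
qed

lemma smooth_on_Pair_right:
  fixes w :: "'f::euclidean_space"
  assumes "open S" shows "smooth_on S (\<lambda>x::'e::euclidean_space. (w, x))"
proof -
  have "smooth_on S (\<lambda>x::'e. (0, x) + (w, 0))"
    by (rule smooth_on_add[OF assms smooth_on_linear[OF assms] smooth_on_const[OF assms]])
      (intro bounded_linear_Pair bounded_linear_ident bounded_linear_zero)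
  then show ?thesis by simp
qed

lemma sum_Basis_prod:
  fixes h :: "'e::euclidean_space \<times> 'f::euclidean_space \<Rightarrow> real"
  shows "(\<Sum>b\<in>Basis. h b) = (\<Sum>e\<in>Basis. h (e, 0)) + (\<Sum>e\<in>Basis. h (0, e))"
proof -
  have "(\<Sum>b\<in>Basis. h b) = (\<Sum>b\<in>(\<lambda>u. (u, 0)) ` (Basis :: 'e set). h b) + (\<Sum>b\<in>(\<lambda>v. (0, v)) ` (Basis :: 'f set). h b)"
    unfolding Basis_prod_def by (rule sum.union_disjoint) auto
  then show ?thesis by (simp add: sum.reindex inj_on_def)
qed

lemma prod_chart_inv:
  assumes "inj_on \<phi> U" "inj_on \<psi> V" "x \<in> \<phi> ` U" "y \<in> \<psi> ` V"
  shows "inv_into (U \<times> V) (map_prod \<phi> \<psi>) (x, y) = (inv_into U \<phi> x, inv_into V \<psi> y)"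
proof (rule inv_into_f_eq)
  show "inj_on (map_prod \<phi> \<psi>) (U \<times> V)" using assms(1,2) by (auto simp: inj_on_def)
qed (use assms in \<open>auto simp: f_inv_into_f inv_into_into\<close>)

locale manifold_pair = B: manifold B + F: manifold F
  for B :: "('a::{second_countable_topology,t2_space}, 'e::euclidean_space) atlas"
    and F :: "('b::{second_countable_topology,t2_space}, 'f::euclidean_space) atlas"
begin

abbreviation "M \<equiv> prod_atlas B F"

lemma prod_chart:
  assumes U: "(U, \<phi>) \<in> B" and V: "(V, \<psi>) \<in> F"
  shows "(U \<times> V, map_prod \<phi> \<psi>) \<in> M" "map_prod \<phi> \<psi> ` (U \<times> V) = \<phi> ` U \<times> \<psi> ` V"
    "open (\<phi> ` U \<times> \<psi> ` V)"
    "x \<in> \<phi> ` U \<Longrightarrow> y \<in> \<psi> ` V \<Longrightarrow>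
      inv_into (U \<times> V) (map_prod \<phi> \<psi>) (x, y) = (inv_into U \<phi> x, inv_into V \<psi> y)"
  using assms prod_chart_inv[OF B.chart_inj[OF U] F.chart_inj[OF V]]
  by (auto simp: prod_atlas_def intro!: open_Times B.chart_homeo(2)[OF U] F.chart_homeo(2)[OF V])

lemma prod_transition:
  assumes U: "(U, \<phi>) \<in> B" and V: "(V, \<psi>) \<in> F" and U': "(U', \<phi>') \<in> B" and V': "(V', \<psi>') \<in> F"
  shows "smooth_on (map_prod \<phi> \<psi> ` (U \<times> V \<inter> U' \<times> V')) (map_prod \<phi>' \<psi>' \<circ> inv_into (U \<times> V) (map_prod \<phi> \<psi>))"
proof -
  let ?S = "\<phi> ` (U \<inter> U')" and ?T = "\<psi> ` (V \<inter> V')"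
  have o: "open ?S" "open ?T"
    using B.chart_open_image[OF U, of "U \<inter> U'"] F.chart_open_image[OF V, of "V \<inter> V'"]
      B.chart_homeo(1)[OF U] B.chart_homeo(1)[OF U'] F.chart_homeo(1)[OF V] F.chart_homeo(1)[OF V'] by auto
  have im: "map_prod \<phi> \<psi> ` (U \<times> V \<inter> U' \<times> V') = ?S \<times> ?T" by force
  show ?thesis
    unfolding im
  proof (rule smooth_on_cong[OF open_Times[OF o]])
    show "smooth_on (?S \<times> ?T) (\<lambda>z. ((\<phi>' \<circ> inv_into U \<phi>) (fst z), (\<psi>' \<circ> inv_into V \<psi>) (snd z)))"
      by (rule smooth_on_prod_map[OF o B.transition_smooth[OF U U'] F.transition_smooth[OF V V']])
    show "((\<phi>' \<circ> inv_into U \<phi>) (fst z), (\<psi>' \<circ> inv_into V \<psi>) (snd z)) =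
        (map_prod \<phi>' \<psi>' \<circ> inv_into (U \<times> V) (map_prod \<phi> \<psi>)) z" if "z \<in> ?S \<times> ?T" for z
    proof -
      obtain x y where z: "z = (x, y)" "x \<in> \<phi> ` U" "y \<in> \<psi> ` V" using \<open>z \<in> ?S \<times> ?T\<close> by auto
      show ?thesis using prod_chart(4)[OF U V z(2,3)] by (simp add: z(1))
    qed
  qed
qed

lemma prod_smooth_manifold: "smooth_manifold M"
  unfolding smooth_manifold_def
proof (intro conjI)
  show "(\<Union>(U, \<phi>)\<in>M. U) = UNIV"
  proof (rule UNIV_eq_I[symmetric])
    fix m :: "'a \<times> 'b"
    obtain U \<phi> V \<psi> where "(U, \<phi>) \<in> B" "fst m \<in> U" "(V, \<psi>) \<in> F" "snd m \<in> V"
      using B.chart_at F.chart_at by metis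
    then show "m \<in> (\<Union>(U, \<phi>)\<in>M. U)"
      using prod_chart(1)[of U \<phi> V \<psi>] by (intro UN_I[of "(U \<times> V, map_prod \<phi> \<psi>)"]) (auto simp: mem_Times_iff)
  qed
  show "\<forall>(W, \<kappa>)\<in>M. open W \<and> open (\<kappa> ` W) \<and> (\<exists>\<kappa>'. homeomorphism W (\<kappa> ` W) \<kappa> \<kappa>')"
  proof (clarify, unfold prod_atlas_def, clarify)
    fix U \<phi> V \<psi> assume U: "(U, \<phi>) \<in> B" and V: "(V, \<psi>) \<in> F"
    have "homeomorphism (U \<times> V) (map_prod \<phi> \<psi> ` (U \<times> V)) (map_prod \<phi> \<psi>) (map_prod (inv_into U \<phi>) (inv_into V \<psi>))"
    proof (rule homeomorphismI)
      show "continuous_on (U \<times> V) (map_prod \<phi> \<psi>)"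
        unfolding map_prod_def split_beta
        by (intro continuous_intros continuous_on_compose2[OF B.chart_continuous(1)[OF U]]
            continuous_on_compose2[OF F.chart_continuous(1)[OF V]]) auto
      show "continuous_on (map_prod \<phi> \<psi> ` (U \<times> V)) (map_prod (inv_into U \<phi>) (inv_into V \<psi>))"
        unfolding prod_chart(2)[OF U V] unfolding map_prod_def split_beta
        by (intro continuous_intros continuous_on_compose2[OF B.chart_continuous(2)[OF U]]
            continuous_on_compose2[OF F.chart_continuous(2)[OF V]]) auto
    qed (auto simp: B.chart_inv[OF U] F.chart_inv[OF V])
    then show "open (U \<times> V) \<and> open (map_prod \<phi> \<psi> ` (U \<times> V)) \<and>
        (\<exists>\<kappa>'. homeomorphism (U \<times> V) (map_prod \<phi> \<psi> ` (U \<times> V)) (map_prod \<phi> \<psi>) \<kappa>')"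
      using open_Times[OF B.chart_homeo(1)[OF U] F.chart_homeo(1)[OF V]] prod_chart(2,3)[OF U V] by auto
  qed
  show "\<forall>(U, \<phi>)\<in>M. \<forall>(V, \<psi>)\<in>M. smooth_on (\<phi> ` (U \<inter> V)) (\<psi> \<circ> inv_into U \<phi>)"
    using prod_transition by (auto simp: prod_atlas_def)
qed

end

sublocale manifold_pair \<subseteq> M: manifold "prod_atlas B F"
  by unfold_locales (rule prod_smooth_manifold)

context manifold_pair
begin

abbreviation "slice1 \<equiv> \<lambda>m b. (b, snd m)"
abbreviation "slice2 \<equiv> \<lambda>m w. (fst m, w)"

lemma prod_smooth_chart:
  assumes u: "u \<in> M.C" and U: "(U, \<phi>) \<in> B" and V: "(V, \<psi>) \<in> F"
  shows "smooth_on (\<phi> ` U \<times> \<psi> ` V) (u \<circ> inv_into (U \<times> V) (map_prod \<phi> \<psi>))"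
  using M.smooth_functions_chart[OF prod_chart(1)[OF U V] u] prod_chart(2)[OF U V] by simp

lemma pull_fst: assumes u: "u \<in> B.C" shows "u \<circ> fst \<in> M.C"
  unfolding smooth_functions_def
proof (clarify, unfold prod_atlas_def, clarify)
  fix U \<phi> V \<psi> assume U: "(U, \<phi>) \<in> B" and V: "(V, \<psi>) \<in> F"
  note p = prod_chart[OF U V]
  have "smooth_on (\<phi> ` U \<times> \<psi> ` V) (\<lambda>z. (u \<circ> inv_into U \<phi>) (fst z))"
    by (rule smooth_on_compose[OF p(3) B.chart_homeo(2)[OF U] smooth_on_linear[OF p(3) bounded_linear_fst]
          B.smooth_functions_chart[OF U u]]) auto
  then show "smooth_on (map_prod \<phi> \<psi> ` (U \<times> V)) (u \<circ> fst \<circ> inv_into (U \<times> V) (map_prod \<phi> \<psi>))"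
    unfolding p(2) by (rule smooth_on_cong[OF p(3), rotated]) (auto simp: p(4))
qed

lemma pull_snd: assumes u: "u \<in> F.C" shows "u \<circ> snd \<in> M.C"
  unfolding smooth_functions_def
proof (clarify, unfold prod_atlas_def, clarify)
  fix U \<phi> V \<psi> assume U: "(U, \<phi>) \<in> B" and V: "(V, \<psi>) \<in> F"
  note p = prod_chart[OF U V]
  have "smooth_on (\<phi> ` U \<times> \<psi> ` V) (\<lambda>z. (u \<circ> inv_into V \<psi>) (snd z))"
    by (rule smooth_on_compose[OF p(3) F.chart_homeo(2)[OF V] smooth_on_linear[OF p(3) bounded_linear_snd]
          F.smooth_functions_chart[OF V u]]) auto
  then show "smooth_on (map_prod \<phi> \<psi> ` (U \<times> V)) (u \<circ> snd \<circ> inv_into (U \<times> V) (map_prod \<phi> \<psi>))"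
    unfolding p(2) by (rule smooth_on_cong[OF p(3), rotated]) (auto simp: p(4))
qed

lemma slice1_smooth: assumes u: "u \<in> M.C" shows "u \<circ> slice1 m \<in> B.C"
  unfolding smooth_functions_def
proof clarify
  fix U \<phi> assume U: "(U, \<phi>) \<in> B"
  obtain V \<psi> where V: "(V, \<psi>) \<in> F" "snd m \<in> V" using F.chart_at by blast
  note oU = B.chart_homeo(2)[OF U]
  have "smooth_on (\<phi> ` U) (\<lambda>x. (u \<circ> inv_into (U \<times> V) (map_prod \<phi> \<psi>)) (x, \<psi> (snd m)))"
    by (rule smooth_on_compose[OF oU prod_chart(3)[OF U V(1)] smooth_on_Pair_left[OF oU]
          prod_smooth_chart[OF u U V(1)]]) (use V in auto)
  then show "smooth_on (\<phi> ` U) (u \<circ> slice1 m \<circ> inv_into U \<phi>)"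
    by (rule smooth_on_cong[OF oU, rotated]) (use V in \<open>simp add: prod_chart(4)[OF U V(1)] F.chart_inv[OF V(1)]\<close>)
qed

lemma slice2_smooth: assumes u: "u \<in> M.C" shows "u \<circ> slice2 m \<in> F.C"
  unfolding smooth_functions_def
proof clarify
  fix V \<psi> assume V: "(V, \<psi>) \<in> F"
  obtain U \<phi> where U: "(U, \<phi>) \<in> B" "fst m \<in> U" using B.chart_at by blast
  note oV = F.chart_homeo(2)[OF V]
  have "smooth_on (\<psi> ` V) (\<lambda>y. (u \<circ> inv_into (U \<times> V) (map_prod \<phi> \<psi>)) (\<phi> (fst m), y))"
    by (rule smooth_on_compose[OF oV prod_chart(3)[OF U(1) V] smooth_on_Pair_right[OF oV]
          prod_smooth_chart[OF u U(1) V]]) (use U in auto)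
  then show "smooth_on (\<psi> ` V) (u \<circ> slice2 m \<circ> inv_into V \<psi>)"
    by (rule smooth_on_cong[OF oV, rotated]) (use U in \<open>simp add: prod_chart(4)[OF U(1) V] B.chart_inv[OF U(1)]\<close>)
qed

text \<open>In a product chart a slice is an affine embedding with derivative
  \<open>h \<mapsto> (h, 0)\<close> or \<open>h \<mapsto> (0, h)\<close>, so this is the chain
  rule.\<close>

lemma partial_derivatives:
  assumes u: "u \<in> M.C" and U: "(U, \<phi>) \<in> B" and V: "(V, \<psi>) \<in> F" and m: "fst m \<in> U" "snd m \<in> V"
  defines "D \<equiv> frechet_derivative (u \<circ> inv_into (U \<times> V) (map_prod \<phi> \<psi>)) (at (map_prod \<phi> \<psi> m))"
  shows "frechet_derivative (u \<circ> slice1 m \<circ> inv_into U \<phi>) (at (\<phi> (fst m))) e = D (e, 0)"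
    and "frechet_derivative (u \<circ> slice2 m \<circ> inv_into V \<psi>) (at (\<psi> (snd m))) e' = D (0, e')"
proof -
  note p = prod_chart[OF U V]
  have mm: "map_prod \<phi> \<psi> m = (\<phi> (fst m), \<psi> (snd m))" by (simp add: map_prod_def split_beta)
  have D: "(u \<circ> inv_into (U \<times> V) (map_prod \<phi> \<psi>) has_derivative D) (at (\<phi> (fst m), \<psi> (snd m)))"
    unfolding D_def mm
    by (rule smooth_on_has_derivative[OF p(3) prod_smooth_chart[OF u U V]]) (use m in auto)
  have "((\<lambda>x. (x, \<psi> (snd m))) has_derivative (\<lambda>h. (h, 0))) (at (\<phi> (fst m)))"
    by (intro has_derivative_Pair has_derivative_ident has_derivative_const)
  from has_derivative_compose[OF this D]
  have "(u \<circ> slice1 m \<circ> inv_into U \<phi> has_derivative (\<lambda>h. D (h, 0))) (at (\<phi> (fst m)))"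
    by (rule has_derivative_transform_within_open[OF _ B.chart_homeo(2)[OF U]])
      (use m in \<open>auto simp: p(4) F.chart_inv[OF V]\<close>)
  from frechet_derivative_at[OF this, symmetric]
  show "frechet_derivative (u \<circ> slice1 m \<circ> inv_into U \<phi>) (at (\<phi> (fst m))) e = D (e, 0)" by simp
  have "((\<lambda>y. (\<phi> (fst m), y)) has_derivative (\<lambda>h. (0, h))) (at (\<psi> (snd m)))"
    by (intro has_derivative_Pair has_derivative_ident has_derivative_const)
  from has_derivative_compose[OF this D]
  have "(u \<circ> slice2 m \<circ> inv_into V \<psi> has_derivative (\<lambda>h. D (0, h))) (at (\<psi> (snd m)))"
    by (rule has_derivative_transform_within_open[OF _ F.chart_homeo(2)[OF V]])
      (use m in \<open>auto simp: p(4) B.chart_inv[OF U]\<close>)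
  from frechet_derivative_at[OF this, symmetric]
  show "frechet_derivative (u \<circ> slice2 m \<circ> inv_into V \<psi>) (at (\<psi> (snd m))) e' = D (0, e')" by simp
qed

text \<open>Three frames over one neighbourhood, those of two factor charts and of their product
  chart, with the relations between them. Objects that vary with the slice can thereby be expressed
  by fixed smooth functions on the product.\<close>

definition adapted_frames ::
  "('a \<times> 'b) set \<Rightarrow> ('e \<Rightarrow> 'a \<Rightarrow> real) \<Rightarrow> ('e \<Rightarrow> 'a vfield) \<Rightarrow> ('f \<Rightarrow> 'b \<Rightarrow> real) \<Rightarrow> ('f \<Rightarrow> 'b vfield) \<Rightarrow>
    ('e \<times> 'f \<Rightarrow> 'a \<times> 'b \<Rightarrow> real) \<Rightarrow> ('e \<times> 'f \<Rightarrow> ('a \<times> 'b) vfield) \<Rightarrow> bool" where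
  "adapted_frames W x E y H z K \<longleftrightarrow> open W \<and> (\<forall>e. z e \<in> M.C) \<and> (\<forall>e. K e \<in> M.VF) \<and>
    (\<forall>e. x e \<in> B.C) \<and> (\<forall>e. y e \<in> F.C) \<and>
    (\<forall>m\<in>W. \<forall>e e'. z (e, 0) m = x e (fst m) \<and> z (0, e') m = y e' (snd m)) \<and>
    (\<forall>m\<in>W. \<forall>u\<in>M.C. \<forall>e e'. K (e, 0) u m = E e (u \<circ> slice1 m) (fst m) \<and>
      K (0, e') u m = H e' (u \<circ> slice2 m) (snd m)) \<and>
    (\<forall>m\<in>W. \<forall>X\<in>M.VF. \<forall>u\<in>M.C. X u m = (\<Sum>e\<in>Basis. X (z e) m * K e u m)) \<and>
    (\<forall>m\<in>W. \<forall>X\<in>B.VF. \<forall>u\<in>B.C. X u (fst m) = (\<Sum>e\<in>Basis. X (x e) (fst m) * E e u (fst m))) \<and>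
    (\<forall>m\<in>W. \<forall>X\<in>F.VF. \<forall>u\<in>F.C. X u (snd m) = (\<Sum>e\<in>Basis. X (y e) (snd m) * H e u (snd m)))"

lemma adapted_frames_exist:
  obtains W x E y H z K where "m \<in> W" "adapted_frames W x E y H z K"
proof -
  obtain U \<phi> where U: "(U, \<phi>) \<in> B" "fst m \<in> U" using B.chart_at by blast
  obtain V \<psi> where V: "(V, \<psi>) \<in> F" "snd m \<in> V" using F.chart_at by blast
  have UV: "m \<in> U \<times> V" using U V by (simp add: mem_Times_iff)
  have oM: "open (U \<times> V)" by (rule open_Times[OF B.chart_homeo(1)[OF U(1)] F.chart_homeo(1)[OF V(1)]])
  show thesis
  proof (rule B.chart_frame[OF U(1) B.chart_homeo(1)[OF U(1)] U(2) order_refl],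
      rule F.chart_frame[OF V(1) F.chart_homeo(1)[OF V(1)] V(2) order_refl],
      rule M.chart_frame[OF prod_chart(1)[OF U(1) V(1)] oM UV order_refl])
    fix x :: "'e \<Rightarrow> 'a \<Rightarrow> real" and E W1 and y :: "'f \<Rightarrow> 'b \<Rightarrow> real" and H W2
      and z :: "'e \<times> 'f \<Rightarrow> 'a \<times> 'b \<Rightarrow> real" and K W3
    assume b: "open W1" "fst m \<in> W1" "W1 \<subseteq> U" "\<And>e. x e \<in> B.C" "\<And>e. E e \<in> B.VF"
      "\<And>e q. q \<in> W1 \<Longrightarrow> x e q = \<phi> q \<bullet> e"
      "\<And>e q u. q \<in> W1 \<Longrightarrow> u \<in> B.C \<Longrightarrow> E e u q = frechet_derivative (u \<circ> inv_into U \<phi>) (at (\<phi> q)) e"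
      "\<And>e e' q. q \<in> W1 \<Longrightarrow> E e (x e') q = e \<bullet> e'"
      "\<And>X u q. X \<in> B.VF \<Longrightarrow> u \<in> B.C \<Longrightarrow> q \<in> W1 \<Longrightarrow> X u q = (\<Sum>e\<in>Basis. X (x e) q * E e u q)"
    assume f: "open W2" "snd m \<in> W2" "W2 \<subseteq> V" "\<And>e. y e \<in> F.C" "\<And>e. H e \<in> F.VF"
      "\<And>e q. q \<in> W2 \<Longrightarrow> y e q = \<psi> q \<bullet> e"
      "\<And>e q u. q \<in> W2 \<Longrightarrow> u \<in> F.C \<Longrightarrow> H e u q = frechet_derivative (u \<circ> inv_into V \<psi>) (at (\<psi> q)) e"
      "\<And>e e' q. q \<in> W2 \<Longrightarrow> H e (y e') q = e \<bullet> e'"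
      "\<And>X u q. X \<in> F.VF \<Longrightarrow> u \<in> F.C \<Longrightarrow> q \<in> W2 \<Longrightarrow> X u q = (\<Sum>e\<in>Basis. X (y e) q * H e u q)"
    assume t: "open W3" "m \<in> W3" "W3 \<subseteq> U \<times> V" "\<And>e. z e \<in> M.C" "\<And>e. K e \<in> M.VF"
      "\<And>e q. q \<in> W3 \<Longrightarrow> z e q = map_prod \<phi> \<psi> q \<bullet> e"
      "\<And>e q u. q \<in> W3 \<Longrightarrow> u \<in> M.C \<Longrightarrow>
        K e u q = frechet_derivative (u \<circ> inv_into (U \<times> V) (map_prod \<phi> \<psi>)) (at (map_prod \<phi> \<psi> q)) e"
      "\<And>e e' q. q \<in> W3 \<Longrightarrow> K e (z e') q = e \<bullet> e'"
      "\<And>X u q. X \<in> M.VF \<Longrightarrow> u \<in> M.C \<Longrightarrow> q \<in> W3 \<Longrightarrow> X u q = (\<Sum>e\<in>Basis. X (z e) q * K e u q)"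
    let ?W = "W3 \<inter> W1 \<times> W2"
    have W: "q \<in> W3" "fst q \<in> W1" "snd q \<in> W2" "fst q \<in> U" "snd q \<in> V" if "q \<in> ?W" for q
      using that b(3) f(3) by (auto simp: mem_Times_iff)
    have "adapted_frames ?W x E y H z K"
      unfolding adapted_frames_def
    proof (intro conjI ballI allI)
      show "open ?W" using t(1) open_Times[OF b(1) f(1)] by blast
      fix q assume q: "q \<in> ?W"
      note W = W[OF q]
      show "z (e, 0) q = x e (fst q)" for e
        unfolding t(6)[OF W(1)] b(6)[OF W(2)] by (cases q) simp
      show "z (0, e) q = y e (snd q)" for e
        unfolding t(6)[OF W(1)] f(6)[OF W(3)] by (cases q) simp
      show "K (e, 0) u q = E e (u \<circ> slice1 q) (fst q)" if "u \<in> M.C" for e u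
        unfolding t(7)[OF W(1) that] b(7)[OF W(2) slice1_smooth[OF that]]
          partial_derivatives(1)[OF that U(1) V(1) W(4,5)] ..
      show "K (0, e) u q = H e (u \<circ> slice2 q) (snd q)" if "u \<in> M.C" for e u
        unfolding t(7)[OF W(1) that] f(7)[OF W(3) slice2_smooth[OF that]]
          partial_derivatives(2)[OF that U(1) V(1) W(4,5)] ..
      show "X u q = (\<Sum>e\<in>Basis. X (z e) q * K e u q)" if "X \<in> M.VF" "u \<in> M.C" for X u
        by (rule t(9)[OF that W(1)])
      show "X u (fst q) = (\<Sum>e\<in>Basis. X (x e) (fst q) * E e u (fst q))" if "X \<in> B.VF" "u \<in> B.C" for X u
        by (rule b(9)[OF that W(2)])
      show "X u (snd q) = (\<Sum>e\<in>Basis. X (y e) (snd q) * H e u (snd q))" if "X \<in> F.VF" "u \<in> F.C" for X u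
        by (rule f(9)[OF that W(3)])
    qed (rule b(4) f(4) t(4) t(5))+
    moreover have "m \<in> ?W" using b(2) f(2) t(2) by (simp add: mem_Times_iff)
    ultimately show thesis by (intro that)
  qed
qed

lemma adapted_framesD:
  assumes "adapted_frames W x E y H z K"
  shows "open W" "z ez \<in> M.C" "K ez \<in> M.VF" "x e \<in> B.C" "y e' \<in> F.C"
    "m \<in> W \<Longrightarrow> z (e, 0) m = x e (fst m)" "m \<in> W \<Longrightarrow> z (0, e') m = y e' (snd m)"
    "m \<in> W \<Longrightarrow> u \<in> M.C \<Longrightarrow> K (e, 0) u m = E e (u \<circ> slice1 m) (fst m)"
    "m \<in> W \<Longrightarrow> u \<in> M.C \<Longrightarrow> K (0, e') u m = H e' (u \<circ> slice2 m) (snd m)"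
    "m \<in> W \<Longrightarrow> X \<in> M.VF \<Longrightarrow> u \<in> M.C \<Longrightarrow> X u m = (\<Sum>e\<in>Basis. X (z e) m * K e u m)"
    "m \<in> W \<Longrightarrow> Y \<in> B.VF \<Longrightarrow> v \<in> B.C \<Longrightarrow> Y v (fst m) = (\<Sum>e\<in>Basis. Y (x e) (fst m) * E e v (fst m))"
    "m \<in> W \<Longrightarrow> Z \<in> F.VF \<Longrightarrow> w \<in> F.C \<Longrightarrow> Z w (snd m) = (\<Sum>e\<in>Basis. Z (y e) (snd m) * H e w (snd m))"
proof -
  note a = assms[unfolded adapted_frames_def]
  note a1 = a[THEN conjunct2] note a2 = a1[THEN conjunct2] note a3 = a2[THEN conjunct2]
  note a4 = a3[THEN conjunct2] note a5 = a4[THEN conjunct2] note a6 = a5[THEN conjunct2]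
  note a7 = a6[THEN conjunct2] note a8 = a7[THEN conjunct2] note a9 = a8[THEN conjunct2]
  show "open W" by (rule a[THEN conjunct1])
  show "z ez \<in> M.C" by (rule a1[THEN conjunct1, rule_format])
  show "K ez \<in> M.VF" by (rule a2[THEN conjunct1, rule_format])
  show "x e \<in> B.C" by (rule a3[THEN conjunct1, rule_format])
  show "y e' \<in> F.C" by (rule a4[THEN conjunct1, rule_format])
  show "m \<in> W \<Longrightarrow> z (e, 0) m = x e (fst m)" by (rule a5[THEN conjunct1, rule_format, THEN conjunct1])
  show "m \<in> W \<Longrightarrow> z (0, e') m = y e' (snd m)" by (rule a5[THEN conjunct1, rule_format, THEN conjunct2])
  show "m \<in> W \<Longrightarrow> u \<in> M.C \<Longrightarrow> K (e, 0) u m = E e (u \<circ> slice1 m) (fst m)"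
    by (rule a6[THEN conjunct1, rule_format, THEN conjunct1])
  show "m \<in> W \<Longrightarrow> u \<in> M.C \<Longrightarrow> K (0, e') u m = H e' (u \<circ> slice2 m) (snd m)"
    by (rule a6[THEN conjunct1, rule_format, THEN conjunct2])
  show "m \<in> W \<Longrightarrow> X \<in> M.VF \<Longrightarrow> u \<in> M.C \<Longrightarrow> X u m = (\<Sum>e\<in>Basis. X (z e) m * K e u m)"
    by (rule a7[THEN conjunct1, rule_format])
  show "m \<in> W \<Longrightarrow> Y \<in> B.VF \<Longrightarrow> v \<in> B.C \<Longrightarrow> Y v (fst m) = (\<Sum>e\<in>Basis. Y (x e) (fst m) * E e v (fst m))"
    by (rule a8[THEN conjunct1, rule_format])
  show "m \<in> W \<Longrightarrow> Z \<in> F.VF \<Longrightarrow> w \<in> F.C \<Longrightarrow> Z w (snd m) = (\<Sum>e\<in>Basis. Z (y e) (snd m) * H e w (snd m))"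
    by (rule a9[rule_format])
qed

text \<open>The function to which \<open>X\<close> is applied changes with \<open>m\<close>. After
  expanding \<open>X\<close> in the base frame, the derivatives of the slices are values of the
  fixed field \<open>K (e, 0)\<close> on \<open>u\<close>, hence smooth on the product.\<close>

lemma lift1_smooth:
  assumes X: "X \<in> B.VF" and u: "u \<in> M.C"
  shows "(\<lambda>m. X (u \<circ> slice1 m) (fst m)) \<in> M.C"
proof (rule M.smooth_functionsI_local)
  fix m0
  obtain W x E y H z K where m0: "m0 \<in> W" and fr: "adapted_frames W x E y H z K"
    using adapted_frames_exist .
  note d = adapted_framesD[OF fr]
  let ?v = "\<Sum>e\<in>Basis. (X (x e) \<circ> fst) * K (e, 0) u"
  have "?v \<in> M.C"
    by (intro M.smooth_functions_sum M.smooth_functions_mult pull_fst B.vf_smooth[OF X] d(4)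
        M.vf_smooth[OF d(3) u])
  moreover have "X (u \<circ> slice1 m) (fst m) = ?v m" if "m \<in> W" for m
    unfolding d(11)[OF that X slice1_smooth[OF u]] by (simp add: sum_fun_apply d(8)[OF that u])
  ultimately show "\<exists>W v. open W \<and> m0 \<in> W \<and> v \<in> M.C \<and> (\<forall>q\<in>W. X (u \<circ> slice1 q) (fst q) = v q)"
    using d(1) m0 by blast
qed

lemma lift2_smooth:
  assumes X: "X \<in> F.VF" and u: "u \<in> M.C"
  shows "(\<lambda>m. X (u \<circ> slice2 m) (snd m)) \<in> M.C"
proof (rule M.smooth_functionsI_local)
  fix m0
  obtain W x E y H z K where m0: "m0 \<in> W" and fr: "adapted_frames W x E y H z K"
    using adapted_frames_exist .
  note d = adapted_framesD[OF fr]
  let ?v = "\<Sum>e\<in>Basis. (X (y e) \<circ> snd) * K (0, e) u"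
  have "?v \<in> M.C"
    by (intro M.smooth_functions_sum M.smooth_functions_mult pull_snd F.vf_smooth[OF X] d(5)
        M.vf_smooth[OF d(3) u])
  moreover have "X (u \<circ> slice2 m) (snd m) = ?v m" if "m \<in> W" for m
    unfolding d(12)[OF that X slice2_smooth[OF u]] by (simp add: sum_fun_apply d(9)[OF that u])
  ultimately show "\<exists>W v. open W \<and> m0 \<in> W \<and> v \<in> M.C \<and> (\<forall>q\<in>W. X (u \<circ> slice2 q) (snd q) = v q)"
    using d(1) m0 by blast
qed

end

sublocale manifold_pair \<subseteq> one: factor "prod_atlas B F" B fst "\<lambda>m b. (b, snd m)"
  by unfold_locales (auto simp: pull_fst slice1_smooth lift1_smooth fst_vimage_eq_Times intro: open_Times)

sublocale manifold_pair \<subseteq> two: factor "prod_atlas B F" F snd "\<lambda>m w. (fst m, w)"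
  by unfold_locales (auto simp: pull_snd slice2_smooth lift2_smooth snd_vimage_eq_Times intro: open_Times)

text \<open>The basis of the model space splits into the bases of its two factors, and in the
  adapted frames the two partial sums are the slice components of \<open>X\<close>.\<close>

lemma (in manifold_pair) prod_tangent_sum:
  assumes X: "X \<in> M.VF" and u: "u \<in> M.C"
  shows "X u m = one.push X m (u \<circ> slice1 m) (fst m) + two.push X m (u \<circ> slice2 m) (snd m)"
proof -
  obtain W x E y H z K where m: "m \<in> W" and fr: "adapted_frames W x E y H z K"
    using adapted_frames_exist .
  note d = adapted_framesD[OF fr]
  \<comment> \<open>The product coordinate agrees with the pulled-back coordinate only on
    \<open>W\<close>, so locality of \<open>X\<close> is needed.\<close>
  have zx: "X (z (e, 0)) m = X (x e \<circ> fst) m" for e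
    by (rule M.vf_local[OF X d(2) pull_fst[OF d(4)] d(1) m]) (simp add: d(6))
  have zy: "X (z (0, e)) m = X (y e \<circ> snd) m" for e
    by (rule M.vf_local[OF X d(2) pull_snd[OF d(5)] d(1) m]) (simp add: d(7))
  have 1: "one.push X m (u \<circ> slice1 m) (fst m) = (\<Sum>e\<in>Basis. X (z (e, 0)) m * K (e, 0) u m)"
    unfolding d(11)[OF m one.push_VF[OF X] slice1_smooth[OF u]] zx d(8)[OF m u] by (simp add: one.push_def)
  have 2: "two.push X m (u \<circ> slice2 m) (snd m) = (\<Sum>e\<in>Basis. X (z (0, e)) m * K (0, e) u m)"
    unfolding d(12)[OF m two.push_VF[OF X] slice2_smooth[OF u]] zy d(9)[OF m u] by (simp add: two.push_def)
  show ?thesis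
    unfolding 1 2 d(10)[OF m X u] by (rule sum_Basis_prod)
qed

sublocale manifold_pair \<subseteq> complementary "prod_atlas B F" B fst "\<lambda>m b. (b, snd m)" F snd "\<lambda>m w. (fst m, w)"
  by unfold_locales (simp_all add: prod_tangent_sum)

context manifold_pair
begin

lemma push_fst_eq: "one.push X (b, w) = push_fst X w"
  by (simp add: push_fst_def one.push_def)

lemma push_snd_eq: "two.push X (b, w) = push_snd X b"
  by (simp add: push_snd_def two.push_def)

lemma hlift_eq: "hlift B F = one.form_lift"
  by (simp add: fun_eq_iff hlift_def one.form_lift_def split_beta push_fst_eq)

lemma vlift_eq: "vlift B F = two.form_lift"
  by (simp add: fun_eq_iff vlift_def two.form_lift_def split_beta push_snd_eq)

lemma warped_metric_eq:
  "warped_metric GB GF f X Y m = GB (one.push X m) (one.push Y m) (fst m) +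
    (f (fst m))\<^sup>2 * GF (two.push X m) (two.push Y m) (snd m)"
  by (cases m) (simp add: warped_metric_def push_fst_eq push_snd_eq)

end

section \<open>Casimir warping functions\<close>

context manifold_pair
begin

lemma casimir_warped_product:
  assumes GB: "pseudo_riemannian_metric B GB" and GF: "pseudo_riemannian_metric F GF"
    and PB: "poisson_bivector B PB" and PF: "poisson_bivector F PF"
    and P: "is_product_bivector B F PB PF P" "poisson_bivector M P"
    and f: "warping_function B f" "casimir B PB f"
  shows "warped_product M B fst slice1 F snd slice2 PB PF P GB GF (warped_metric GB GF f) (\<lambda>_. 1) (f \<circ> fst)"
proof -
  note P' = P(1)[unfolded is_product_bivector_def hlift_eq vlift_eq]
  interpret pB: poisson_metric B GB PB
    by unfold_locales (fact GB, fact PB)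
  interpret pF: poisson_metric F GF PF
    by unfold_locales (fact GF, fact PF)
  interpret prd: poisson_product M B fst slice1 F snd slice2 PB PF P
  proof unfold_locales
    show "bivector_field M P" by (rule P'[THEN conjunct1])
    show "P (one.form_lift \<alpha>) (one.form_lift \<beta>) = PB \<alpha> \<beta> \<circ> fst" if "\<alpha> \<in> B.OF" "\<beta> \<in> B.OF" for \<alpha> \<beta>
      by (rule P'[THEN conjunct2, THEN conjunct1, rule_format, OF that])
    show "P (one.form_lift \<alpha>) (two.form_lift \<beta>) = 0" if "\<alpha> \<in> B.OF" "\<beta> \<in> F.OF" for \<alpha> \<beta>
      by (rule P'[THEN conjunct2, THEN conjunct2, THEN conjunct1, rule_format, OF that])
    show "P (two.form_lift \<alpha>) (two.form_lift \<beta>) = PF \<alpha> \<beta> \<circ> snd" if "\<alpha> \<in> F.OF" "\<beta> \<in> F.OF" for \<alpha> \<beta>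
      by (rule P'[THEN conjunct2, THEN conjunct2, THEN conjunct2, rule_format, OF that])
  qed (rule pB.bivector pF.bivector)+
  have fC: "f \<in> B.C" and fpos: "f b > 0" for b
    using f(1) by (auto simp: warping_function_def)
  have metric: "pseudo_riemannian_metric M (warped_metric GB GF f)"
  proof (rule warped_pseudo_riemannian[OF pB.metric_manifold_axioms pF.metric_manifold_axioms fC])
    show "f b \<noteq> 0" for b using fpos[of b] by simp
  qed (rule warped_metric_eq)
  interpret pM: poisson_metric M "warped_metric GB GF f" P
    by unfold_locales (fact metric, fact P(2))
  show ?thesis
  proof unfold_locales
    show "(\<lambda>_. 1) \<in> M.C" by simp
    show "f \<circ> fst \<in> M.C" by (rule one.pull_smooth[OF fC])
    show "(f \<circ> fst) m \<noteq> 0" for m using fpos[of "fst m"] by simp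
    show "sharp M P \<gamma> (\<lambda>_. 1) = 0" if "\<gamma> \<in> M.OF" for \<gamma>
      by (rule M.vf_const[OF pM.sh_VF[OF that]])
    show "sharp M P \<gamma> (f \<circ> fst) = 0" if "\<gamma> \<in> M.OF" for \<gamma>
      by (rule prd.casimir_pull[OF f(2) that])
  qed (simp_all add: warped_metric_eq)
qed

lemma casimir_warped_scalar_curvature:
  assumes "pseudo_riemannian_metric B GB" "pseudo_riemannian_metric F GF"
    "poisson_bivector B PB" "poisson_bivector F PF"
    "is_product_bivector B F PB PF P" "poisson_bivector M P"
    "warping_function B f" "casimir B PB f"
  shows "warped_scalar_curvature B F GB GF P f m =
    scalar_curvature B PB (cometric B GB) (fst m) + (f (fst m))\<^sup>2 * scalar_curvature F PF (cometric F GF) (snd m)"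
proof -
  interpret w: warped_product M B fst slice1 F snd slice2 PB PF P GB GF "warped_metric GB GF f" "\<lambda>_. 1" "f \<circ> fst"
    by (rule casimir_warped_product[OF assms])
  show ?thesis
    unfolding warped_scalar_curvature_def using w.scalar_curvature_warped[of m] by simp
qed

text \<open>The given warping function and the one solving the curvature equation are different.
  Parallelism is known for the first only, and the second must acquire it.\<close>

lemma poisson_warped_product_transfer:
  assumes base: "pseudo_riemannian_metric B GB" "pseudo_riemannian_metric F GF"
    "poisson_bivector B PB" "poisson_bivector F PF" "is_product_bivector B F PB PF P"
    and f: "poisson_warped_product B F GB GF P f" "casimir B PB f"
    and \<phi>: "warping_function B \<phi>" "casimir B PB \<phi>"
  shows "poisson_warped_product B F GB GF P \<phi>"
proof -
  have wf: "warping_function B f" and prp: "pseudo_riemannian_poisson M P (warped_metric GB GF f)"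
    using f(1) by (auto simp: poisson_warped_product_def)
  note pr = prp[unfolded pseudo_riemannian_poisson_def]
  have PM: "poisson_bivector M P" by (rule pr[THEN conjunct2, THEN conjunct1])
  note w = casimir_warped_product[OF base PM]
  interpret wf: warped_product M B fst slice1 F snd slice2 PB PF P GB GF "warped_metric GB GF f" "\<lambda>_. 1" "f \<circ> fst"
    by (rule w[OF wf f(2)])
  interpret w\<phi>: warped_product M B fst slice1 F snd slice2 PB PF P GB GF "warped_metric GB GF \<phi>" "\<lambda>_. 1" "\<phi> \<circ> fst"
    by (rule w[OF \<phi>])
  have par: "wf.pm.parallel_defect x y z = 0" if "x \<in> M.OF" "y \<in> M.OF" "z \<in> M.OF" for x y z
    unfolding wf.pm.parallel_defect_def
    by (rule pr[THEN conjunct2, THEN conjunct2, rule_format, OF that])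
  have "w\<phi>.pm.parallel_defect x y z = 0" if "x \<in> M.OF" "y \<in> M.OF" "z \<in> M.OF" for x y z
    by (rule wf.parallel_transfer[OF w\<phi>.warped_product_axioms par that])
  then have "pseudo_riemannian_poisson M P (warped_metric GB GF \<phi>)"
    unfolding pseudo_riemannian_poisson_def w\<phi>.pm.parallel_defect_def
    using PM w\<phi>.pm.metric by blast
  then show ?thesis using \<phi>(1) by (simp add: poisson_warped_product_def)
qed

end

text \<open>The curvature formula is available for Casimir warping functions, so the equation to
  solve is \<open>S\<^sub>B + \<psi>\<^sup>2 * \<mu> = \<mu>1\<close> within that class. Cases (a)
  and (b) are the two sign patterns that make the radicand positive.\<close>

theorem theorem3p7:
  fixes B :: "('a::{second_countable_topology,t2_space}, 'e::euclidean_space) atlas"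
    and F :: "('b::{second_countable_topology,t2_space}, 'f::euclidean_space) atlas"
    and GB :: "'a metric" and GF :: "'b metric"
    and PB :: "'a bivector" and PF :: "'b bivector" and P :: "('a \<times> 'b) bivector"
    and f :: "'a \<Rightarrow> real" and \<mu> \<mu>1 :: real
  assumes "smooth_manifold B" and "smooth_manifold F"
    and "pseudo_riemannian_metric B GB" and "pseudo_riemannian_metric F GF"
    and "poisson_bivector B PB" and "poisson_bivector F PF"
    and "is_product_bivector B F PB PF P"
    and "poisson_warped_product B F GB GF P f" and "casimir B PB f"
    and "DIM('f) > 1"
    and "\<forall>w. scalar_curvature F PF (cometric F GF) w = \<mu>" and "\<mu> \<noteq> 0"
  shows "let S\<^sub>B = scalar_curvature B PB (cometric B GB);
             \<phi> = (\<lambda>b. sqrt ((\<mu>1 - S\<^sub>B b) / \<mu>)) in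
         ((\<forall>b. \<mu>1 > S\<^sub>B b) \<and> \<mu> > 0 \<longrightarrow>
            warping_function B \<phi> \<and>
            (casimir B PB \<phi> \<longrightarrow> casimir_warping_with_scalar B F GB GF PB P \<mu>1 \<phi>) \<and>
            (\<forall>\<psi>. casimir_warping_with_scalar B F GB GF PB P \<mu>1 \<psi> \<longrightarrow> \<psi> = \<phi>)) \<and>
         ((\<forall>b. \<mu>1 < S\<^sub>B b) \<and> \<mu> < 0 \<longrightarrow>
            warping_function B \<phi> \<and>
            (casimir B PB \<phi> \<longrightarrow> casimir_warping_with_scalar B F GB GF PB P \<mu>1 \<phi>) \<and>
            (\<forall>\<psi>. casimir_warping_with_scalar B F GB GF PB P \<mu>1 \<psi> \<longrightarrow> \<psi> = \<phi>)) \<and>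
         ((\<forall>b. \<mu>1 = S\<^sub>B b) \<longrightarrow> (\<nexists>\<psi>. casimir_warping_with_scalar B F GB GF PB P \<mu>1 \<psi>))"
proof -
  interpret manifold_pair B F by unfold_locales (fact assms(1), fact assms(2))
  interpret pB: poisson_metric B GB PB by unfold_locales (fact assms(3), fact assms(5))
  define S where "S = scalar_curvature B PB (cometric B GB)"
  define \<phi> where "\<phi> = (\<lambda>b. sqrt ((\<mu>1 - S b) / \<mu>))"
  have PM: "poisson_bivector M P"
    using assms(8) by (simp add: poisson_warped_product_def pseudo_riemannian_poisson_def)
  have curv: "warped_scalar_curvature B F GB GF P \<psi> m = S (fst m) + (\<psi> (fst m))\<^sup>2 * \<mu>"
    if "warping_function B \<psi>" "casimir B PB \<psi>" for \<psi> m
    using casimir_warped_scalar_curvature[OF assms(3-7) PM that, of m] assms(11) by (simp add: S_def)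
  have eq: "S b + (\<psi> b)\<^sup>2 * \<mu> = \<mu>1 \<and> \<psi> b > 0"
    if "casimir_warping_with_scalar B F GB GF PB P \<mu>1 \<psi>" for \<psi> b
  proof -
    have \<psi>: "warping_function B \<psi>" "casimir B PB \<psi>"
      "\<And>x. warped_scalar_curvature B F GB GF P \<psi> x = \<mu>1"
      using that by (auto simp: casimir_warping_with_scalar_def poisson_warped_product_def)
    show ?thesis
      \<comment> \<open>\<open>undefined\<close> is an arbitrary point of the fibre; the curvature
        depends only on the base point.\<close>
      using curv[OF \<psi>(1,2), of "(b, undefined)"] \<psi>(3)[of "(b, undefined)"] \<psi>(1)
      by (simp add: warping_function_def)
  qed
  have main: "warping_function B \<phi> \<and>
      (casimir B PB \<phi> \<longrightarrow> casimir_warping_with_scalar B F GB GF PB P \<mu>1 \<phi>) \<and>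
      (\<forall>\<psi>. casimir_warping_with_scalar B F GB GF PB P \<mu>1 \<psi> \<longrightarrow> \<psi> = \<phi>)"
    if pos: "\<And>b. (\<mu>1 - S b) / \<mu> > 0"
  proof (intro conjI impI allI)
    have "S \<in> B.C" unfolding S_def by (rule pB.scalar_curvature_smooth)
    then have "((\<lambda>_. \<mu>1) - S) * (\<lambda>_. 1 / \<mu>) \<in> B.C" by simp
    moreover have "((\<lambda>_. \<mu>1) - S) * (\<lambda>_. 1 / \<mu>) = (\<lambda>b. (\<mu>1 - S b) / \<mu>)" by (simp add: fun_eq_iff)
    ultimately have "(\<lambda>b. (\<mu>1 - S b) / \<mu>) \<in> B.C" by simp
    \<comment> \<open>A positive radicand keeps the square root away from \<open>0\<close>, where it
      fails to be differentiable.\<close>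
    then have "\<phi> \<in> B.C" unfolding \<phi>_def using pos by (rule B.smooth_functions_sqrt)
    then show wphi: "warping_function B \<phi>"
      using pos by (simp add: warping_function_def \<phi>_def)
    show "casimir_warping_with_scalar B F GB GF PB P \<mu>1 \<phi>" if c: "casimir B PB \<phi>"
    proof -
      have "(\<phi> b)\<^sup>2 = (\<mu>1 - S b) / \<mu>" for b
        using pos[of b] by (simp add: \<phi>_def)
      then have "warped_scalar_curvature B F GB GF P \<phi> m = \<mu>1" for m
        using curv[OF wphi c, of m] assms(12) by simp
      then show ?thesis
        using poisson_warped_product_transfer[OF assms(3-9) wphi c] c
        by (simp add: casimir_warping_with_scalar_def)
    qed
    show "\<psi> = \<phi>" if "casimir_warping_with_scalar B F GB GF PB P \<mu>1 \<psi>" for \<psi>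
    proof
      fix b
      have "(\<psi> b)\<^sup>2 = (\<mu>1 - S b) / \<mu>" "\<psi> b > 0"
        using eq[OF that, of b] assms(12) by (auto simp: field_simps)
      then show "\<psi> b = \<phi> b" by (simp add: \<phi>_def real_sqrt_unique[symmetric])
    qed
  qed
  have a: "(\<mu>1 - S b) / \<mu> > 0" if "(\<forall>b. \<mu>1 > S b) \<and> \<mu> > 0" for b using that by simp
  have b: "(\<mu>1 - S b) / \<mu> > 0" if "(\<forall>b. \<mu>1 < S b) \<and> \<mu> < 0" for b using that by (simp add: divide_neg_neg)
  have c: "\<nexists>\<psi>. casimir_warping_with_scalar B F GB GF PB P \<mu>1 \<psi>" if "\<forall>b. \<mu>1 = S b"
  proof
    assume "\<exists>\<psi>. casimir_warping_with_scalar B F GB GF PB P \<mu>1 \<psi>"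
    then obtain \<psi> where "casimir_warping_with_scalar B F GB GF PB P \<mu>1 \<psi>" by blast
    \<comment> \<open>At any base point the equation would force
      \<open>\<psi>\<^sup>2 * \<mu> = 0\<close>, although \<open>\<psi>\<close> is positive and
      \<open>\<mu>\<close> nonzero.\<close>
    from eq[OF this, of undefined] that assms(12) show False by simp
  qed
  show ?thesis
    unfolding Let_def S_def[symmetric] \<phi>_def[symmetric]
    using main[OF a] main[OF b] c by (intro conjI[OF impI conjI[OF impI impI]])
qed

end
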